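(* Consider the semilinear Kohn-Laplace equation $\Delta_{H^1}u+f(u)=0$ for $u=u(x,y,t)$, that is, $$u_{xx}+u_{yy}+4(x^2+y^2)u_{tt}+4y\,u_{xt}-4x\,u_{yt}+f(u)=0 .$$ The widest Lie point symmetry group of this equation with arbitrary $f(u)$ is determined by the operators $$T=\frac{\partial}{\partial t},\qquad R=y\frac{\partial}{\partial x}-x\frac{\partial}{\partial y},\qquad \tilde X=\frac{\partial}{\partial x}-2y\frac{\partial}{\partial t},\qquad \tilde Y=\frac{\partial}{\partial y}+2x\frac{\partial}{\partial t}, \qquad ( * )$$ i.e. the infinitesimal symmetries admitted for arbitrary $f$ are exactly the real linear combinations of $T,R,\tilde X,\tilde Y$ (a translation in $t$, a rotation in the $x$-$y$ plane, and the generators of right multiplication in $H^1$). For the following special choices of $f$ the symmetry group is extended; in each case the Lie algebra of infinitesimal symmetries is generated by the operators $( * )$ together with the additional generators listed. (i) If $f(u)=0$, the additional generators are $$V_1=(xt-x^2y-y^3)\frac{\partial}{\partial x}+(yt+x^3+xy^2)\frac{\partial}{\partial y}+\bigl(t^2-(x^2+y^2)^2\bigr)\frac{\partial}{\partial t}-tu\frac{\partial}{\partial u},$$ $$V_2=(t-4xy)\frac{\partial}{\partial x}+(3x^2-y^2)\frac{\partial}{\partial y}-(2yt+2x^3+2xy^2)\frac{\partial}{\partial t}+2yu\frac{\partial}{\partial u},$$ $$V_3=(x^2-3y^2)\frac{\partial}{\partial x}+(t+4xy)\frac{\partial}{\partial y}+(2xt-2x^2y-2y^3)\frac{\partial}{\partial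 t}-2xu\frac{\partial}{\partial u},$$ $$Z_1=x\frac{\partial}{\partial x}+y\frac{\partial}{\partial y}+2t\frac{\partial}{\partial t},\qquad Z_2=u\frac{\partial}{\partial u},\qquad W=\beta(x,y,t)\frac{\partial}{\partial u},$$ where $\beta$ is any function satisfying $\Delta_{H^1}\beta=0$. (ii) If $f(u)=c$ is constant, this case is reduced to case (i) by the change $u=v-cx^2/2$ (i.e. $u$ satisfies $\Delta_{H^1}u+c=0$ if and only if $v$ satisfies $\Delta_{H^1}v=0$). (iii) If $f(u)=ku$ with $k\neq 0$ constant, the additional generators are $$Z_2=u\frac{\partial}{\partial u},\qquad W=\beta(x,y,t)\frac{\partial}{\partial u},$$ where $\beta$ is any function satisfying $\Delta_{H^1}\beta+k\beta=0$. (iv) If $f(u)=ku^p$ with $k\ne 0$ constant and $p\neq 0$, $p\neq 1$, there is the additional generator of dilations $$Z=x\frac{\partial}{\partial x}+y\frac{\partial}{\partial y}+2t\frac{\partial}{\partial t}+\frac{2}{1-p}\,u\frac{\partial}{\partial u};$$ for $p\ne 3$ it is the only additional generator, and in the critical case $f(u)=ku^3$ there are three further additional generators, namely the operators $V_1,V_2,V_3$ given in (i). (v) If $f(u)=ke^u$ with $k\neq 0$ constant, the additional generator is $$Z_3=x\frac{\partial}{\partial x}+y\frac{\partial}{\partial y}+2t\frac{\partial}{\partial t}-2\frac{\partial}{\partial u}.$$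
   Context: The Heisenberg group $H^1$ is $\mathbb{R}^3$ with product $(x,y,t)(x^0,y^0,t^0)=(x+x^0,\,y+y^0,\,t+t^0+2(yx^0-xy^0))$. The Kohn-Laplace operator on $H^1$ is $\Delta_{H^1}=X^2+Y^2$, where $X=\frac{\partial}{\partial x}+2y\frac{\partial}{\partial t}$ and $Y=\frac{\partial}{\partial y}-2x\frac{\partial}{\partial t}$. All functions are assumed sufficiently smooth (e.g. $C^\infty$). An infinitesimal (Lie point) symmetry of the equation is a vector field $$S=\xi\frac{\partial}{\partial x}+\phi\frac{\partial}{\partial y}+\tau\frac{\partial}{\partial t}+\eta\frac{\partial}{\partial u},$$ with $\xi,\phi,\tau,\eta$ smooth functions of $(x,y,t,u)$ (for $(x,y,t)\in\mathbb{R}^3$ and $u$ in an open interval on which $f$ is defined and smooth), such that $\hat S H=0$ whenever $H=0$, where $H=\Delta_{H^1}u+f(u)$ is regarded as a function of the independent jet variables $x,y,t,u$ and the first and second derivatives of $u$, and $\hat S$ is the standard second-order extension (second prolongation) of $S$ to these jet variables. A (local) Lie point symmetry group is "determined by" its infinitesimal generators. A symmetry admitted "for arbitrary $f$" is a vector field $S$ which is an infinitesimal symmetry of the equation for every smooth function $f$. In (iv), $p$ is a real number and $u$ ranges over an interval on which $u^p$ is defined and smooth (e.g. $u>0$ for non-integer $p$). *)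

theory Defs
  imports "HOL-Analysis.Analysis"
begin

section \<open>Smooth functions\<close>

(* Only meant for open S: derivatives are taken in a full neighbourhood of each point. *)
primrec Ck_on :: "nat \<Rightarrow> 'a::real_normed_vector set \<Rightarrow> ('a \<Rightarrow> 'b::real_normed_vector) \<Rightarrow> bool" where
  "Ck_on 0 S g \<longleftrightarrow> continuous_on S g"
| "Ck_on (Suc k) S g \<longleftrightarrow>
     (\<forall>x\<in>S. g differentiable (at x)) \<and>
     (\<forall>v. Ck_on k S (\<lambda>x. frechet_derivative g (at x) v))"

definition smooth_on :: "'a::real_normed_vector set \<Rightarrow> ('a \<Rightarrow> 'b::real_normed_vector) \<Rightarrow> bool" where
  "smooth_on S g \<longleftrightarrow> (\<forall>k. Ck_on k S g)"

section \<open>The Kohn-Laplace operator\<close>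

(* A point (x, y, t) of the Heisenberg group is z :: real^3 with x = z$1, y = z$2, t = z$3. *)
definition partial :: "3 \<Rightarrow> (real^3 \<Rightarrow> real) \<Rightarrow> real^3 \<Rightarrow> real" where
  "partial i g z = frechet_derivative g (at z) (axis i 1)"

definition heis_X :: "(real^3 \<Rightarrow> real) \<Rightarrow> real^3 \<Rightarrow> real" where
  "heis_X g z = partial 1 g z + 2 * z$2 * partial 3 g z"

definition heis_Y :: "(real^3 \<Rightarrow> real) \<Rightarrow> real^3 \<Rightarrow> real" where
  "heis_Y g z = partial 2 g z - 2 * z$1 * partial 3 g z"

definition kohn_laplace :: "(real^3 \<Rightarrow> real) \<Rightarrow> real^3 \<Rightarrow> real" where
  "kohn_laplace g z = heis_X (heis_X g) z + heis_Y (heis_Y g) z"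

section \<open>Jets, vector fields and their prolongation\<close>

(* jets of order 0, 1 and 2: (z, u), (z, u, p) and (z, u, p, q), where p$i and q$i$j stand for
   the first and second derivatives of u; actual 2-jets have a symmetric q *)
type_synonym jet0 = "(real^3) \<times> real"
type_synonym jet1 = "(real^3) \<times> real \<times> (real^3)"
type_synonym jet2 = "(real^3) \<times> real \<times> (real^3) \<times> (real^3^3)"

(* S w = (\<chi> i. xi^i, eta) represents xi^1 d/dx + xi^2 d/dy + xi^3 d/dt + eta d/du at w = (z, u). *)
type_synonym vfield = "jet0 \<Rightarrow> jet0"

definition jet2_of :: "(real^3 \<Rightarrow> real) \<Rightarrow> real^3 \<Rightarrow> jet2" where
  "jet2_of u z = (z, u z, (\<chi> i. partial i u z), (\<chi> i j. partial j (partial i u) z))"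

(* D_i g = g_i + p_i g_u *)
definition total_deriv0 :: "3 \<Rightarrow> (jet0 \<Rightarrow> real) \<Rightarrow> jet1 \<Rightarrow> real" where
  "total_deriv0 i g = (\<lambda>(z, u, p). frechet_derivative g (at (z, u)) (axis i 1, p$i))"

(* D_i g = g_i + p_i g_u + (\<Sum>k. q_ik g_{p_k}) *)
definition total_deriv1 :: "3 \<Rightarrow> (jet1 \<Rightarrow> real) \<Rightarrow> jet2 \<Rightarrow> real" where
  "total_deriv1 i g = (\<lambda>(z, u, p, q). frechet_derivative g (at (z, u, p)) (axis i 1, p$i, q$i))"

(* eta_i = D_i eta - (\<Sum>j. p_j D_i xi^j) *)
definition prolong_coeff1 :: "vfield \<Rightarrow> 3 \<Rightarrow> jet1 \<Rightarrow> real" where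
  "prolong_coeff1 S i = (\<lambda>(z, u, p).
     total_deriv0 i (\<lambda>w. snd (S w)) (z, u, p)
     - (\<Sum>j\<in>UNIV. p$j * total_deriv0 i (\<lambda>w. fst (S w) $ j) (z, u, p)))"

(* eta_ij = D_j eta_i - (\<Sum>k. q_ik D_j xi^k) *)
definition prolong_coeff2 :: "vfield \<Rightarrow> 3 \<Rightarrow> 3 \<Rightarrow> jet2 \<Rightarrow> real" where
  "prolong_coeff2 S i j = (\<lambda>(z, u, p, q).
     total_deriv1 j (prolong_coeff1 S i) (z, u, p, q)
     - (\<Sum>k\<in>UNIV. q$i$k * total_deriv0 j (\<lambda>w. fst (S w) $ k) (z, u, p)))"

definition prolong2 :: "vfield \<Rightarrow> jet2 \<Rightarrow> jet2" where
  "prolong2 S = (\<lambda>(z, u, p, q).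
     (fst (S (z, u)), snd (S (z, u)),
      (\<chi> i. prolong_coeff1 S i (z, u, p)),
      (\<chi> i j. prolong_coeff2 S i j (z, u, p, q))))"

section \<open>Infinitesimal symmetries\<close>

definition heis_eq :: "(real \<Rightarrow> real) \<Rightarrow> jet2 \<Rightarrow> real" where
  "heis_eq f = (\<lambda>(z, u, p, q).
     q$1$1 + q$2$2 + 4 * ((z$1)^2 + (z$2)^2) * q$3$3
     + 4 * z$2 * q$1$3 - 4 * z$1 * q$2$3 + f u)"

(* At a jet with symmetric q the prolonged field is tangent to the space of symmetric jets, so its
   action on H is the derivative of H in its direction, however H is extended to arbitrary q. *)
definition inf_symmetry :: "real set \<Rightarrow> (real \<Rightarrow> real) \<Rightarrow> vfield \<Rightarrow> bool" where
  "inf_symmetry I f S \<longleftrightarrow>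
     smooth_on (UNIV \<times> I) S \<and>
     (\<forall>z u p q. u \<in> I \<and> transpose q = q \<and> heis_eq f (z, u, p, q) = 0 \<longrightarrow>
        frechet_derivative (heis_eq f) (at (z, u, p, q)) (prolong2 S (z, u, p, q)) = 0)"

definition symmetries :: "real set \<Rightarrow> (real \<Rightarrow> real) \<Rightarrow> vfield set" where
  "symmetries I f = {S. inf_symmetry I f S}"

(* vector fields that agree on UNIV \<times> I with a (finite) real linear combination of members of B;
   their values for u outside I are irrelevant *)
definition vf_span :: "real set \<Rightarrow> vfield set \<Rightarrow> vfield set" where
  "vf_span I B = {S. \<exists>F c. finite F \<and> F \<subseteq> B \<and>
     (\<forall>w \<in> UNIV \<times> I. S w = (\<Sum>G\<in>F. c G *\<^sub>R G w))}"

section \<open>The generators\<close>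

definition vf :: "(real \<Rightarrow> real \<Rightarrow> real \<Rightarrow> real \<Rightarrow> real) \<Rightarrow> (real \<Rightarrow> real \<Rightarrow> real \<Rightarrow> real \<Rightarrow> real) \<Rightarrow>
    (real \<Rightarrow> real \<Rightarrow> real \<Rightarrow> real \<Rightarrow> real) \<Rightarrow> (real \<Rightarrow> real \<Rightarrow> real \<Rightarrow> real \<Rightarrow> real) \<Rightarrow> vfield" where
  "vf \<xi> \<phi> \<tau> \<eta> = (\<lambda>(z, u).
     (vector [\<xi> (z$1) (z$2) (z$3) u, \<phi> (z$1) (z$2) (z$3) u, \<tau> (z$1) (z$2) (z$3) u],
      \<eta> (z$1) (z$2) (z$3) u))"

definition gen_T :: vfield where
  "gen_T = vf (\<lambda>x y t u. 0) (\<lambda>x y t u. 0) (\<lambda>x y t u. 1) (\<lambda>x y t u. 0)"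

definition gen_R :: vfield where
  "gen_R = vf (\<lambda>x y t u. y) (\<lambda>x y t u. - x) (\<lambda>x y t u. 0) (\<lambda>x y t u. 0)"

definition gen_Xt :: vfield where
  "gen_Xt = vf (\<lambda>x y t u. 1) (\<lambda>x y t u. 0) (\<lambda>x y t u. - 2 * y) (\<lambda>x y t u. 0)"

definition gen_Yt :: vfield where
  "gen_Yt = vf (\<lambda>x y t u. 0) (\<lambda>x y t u. 1) (\<lambda>x y t u. 2 * x) (\<lambda>x y t u. 0)"

definition basic_gens :: "vfield set" where
  "basic_gens = {gen_T, gen_R, gen_Xt, gen_Yt}"

definition gen_V1 :: vfield where
  "gen_V1 = vf (\<lambda>x y t u. x * t - x^2 * y - y^3)
               (\<lambda>x y t u. y * t + x^3 + x * y^2)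
               (\<lambda>x y t u. t^2 - (x^2 + y^2)^2)
               (\<lambda>x y t u. - t * u)"

definition gen_V2 :: vfield where
  "gen_V2 = vf (\<lambda>x y t u. t - 4 * x * y)
               (\<lambda>x y t u. 3 * x^2 - y^2)
               (\<lambda>x y t u. - (2 * y * t + 2 * x^3 + 2 * x * y^2))
               (\<lambda>x y t u. 2 * y * u)"

definition gen_V3 :: vfield where
  "gen_V3 = vf (\<lambda>x y t u. x^2 - 3 * y^2)
               (\<lambda>x y t u. t + 4 * x * y)
               (\<lambda>x y t u. 2 * x * t - 2 * x^2 * y - 2 * y^3)
               (\<lambda>x y t u. - 2 * x * u)"

definition gen_Z1 :: vfield where
  "gen_Z1 = vf (\<lambda>x y t u. x) (\<lambda>x y t u. y) (\<lambda>x y t u. 2 * t) (\<lambda>x y t u. 0)"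

definition gen_Z2 :: vfield where
  "gen_Z2 = vf (\<lambda>x y t u. 0) (\<lambda>x y t u. 0) (\<lambda>x y t u. 0) (\<lambda>x y t u. u)"

definition gen_Z3 :: vfield where
  "gen_Z3 = vf (\<lambda>x y t u. x) (\<lambda>x y t u. y) (\<lambda>x y t u. 2 * t) (\<lambda>x y t u. - 2)"

definition gen_Z :: "real \<Rightarrow> vfield" where
  "gen_Z p = vf (\<lambda>x y t u. x) (\<lambda>x y t u. y) (\<lambda>x y t u. 2 * t) (\<lambda>x y t u. 2 / (1 - p) * u)"

definition gen_W :: "(real^3 \<Rightarrow> real) \<Rightarrow> vfield" where
  "gen_W \<beta> = (\<lambda>(z, u). (0, \<beta> z))"

section \<open>Real powers\<close>

(* u^p for real p: integer exponents make sense for negative u as well, where powr is not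
   the usual power *)
definition real_power :: "real \<Rightarrow> real \<Rightarrow> real" where
  "real_power p u = (if p \<in> \<int> then u powi \<lfloor>p\<rfloor> else u powr p)"

(* u^p is defined and smooth on I *)
definition power_domain :: "real \<Rightarrow> real set \<Rightarrow> bool" where
  "power_domain p I \<longleftrightarrow> I \<subseteq> {0<..} \<or> (p \<in> \<int> \<and> (p \<ge> 0 \<or> 0 \<notin> I))"

end

theory Submission
  imports Defs
begin

text \<open>In terms of the left-invariant fields \<open>X\<close>, \<open>Y\<close> and \<open>T = \<partial>/\<partial>t\<close>, which satisfy \<open>[X, Y] = -4T\<close>, the equation reads
\<open>L u + f(u) = 0\<close> with \<open>L = X\<^sup>2 + Y\<^sup>2\<close>.  Its symbol \<open>X \<otimes> X + Y \<otimes> Y\<close> has rank two, and in coordinates \<open>L\<close> has no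
first-order part.  The symmetry condition is a polynomial in the derivatives \<open>p\<close>, \<open>q\<close> of \<open>u\<close>, subject only to
the equation itself, so it splits into coefficients.

The mixed terms in \<open>p\<close> and \<open>q\<close> pair the symbol applied to \<open>p\<close> with \<open>\<partial>\<xi>/\<partial>u\<close>; a symmetric product of two vectors is
indefinite or of rank at most one, hence a multiple of the symbol only if it vanishes.  Hence \<open>\<partial>\<xi>/\<partial>u = 0\<close>, and
then the terms quadratic in \<open>p\<close> give \<open>\<eta> = \<alpha> u + \<beta>\<close> (lemmas \<open>du_xi_zero\<close>, \<open>du_du_eta_zero\<close>).  What is left says
that \<open>\<xi>\<close> is conformal for the symbol, that \<open>L \<xi>\<close> prescribes \<open>X \<alpha>\<close> and \<open>Y \<alpha>\<close>, and that one scalar equation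
relates \<open>\<alpha>\<close>, \<open>\<beta>\<close> and \<open>f\<close> (lemma \<open>symmetry_iff_determining\<close>).

Conformal fields are rigid.  Writing \<open>\<xi> = A X + B Y + C T\<close>, conformality amounts to \<open>4 B = X C\<close>, \<open>4 A = - Y C\<close>,
\<open>X X C = Y Y C\<close> and \<open>X Y C = - Y X C\<close>.  The commutation relation turns every third-order derivative of \<open>C\<close> along \<open>X\<close> and \<open>Y\<close> into a
multiple of \<open>X T C\<close> or \<open>Y T C\<close>, and computing the commutator of \<open>Y\<close> and \<open>X\<close> on \<open>X X C\<close> in two ways forces
\<open>X X T C = 0\<close>.  So \<open>C\<close> is a polynomial with eight free coefficients (lemma \<open>contact_potential_polynomial\<close>), which
are the coefficients of \<open>T\<close>, \<open>R\<close>, the two right multiplications, \<open>V\<^sub>1\<close>, \<open>V\<^sub>2\<close>, \<open>V\<^sub>3\<close> and \<open>Z\<^sub>1\<close>; the constant of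
integration of \<open>\<alpha>\<close> is the coefficient of \<open>Z\<^sub>2\<close>.

Thus every symmetry for any \<open>f\<close> is one of the symmetries for \<open>f = 0\<close> up to the choice of \<open>\<beta>\<close>, and \<open>f\<close> enters only
through the equation \<open>f' ((e - w) u + \<beta>) + L \<beta> - (e - 3 w - 2 s) f = 0\<close>, where \<open>e\<close> and \<open>s\<close> are the coefficients
of \<open>Z\<^sub>2\<close> and \<open>Z\<^sub>1\<close> and \<open>w\<close> is linear in \<open>(x, y, t)\<close> (lemma \<open>symmetry_characterization\<close>).  For the listed \<open>f\<close>
it is solved by the linear independence of the functions of \<open>u\<close> that occur; since \<open>w\<close> has no constant term, it
vanishes as soon as it is constant, which is why among the listed non-constant \<open>f\<close> only \<open>k u\<^sup>3\<close> retains
\<open>V\<^sub>1\<close>, \<open>V\<^sub>2\<close>, \<open>V\<^sub>3\<close>.\<close>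

section \<open>Directional derivatives and smooth functions\<close>

definition dird :: "'a::real_normed_vector \<Rightarrow> ('a \<Rightarrow> 'b::real_normed_vector) \<Rightarrow> 'a \<Rightarrow> 'b" where
  "dird v g x = frechet_derivative g (at x) v"

lemma dirdI: "(g has_derivative g') (at x) \<Longrightarrow> dird v g x = g' v"
  by (simp add: dird_def flip: frechet_derivative_at)

lemma has_derivative_dird:
  "g differentiable (at x) \<Longrightarrow> (g has_derivative (\<lambda>v. dird v g x)) (at x)"
  by (simp add: dird_def[abs_def] frechet_derivative_works)

text \<open>At a point where the functions are not differentiable, both sides are the same arbitrary choice.\<close>

lemma dird_cong:
  assumes "open S" "x \<in> S" "\<And>y. y \<in> S \<Longrightarrow> f y = g y"
  shows "dird v f x = dird v g x"
proof -
  have "(f has_derivative f') (at x) \<longleftrightarrow> (g has_derivative f') (at x)" for f'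
    using assms by (metis has_derivative_transform_within_open)
  then show ?thesis by (simp add: dird_def frechet_derivative_def)
qed

lemma differentiable_cong_open:
  assumes "f differentiable (at x)" "open S" "x \<in> S" "\<And>y. y \<in> S \<Longrightarrow> f y = g y"
  shows "g differentiable (at x)"
  using assms unfolding differentiable_def by (metis has_derivative_transform_within_open)

lemma dird_add_left:
  "g differentiable (at x) \<Longrightarrow> dird (v + w) g x = dird v g x + dird w g x"
  by (simp add: dird_def linear_add linear_frechet_derivative)

lemma dird_scaleR_left:
  "g differentiable (at x) \<Longrightarrow> dird (c *\<^sub>R v) g x = c *\<^sub>R dird v g x"
  by (simp add: dird_def linear_scale linear_frechet_derivative)

lemma dird_const [simp]: "dird v (\<lambda>x. c) x = 0"
  by (simp add: dird_def)

lemma dird_bounded_linear: "bounded_linear g \<Longrightarrow> dird v g x = g v"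
  by (simp add: dirdI bounded_linear_imp_has_derivative)

lemma dird_add:
  "f differentiable (at x) \<Longrightarrow> g differentiable (at x) \<Longrightarrow>
   dird v (\<lambda>x. f x + g x) x = dird v f x + dird v g x"
  by (rule dirdI, intro has_derivative_add has_derivative_dird)

lemma dird_diff:
  "f differentiable (at x) \<Longrightarrow> g differentiable (at x) \<Longrightarrow>
   dird v (\<lambda>x. f x - g x) x = dird v f x - dird v g x"
  by (rule dirdI, intro has_derivative_diff has_derivative_dird)

lemma dird_mult:
  fixes f g :: "'a::real_normed_vector \<Rightarrow> real"
  shows "f differentiable (at x) \<Longrightarrow> g differentiable (at x) \<Longrightarrow>
   dird v (\<lambda>x. f x * g x) x = f x * dird v g x + dird v f x * g x"
  by (rule dirdI, intro has_derivative_mult has_derivative_dird)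

lemma dird_bounded_linear_comp:
  "bounded_linear L \<Longrightarrow> g differentiable (at x) \<Longrightarrow> dird v (\<lambda>x. L (g x)) x = L (dird v g x)"
  by (rule dirdI[OF bounded_linear.has_derivative[OF _ has_derivative_dird]])

lemma dird_affine_comp:
  assumes "bounded_linear L" "g differentiable (at (L x + b))"
  shows "dird v (\<lambda>x. g (L x + b)) x = dird (L v) g (L x + b)"
proof -
  have "((\<lambda>x. L x + b) has_derivative L) (at x)"
    using has_derivative_add_const bounded_linear_imp_has_derivative[OF assms(1)] by blast
  from diff_chain_at[OF this has_derivative_dird[OF assms(2)]] show ?thesis
    by (simp add: dirdI o_def)
qed

lemma Ck_on_Suc_dird:
  "Ck_on (Suc k) S g \<longleftrightarrow> (\<forall>x\<in>S. g differentiable (at x)) \<and> (\<forall>v. Ck_on k S (dird v g))"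
  by (simp add: dird_def[abs_def])

lemma Ck_on_imp: "Ck_on (Suc k) S g \<Longrightarrow> Ck_on k S g"
proof (induction k arbitrary: g)
  case 0
  then show ?case
    by (auto simp: continuous_on_eq_continuous_at continuous_at_imp_continuous_on differentiable_imp_continuous_within)
next
  case (Suc k)
  then show ?case unfolding Ck_on_Suc_dird[of "Suc k"] Ck_on_Suc_dird[of k] by blast
qed

lemma Ck_on_cong:
  assumes "open S"
  shows "Ck_on k S f \<Longrightarrow> (\<And>x. x \<in> S \<Longrightarrow> f x = g x) \<Longrightarrow> Ck_on k S g"
proof (induction k arbitrary: f g)
  case 0
  then show ?case by (simp cong: continuous_on_cong)
next
  case (Suc k)
  have "g differentiable (at x)" if "x \<in> S" for x
    using Suc.prems assms that differentiable_cong_open[of f x S g] by auto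
  moreover have "Ck_on k S (dird v g)" for v
    using Suc.IH[of "dird v f" "dird v g"] Suc.prems dird_cong[OF assms]
    unfolding Ck_on_Suc_dird by blast
  ultimately show ?case unfolding Ck_on_Suc_dird by blast
qed

lemma smooth_on_cong:
  "open S \<Longrightarrow> smooth_on S f \<Longrightarrow> (\<And>x. x \<in> S \<Longrightarrow> f x = g x) \<Longrightarrow> smooth_on S g"
  unfolding smooth_on_def by (meson Ck_on_cong)

lemma smooth_on_differentiable: "smooth_on S g \<Longrightarrow> x \<in> S \<Longrightarrow> g differentiable (at x)"
  unfolding smooth_on_def by (metis Ck_on.simps(2))

lemma smooth_on_dird: "smooth_on S g \<Longrightarrow> smooth_on S (dird v g)"
  unfolding smooth_on_def by (metis Ck_on_Suc_dird)

lemma Ck_on_const: "Ck_on k S (\<lambda>x. c)"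
  by (induction k arbitrary: c) auto

lemma smooth_on_const [simp]: "smooth_on S (\<lambda>x. c)"
  by (simp add: smooth_on_def Ck_on_const)

lemma smooth_on_bounded_linear: "bounded_linear g \<Longrightarrow> smooth_on S g"
proof -
  assume g: "bounded_linear g"
  have "Ck_on k S g" for k
  proof (cases k)
    case 0
    then show ?thesis using g linear_continuous_on by auto
  next
    case (Suc n)
    have "dird v g = (\<lambda>x. g v)" for v using g by (simp add: dird_bounded_linear fun_eq_iff)
    then show ?thesis unfolding Suc Ck_on_Suc_dird
      using g by (simp add: bounded_linear_imp_differentiable Ck_on_const)
  qed
  then show ?thesis by (simp add: smooth_on_def)
qed

lemma Ck_on_add:
  assumes "open S"
  shows "Ck_on k S f \<Longrightarrow> Ck_on k S g \<Longrightarrow> Ck_on k S (\<lambda>x. f x + g x)"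
proof (induction k arbitrary: f g)
  case 0
  then show ?case by (simp add: continuous_on_add)
next
  case (Suc k)
  have "Ck_on k S (dird v (\<lambda>x. f x + g x))" for v
    by (rule Ck_on_cong[OF assms Suc.IH[of "dird v f" "dird v g"]])
       (use Suc.prems in \<open>auto simp: Ck_on_Suc_dird dird_add simp del: Ck_on.simps(2)\<close>)
  then show ?case using Suc.prems by (auto simp: Ck_on_Suc_dird simp del: Ck_on.simps(2))
qed

lemma Ck_on_mult:
  fixes f g :: "'a::real_normed_vector \<Rightarrow> real"
  assumes "open S"
  shows "Ck_on k S f \<Longrightarrow> Ck_on k S g \<Longrightarrow> Ck_on k S (\<lambda>x. f x * g x)"
proof (induction k arbitrary: f g)
  case 0
  then show ?case by (simp add: continuous_on_mult)
next
  case (Suc k)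
  have "Ck_on k S (dird v (\<lambda>x. f x * g x))" for v
    by (rule Ck_on_cong[OF assms Ck_on_add[OF assms
          Suc.IH[OF Ck_on_imp[OF Suc.prems(1)], of "dird v g"]
          Suc.IH[OF _ Ck_on_imp[OF Suc.prems(2)], of "dird v f"]]])
       (use Suc.prems in \<open>auto simp: Ck_on_Suc_dird dird_mult simp del: Ck_on.simps(2)\<close>)
  then show ?case using Suc.prems by (auto simp: Ck_on_Suc_dird simp del: Ck_on.simps(2))
qed

lemma Ck_on_bounded_linear_comp:
  assumes "open S" "bounded_linear L"
  shows "Ck_on k S g \<Longrightarrow> Ck_on k S (\<lambda>x. L (g x))"
proof (induction k arbitrary: g)
  case 0
  then show ?case using assms bounded_linear.continuous_on by auto
next
  case (Suc k)
  have "Ck_on k S (dird v (\<lambda>x. L (g x)))" for v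
    by (rule Ck_on_cong[OF assms(1) Suc.IH[of "dird v g"]])
       (use Suc.prems in \<open>auto simp: Ck_on_Suc_dird dird_bounded_linear_comp[OF assms(2)] simp del: Ck_on.simps(2)\<close>)
  moreover have "(\<lambda>x. L (g x)) differentiable (at x)" if "x \<in> S" for x
    using bounded_linear.has_derivative[OF assms(2) has_derivative_dird[of g x]] Suc.prems that
    by (auto simp: differentiable_def)
  ultimately show ?case unfolding Ck_on_Suc_dird by blast
qed

lemma Ck_on_affine_comp:
  assumes "open T" "bounded_linear L" "\<And>x. x \<in> T \<Longrightarrow> L x + b \<in> S"
  shows "Ck_on k S g \<Longrightarrow> Ck_on k T (\<lambda>x. g (L x + b))"
proof (induction k arbitrary: g)
  case 0
  have "continuous_on T (\<lambda>x. L x + b)"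
    by (rule continuous_on_add[OF linear_continuous_on[OF assms(2)] continuous_on_const])
  with 0 show ?case
    using continuous_on_compose2[of S g T "\<lambda>x. L x + b"] assms(3) by auto
next
  case (Suc k)
  have d: "g differentiable (at (L x + b))" if "x \<in> T" for x
    using Suc.prems assms(3)[OF that] by simp
  have "Ck_on k T (dird v (\<lambda>x. g (L x + b)))" for v
    by (rule Ck_on_cong[OF assms(1) Suc.IH[of "dird (L v) g"]])
       (use Suc.prems d in \<open>auto simp: Ck_on_Suc_dird dird_affine_comp[OF assms(2)] simp del: Ck_on.simps(2)\<close>)
  moreover have "(\<lambda>x. g (L x + b)) differentiable (at x)" if "x \<in> T" for x
  proof -
    have "(\<lambda>x. L x + b) differentiable (at x)"
      by (rule differentiable_add[OF bounded_linear_imp_differentiable[OF assms(2)] differentiable_const])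
    from differentiable_chain_at[OF this d[OF that]] show ?thesis by (simp add: o_def)
  qed
  ultimately show ?case unfolding Ck_on_Suc_dird by blast
qed

lemma smooth_on_add:
  "open S \<Longrightarrow> smooth_on S f \<Longrightarrow> smooth_on S g \<Longrightarrow> smooth_on S (\<lambda>x. f x + g x)"
  by (simp add: smooth_on_def Ck_on_add)

lemma smooth_on_mult:
  fixes f g :: "'a::real_normed_vector \<Rightarrow> real"
  shows "open S \<Longrightarrow> smooth_on S f \<Longrightarrow> smooth_on S g \<Longrightarrow> smooth_on S (\<lambda>x. f x * g x)"
  by (simp add: smooth_on_def Ck_on_mult)

lemma smooth_on_bounded_linear_comp:
  "open S \<Longrightarrow> bounded_linear L \<Longrightarrow> smooth_on S g \<Longrightarrow> smooth_on S (\<lambda>x. L (g x))"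
  by (simp add: smooth_on_def Ck_on_bounded_linear_comp)

lemma smooth_on_affine_comp:
  "open T \<Longrightarrow> bounded_linear L \<Longrightarrow> (\<And>x. x \<in> T \<Longrightarrow> L x + b \<in> S) \<Longrightarrow> smooth_on S g \<Longrightarrow>
   smooth_on T (\<lambda>x. g (L x + b))"
  unfolding smooth_on_def using Ck_on_affine_comp[of T L b S _ g] by blast

lemma smooth_on_diff:
  fixes f g :: "'a::real_normed_vector \<Rightarrow> 'b::real_normed_vector"
  assumes "open S" "smooth_on S f" "smooth_on S g" 
  shows "smooth_on S (\<lambda>x. f x - g x)"
  using smooth_on_add[OF assms(1,2) smooth_on_bounded_linear_comp[OF assms(1) _ assms(3), of "\<lambda>x. - x"]]
  by (simp add: bounded_linear_minus bounded_linear_ident)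

lemma smooth_on_cmult:
  fixes f :: "'a::real_normed_vector \<Rightarrow> real"
  shows "open S \<Longrightarrow> smooth_on S f \<Longrightarrow> smooth_on S (\<lambda>x. c * f x)"
  by (rule smooth_on_mult) auto

lemma smooth_on_power:
  fixes f :: "'a::real_normed_vector \<Rightarrow> real"
  shows "open S \<Longrightarrow> smooth_on S f \<Longrightarrow> smooth_on S (\<lambda>x. f x ^ n)"
  by (induction n) (simp_all add: smooth_on_mult)

lemma smooth_on_exp:
  assumes "open S"
  shows "smooth_on S (exp :: real \<Rightarrow> real)"
proof -
  have "Ck_on k S (\<lambda>x. c * exp x)" for k and c :: real
  proof (induction k arbitrary: c)
    case 0
    have "continuous_on S (\<lambda>x. c * exp x)" by (intro continuous_intros)
    then show ?case by simp
  next
    case (Suc k)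
    have der: "((\<lambda>x. c * exp x) has_derivative (\<lambda>v. (c * v) * exp x)) (at x)" for x :: real
      by (auto intro!: derivative_eq_intros)
    have "dird v (\<lambda>x. c * exp x) = (\<lambda>x. (c * v) * exp x)" for v :: real
      by (rule ext, rule dirdI, rule der)
    then show ?case unfolding Ck_on_Suc_dird
      using der Suc by (auto simp: differentiable_def simp del: mult_exp_exp)
  qed
  from this[of _ 1] show ?thesis by (simp add: smooth_on_def)
qed

section \<open>Symmetry of second derivatives\<close>

lemma has_real_derivative_line:
  fixes g :: "'a::real_normed_vector \<Rightarrow> real"
  assumes "g differentiable (at (y + r *\<^sub>R v))"
  shows "((\<lambda>r. g (y + r *\<^sub>R v)) has_real_derivative dird v g (y + r *\<^sub>R v)) (at r)"
proof -
  have "((\<lambda>r. y + r *\<^sub>R v) has_derivative (\<lambda>h. h *\<^sub>R v)) (at r)"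
    by (auto intro!: derivative_eq_intros)
  from diff_chain_at[OF this has_derivative_dird[OF assms], unfolded o_def] show ?thesis
    unfolding has_field_derivative_def
    by (rule has_derivative_eq_rhs)
       (use assms in \<open>auto simp: o_def dird_scaleR_left\<close>)
qed

text \<open>The second difference quotient equals a mixed second derivative at a nearby point; since the second
difference is symmetric in the two directions, the two orders of differentiation can be compared.\<close>

lemma second_difference_mvt:
  fixes g :: "'a::real_normed_vector \<Rightarrow> real"
  assumes "s > 0"
    and dom: "\<And>r r'. 0 \<le> r \<Longrightarrow> r \<le> s \<Longrightarrow> 0 \<le> r' \<Longrightarrow> r' \<le> s \<Longrightarrow> x + r *\<^sub>R v + r' *\<^sub>R w \<in> S"
    and d1: "\<And>y. y \<in> S \<Longrightarrow> g differentiable (at y)"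
    and d2: "\<And>y. y \<in> S \<Longrightarrow> dird v g differentiable (at y)"
  obtains r r' where "0 \<le> r" "r \<le> s" "0 \<le> r'" "r' \<le> s"
    "g (x + s *\<^sub>R v + s *\<^sub>R w) - g (x + s *\<^sub>R v) - g (x + s *\<^sub>R w) + g x
     = s * s * dird w (dird v g) (x + r *\<^sub>R v + r' *\<^sub>R w)"
proof -
  have a: "((\<lambda>r. g (x + r *\<^sub>R v + s *\<^sub>R w) - g (x + r *\<^sub>R v)) has_real_derivative
      dird v g (x + r *\<^sub>R v + s *\<^sub>R w) - dird v g (x + r *\<^sub>R v)) (at r)"
    if "0 \<le> r" "r \<le> s" for r
  proof -
    have "g differentiable (at (x + s *\<^sub>R w + r *\<^sub>R v))"
      using d1 dom[of r s] that \<open>s > 0\<close> by (simp add: algebra_simps)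
    moreover have "g differentiable (at (x + r *\<^sub>R v))"
      using d1 dom[of r 0] that \<open>s > 0\<close> by simp
    ultimately show ?thesis
      using DERIV_diff[OF has_real_derivative_line[of g "x + s *\<^sub>R w" r v]
          has_real_derivative_line[of g x r v]]
      by (simp add: add.assoc add.commute[of "s *\<^sub>R w"])
  qed
  obtain r where r: "0 < r" "r < s" and r_eq:
    "(g (x + s *\<^sub>R v + s *\<^sub>R w) - g (x + s *\<^sub>R v)) - (g (x + 0 *\<^sub>R v + s *\<^sub>R w) - g (x + 0 *\<^sub>R v))
     = (s - 0) * (dird v g (x + r *\<^sub>R v + s *\<^sub>R w) - dird v g (x + r *\<^sub>R v))"
    using MVT2[of 0 s _ "\<lambda>r. dird v g (x + r *\<^sub>R v + s *\<^sub>R w) - dird v g (x + r *\<^sub>R v)",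
        OF \<open>s > 0\<close> a] by auto
  have b: "((\<lambda>r'. dird v g (x + r *\<^sub>R v + r' *\<^sub>R w)) has_real_derivative
      dird w (dird v g) (x + r *\<^sub>R v + r' *\<^sub>R w)) (at r')" if "0 \<le> r'" "r' \<le> s" for r'
    using d2 dom[of r r'] r that by (intro has_real_derivative_line) simp
  obtain r' where r': "0 < r'" "r' < s" and r'_eq:
    "dird v g (x + r *\<^sub>R v + s *\<^sub>R w) - dird v g (x + r *\<^sub>R v + 0 *\<^sub>R w)
     = (s - 0) * dird w (dird v g) (x + r *\<^sub>R v + r' *\<^sub>R w)"
    using MVT2[of 0 s _ "\<lambda>r'. dird w (dird v g) (x + r *\<^sub>R v + r' *\<^sub>R w)",
        OF \<open>s > 0\<close> b] by auto
  show thesis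
    by (rule that[of r r']) (use r r' r_eq r'_eq in \<open>simp_all add: algebra_simps\<close>)
qed

lemma dird_commute:
  fixes g :: "'a::real_normed_vector \<Rightarrow> real"
  assumes "open S" "x \<in> S" and g: "smooth_on S g"
  shows "dird v (dird w g) x = dird w (dird v g) x"
proof (rule ccontr)
  define P where "P = dird v (dird w g)"
  define Q where "Q = dird w (dird v g)"
  assume "\<not> ?thesis"
  then have ne: "P x \<noteq> Q x" by (simp add: P_def Q_def)
  define e where "e = \<bar>P x - Q x\<bar> / 2"
  have "e > 0" using ne by (simp add: e_def)
  have c: "isCont P x" "isCont Q x"
    using smooth_on_differentiable[OF smooth_on_dird[OF smooth_on_dird[OF g]] \<open>x \<in> S\<close>]
    unfolding P_def Q_def by (blast intro: differentiable_imp_continuous_within)+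
  obtain d1 where d1: "d1 > 0" "\<And>y. dist y x < d1 \<Longrightarrow> \<bar>P y - P x\<bar> < e"
    using c(1) \<open>e > 0\<close> unfolding continuous_at_eps_delta by (auto simp: dist_norm)
  obtain d2 where d2: "d2 > 0" "\<And>y. dist y x < d2 \<Longrightarrow> \<bar>Q y - Q x\<bar> < e"
    using c(2) \<open>e > 0\<close> unfolding continuous_at_eps_delta by (auto simp: dist_norm)
  obtain d3 where d3: "d3 > 0" "\<And>y. dist y x < d3 \<Longrightarrow> y \<in> S"
    using \<open>open S\<close> \<open>x \<in> S\<close> by (meson open_dist)
  define d where "d = min d1 (min d2 d3)"
  define s where "s = d / (2 * (norm v + norm w + 1))"
  have "d > 0" using d1 d2 d3 by (simp add: d_def)
  moreover have pos: "norm v + norm w + 1 > 0" by (simp add: add_nonneg_pos)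
  ultimately have "s > 0" by (simp add: s_def)
  have near: "dist (x + r *\<^sub>R v + r' *\<^sub>R w) x < d" if "0 \<le> r" "r \<le> s" "0 \<le> r'" "r' \<le> s" for r r'
  proof -
    have "dist (x + r *\<^sub>R v + r' *\<^sub>R w) x \<le> r * norm v + r' * norm w"
      using norm_triangle_ineq[of "r *\<^sub>R v" "r' *\<^sub>R w"] that by (simp add: dist_norm)
    also have "\<dots> \<le> s * norm v + s * norm w"
      using that by (intro add_mono mult_right_mono) auto
    also have "\<dots> \<le> s * (norm v + norm w + 1)"
      using \<open>s > 0\<close> by (simp add: algebra_simps)
    also have "\<dots> = d / 2" using pos by (simp add: s_def divide_simps)
    finally show ?thesis using \<open>d > 0\<close> by simp
  qed
  have dom: "x + r *\<^sub>R v + r' *\<^sub>R w \<in> S" if "0 \<le> r" "r \<le> s" "0 \<le> r'" "r' \<le> s" for r r'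
    using near[OF that] d3 by (simp add: d_def)
  have dom': "x + r *\<^sub>R w + r' *\<^sub>R v \<in> S" if "0 \<le> r" "r \<le> s" "0 \<le> r'" "r' \<le> s" for r r'
    using dom[of r' r] that by (simp add: algebra_simps)
  have diff: "g differentiable (at y)" "dird v g differentiable (at y)" if "y \<in> S" for y v
    using g that smooth_on_differentiable smooth_on_dird by blast+
  obtain r r' where r: "0 \<le> r" "r \<le> s" "0 \<le> r'" "r' \<le> s"
    "g (x + s *\<^sub>R v + s *\<^sub>R w) - g (x + s *\<^sub>R v) - g (x + s *\<^sub>R w) + g x
     = s * s * Q (x + r *\<^sub>R v + r' *\<^sub>R w)"
    unfolding Q_def
    by (rule second_difference_mvt[OF \<open>s > 0\<close> dom diff(1) diff(2)[where v = v]]) auto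
  obtain t t' where t: "0 \<le> t" "t \<le> s" "0 \<le> t'" "t' \<le> s"
    "g (x + s *\<^sub>R w + s *\<^sub>R v) - g (x + s *\<^sub>R w) - g (x + s *\<^sub>R v) + g x
     = s * s * P (x + t *\<^sub>R w + t' *\<^sub>R v)"
    unfolding P_def
    by (rule second_difference_mvt[OF \<open>s > 0\<close> dom' diff(1) diff(2)[where v = w]]) auto
  have "s * s * Q (x + r *\<^sub>R v + r' *\<^sub>R w) = s * s * P (x + t *\<^sub>R w + t' *\<^sub>R v)"
    unfolding r(5)[symmetric] t(5)[symmetric] by (simp add: algebra_simps)
  then have eq: "Q (x + r *\<^sub>R v + r' *\<^sub>R w) = P (x + t *\<^sub>R w + t' *\<^sub>R v)"
    using \<open>s > 0\<close> by simp
  have "\<bar>Q (x + r *\<^sub>R v + r' *\<^sub>R w) - Q x\<bar> < e"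
    using d2(2) near[of r r'] r by (simp add: d_def)
  moreover have "\<bar>P (x + t *\<^sub>R w + t' *\<^sub>R v) - P x\<bar> < e"
    using d1(2) near[of t' t] t by (simp add: d_def algebra_simps)
  ultimately show False unfolding eq e_def by (auto simp: abs_if split: if_splits)
qed


section \<open>The Heisenberg frame\<close>

lemma partial_eq_dird: "partial i = dird (axis i 1)"
  by (simp add: fun_eq_iff partial_def dird_def)

lemma smooth_on_partial: "smooth_on U g \<Longrightarrow> smooth_on U (partial i g)"
  by (simp add: partial_eq_dird smooth_on_dird)

lemma smooth_on_nth: "smooth_on U (\<lambda>z::real^3. z $ i)"
  by (rule smooth_on_bounded_linear[OF bounded_linear_vec_nth])

lemma partial_nth: "partial i (\<lambda>z. z $ j) z = (if i = j then 1 else 0)"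
  by (simp add: partial_eq_dird dird_bounded_linear[OF bounded_linear_vec_nth] axis_def)

lemma partial_commute:
  "open U \<Longrightarrow> smooth_on U g \<Longrightarrow> z \<in> U \<Longrightarrow> partial i (partial j g) z = partial j (partial i g) z"
  by (simp add: partial_eq_dird dird_commute)

lemma smooth_on_heis_X: "open U \<Longrightarrow> smooth_on U g \<Longrightarrow> smooth_on U (heis_X g)"
  unfolding heis_X_def[abs_def]
  by (intro smooth_on_add smooth_on_mult smooth_on_partial smooth_on_nth smooth_on_const)

lemma smooth_on_heis_Y: "open U \<Longrightarrow> smooth_on U g \<Longrightarrow> smooth_on U (heis_Y g)"
  unfolding heis_Y_def[abs_def]
  by (intro smooth_on_diff smooth_on_mult smooth_on_partial smooth_on_nth smooth_on_const)

lemma partial_heis: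
  assumes "smooth_on U g" "z \<in> U"
  shows partial_heis_X: "partial i (heis_X g) z =
      partial i (partial 1 g) z + 2 * z$2 * partial i (partial 3 g) z + (if i = 2 then 2 * partial 3 g z else 0)"
    and partial_heis_Y: "partial i (heis_Y g) z =
      partial i (partial 2 g) z - 2 * z$1 * partial i (partial 3 g) z - (if i = 1 then 2 * partial 3 g z else 0)"
proof -
  note d = smooth_on_differentiable[OF smooth_on_partial[OF assms(1)] assms(2)]
  have n: "(\<lambda>z::real^3. z $ j) differentiable (at z)" for j
    by (rule bounded_linear_imp_differentiable[OF bounded_linear_vec_nth])
  have n2: "(\<lambda>z::real^3. 2 * z $ j) differentiable (at z)" for j
    using differentiable_mult[OF differentiable_const n] .
  have pn: "dird (axis i 1) (\<lambda>z. 2 * z $ j) z = (if i = j then 2 else 0)" for j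
    by (subst dird_mult[OF differentiable_const n])
       (simp add: dird_bounded_linear[OF bounded_linear_vec_nth] axis_def)
  note nd = differentiable_mult[OF n2 d]
  show "partial i (heis_X g) z =
      partial i (partial 1 g) z + 2 * z$2 * partial i (partial 3 g) z + (if i = 2 then 2 * partial 3 g z else 0)"
    unfolding heis_X_def[abs_def] partial_eq_dird[of i]
    by (subst dird_add[OF d nd], subst dird_mult[OF n2 d]) (simp add: pn)
  show "partial i (heis_Y g) z =
      partial i (partial 2 g) z - 2 * z$1 * partial i (partial 3 g) z - (if i = 1 then 2 * partial 3 g z else 0)"
    unfolding heis_Y_def[abs_def] partial_eq_dird[of i]
    by (subst dird_diff[OF d nd], subst dird_mult[OF n2 d]) (simp add: pn)
qed

text \<open>The mixed derivatives occur in both orders and are merged by symmetry; no first-order terms appear because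
\<open>X\<close> annihilates its own coefficient \<open>2 y\<close> and \<open>Y\<close> its coefficient \<open>- 2 x\<close>.\<close>

lemma kohn_laplace_coords:
  assumes "open U" "smooth_on U g" "z \<in> U"
  shows "kohn_laplace g z = partial 1 (partial 1 g) z + partial 2 (partial 2 g) z
    + 4 * ((z$1)\<^sup>2 + (z$2)\<^sup>2) * partial 3 (partial 3 g) z
    + 4 * z$2 * partial 3 (partial 1 g) z - 4 * z$1 * partial 3 (partial 2 g) z"
  using partial_commute[OF assms, of 1 3] partial_commute[OF assms, of 2 3]
  unfolding kohn_laplace_def heis_X_def[of "heis_X g"] heis_Y_def[of "heis_Y g"]
    partial_heis[OF assms(2,3)]
  by (simp add: algebra_simps power2_eq_square)

lemma kohn_laplace_jet:
  assumes "open U" "smooth_on U g" "z \<in> U"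
  shows "kohn_laplace g z + f (g z) = heis_eq f (jet2_of g z)"
  by (simp add: kohn_laplace_coords[OF assms] heis_eq_def jet2_of_def)

lemma heis_commutator:
  assumes "smooth_on UNIV g"
  shows "heis_X (heis_Y g) = (\<lambda>z. heis_Y (heis_X g) z - 4 * partial 3 g z)"
proof
  fix z
  note c = partial_commute[OF open_UNIV assms UNIV_I[of z]]
  show "heis_X (heis_Y g) z = heis_Y (heis_X g) z - 4 * partial 3 g z"
    unfolding heis_X_def[of "heis_Y g"] heis_Y_def[of "heis_X g"] partial_heis[OF assms UNIV_I]
    by (simp add: c[of 1 2] c[of 1 3] c[of 2 3] algebra_simps)
qed

lemma partial3_heis:
  assumes "smooth_on UNIV g"
  shows partial3_heis_X: "partial 3 (heis_X g) = heis_X (partial 3 g)"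
    and partial3_heis_Y: "partial 3 (heis_Y g) = heis_Y (partial 3 g)"
proof -
  note c = partial_commute[OF open_UNIV assms UNIV_I]
  show "partial 3 (heis_X g) = heis_X (partial 3 g)"
    by (rule ext, simp only: partial_heis[OF assms UNIV_I] heis_X_def[of "partial 3 g"]) (simp add: c[of 1 3])
  show "partial 3 (heis_Y g) = heis_Y (partial 3 g)"
    by (rule ext, simp only: partial_heis[OF assms UNIV_I] heis_Y_def[of "partial 3 g"]) (simp add: c[of 2 3])
qed

lemma partial_cmult:
  assumes "g differentiable (at z)"
  shows "partial i (\<lambda>z. c * g z) z = c * partial i g z"
  by (simp add: partial_eq_dird dird_mult[OF differentiable_const assms])

lemma heis_cmult:
  assumes "smooth_on UNIV g"
  shows heis_X_cmult: "heis_X (\<lambda>z. c * g z) = (\<lambda>z. c * heis_X g z)"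
    and heis_Y_cmult: "heis_Y (\<lambda>z. c * g z) = (\<lambda>z. c * heis_Y g z)"
    and partial3_cmult: "partial 3 (\<lambda>z. c * g z) = (\<lambda>z. c * partial 3 g z)"
  using smooth_on_differentiable[OF assms UNIV_I]
  by (simp_all add: fun_eq_iff heis_X_def heis_Y_def partial_cmult algebra_simps)

lemma partial_of_heis:
  "partial 1 g z = heis_X g z - 2 * z$2 * partial 3 g z"
  "partial 2 g z = heis_Y g z + 2 * z$1 * partial 3 g z"
  by (simp_all add: heis_X_def heis_Y_def)

section \<open>Contact potentials\<close>

lemma dird_eq_partials:
  assumes "g differentiable (at z)"
  shows "dird v g z = v$1 * partial 1 g z + v$2 * partial 2 g z + v$3 * partial 3 g z"
proof -
  have "v = v$1 *\<^sub>R axis 1 1 + v$2 *\<^sub>R axis 2 1 + v$3 *\<^sub>R axis 3 1"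
    by (simp add: vec_eq_iff forall_3 axis_def)
  then have "dird v g z = dird (v$1 *\<^sub>R axis 1 1 + v$2 *\<^sub>R axis 2 1 + v$3 *\<^sub>R axis 3 1) g z"
    by simp
  also have "\<dots> = v$1 * partial 1 g z + v$2 * partial 2 g z + v$3 * partial 3 g z"
    by (simp add: partial_eq_dird dird_add_left[OF assms] dird_scaleR_left[OF assms])
  finally show ?thesis .
qed

lemma has_derivative_nth: "((\<lambda>z::real^3. z $ i) has_derivative (\<lambda>v. v $ i)) (at z)"
  by (rule bounded_linear_imp_has_derivative[OF bounded_linear_vec_nth])

text \<open>Used to integrate: the primitive \<open>h\<close> is supplied explicitly.\<close>

lemma determined_by_partials:
  assumes g: "smooth_on UNIV g"
    and h: "\<And>z. (h has_derivative (\<lambda>v. v$1 * G1 z + v$2 * G2 z + v$3 * G3 z)) (at z)"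
    and "\<And>z. partial 1 g z = G1 z" "\<And>z. partial 2 g z = G2 z" "\<And>z. partial 3 g z = G3 z"
  obtains c :: real where "\<And>z::real^3. g z = h z + c"
proof -
  have "((\<lambda>z. g z - h z) has_derivative (\<lambda>v. 0)) (at z)" for z
  proof -
    have d: "g differentiable (at z)" using smooth_on_differentiable[OF g] by simp
    from has_derivative_diff[OF has_derivative_dird[OF d] h] show ?thesis
      by (simp add: dird_eq_partials[OF d] assms)
  qed
  then obtain c where "\<And>z. g z - h z = c"
    using has_derivative_zero_constant[OF convex_UNIV, of "\<lambda>z. g z - h z"] by auto
  then show thesis by (intro that[of c]) (simp add: algebra_simps eq_diff_eq)
qed

text \<open>\<open>C\<close> is the contact Hamiltonian of a conformal field: the two equations say that the horizontal components
\<open>A = - Y C / 4\<close> and \<open>B = X C / 4\<close> satisfy the Cauchy--Riemann equations \<open>X A = Y B\<close>, \<open>X B = - Y A\<close>.  With \<open>D = T C\<close> the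
commutation relation gives \<open>X Y C = - 2 D\<close>, \<open>Y X C = 2 D\<close>, hence all third-order derivatives, the last four
conclusions.  Applying the relation \<open>[Y, X] = 4 T\<close> to \<open>X X C\<close> yields \<open>- 12 X X D = 4 X X D\<close>; so \<open>X X D = Y Y D = 0\<close>,
\<open>T D\<close> is constant, and \<open>C\<close> is found by successive integrations.\<close>

lemma contact_potential_polynomial:
  assumes C: "smooth_on UNIV C"
    and eq1: "heis_X (heis_X C) = heis_Y (heis_Y C)"
    and eq2: "heis_X (heis_Y C) = (\<lambda>z. - 1 * heis_Y (heis_X C) z)"
  obtains d0 d1 d2 d3 n a b c where
    "\<And>z. C z = d0 / 2 * ((z$3)\<^sup>2 + ((z$1)\<^sup>2 + (z$2)\<^sup>2)\<^sup>2) + d1 * (z$1 * z$3 + (z$1)\<^sup>2 * z$2 + z$2 ^ 3)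
       + d2 * (z$2 * z$3 - z$1 ^ 3 - z$1 * (z$2)\<^sup>2) + d3 * z$3 + n / 2 * ((z$1)\<^sup>2 + (z$2)\<^sup>2)
       + b * z$1 + a * z$2 + c"
    "\<And>z. heis_X C z = d0 * (2 * z$1 ^ 3 + 2 * z$1 * (z$2)\<^sup>2 + 2 * z$2 * z$3) + d1 * (4 * z$1 * z$2 + z$3)
       + d2 * ((z$2)\<^sup>2 - 3 * (z$1)\<^sup>2) + 2 * d3 * z$2 + n * z$1 + b"
    "\<And>z. heis_Y C z = d0 * (2 * (z$1)\<^sup>2 * z$2 + 2 * z$2 ^ 3 - 2 * z$1 * z$3) + d1 * (3 * (z$2)\<^sup>2 - (z$1)\<^sup>2)
       + d2 * (z$3 - 4 * z$1 * z$2) - 2 * d3 * z$1 + n * z$2 + a"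
    "\<And>z. partial 3 C z = d0 * z$3 + d1 * z$1 + d2 * z$2 + d3"
    "heis_X (heis_X (heis_Y C)) = (\<lambda>z. - 2 * heis_X (partial 3 C) z)"
    "heis_Y (heis_Y (heis_Y C)) = (\<lambda>z. 6 * heis_X (partial 3 C) z)"
    "heis_X (heis_X (heis_X C)) = (\<lambda>z. - 6 * heis_Y (partial 3 C) z)"
    "heis_Y (heis_Y (heis_X C)) = (\<lambda>z. 2 * heis_Y (partial 3 C) z)"
proof -
  let ?X = heis_X and ?Y = heis_Y and ?T = "partial 3"
  note sm = smooth_on_heis_X[OF open_UNIV] smooth_on_heis_Y[OF open_UNIV] smooth_on_partial
  define D where "D = ?T C"
  have D: "smooth_on UNIV D" using C by (simp add: D_def sm)
  note comm = heis_commutator and TX = partial3_heis_X and TY = partial3_heis_Y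
  have XYC: "?X (?Y C) = (\<lambda>z. - 2 * D z)" and YXC: "?Y (?X C) = (\<lambda>z. 2 * D z)"
    using eq2 comm[OF C] by (auto simp: fun_eq_iff D_def)
  have XXYC: "?X (?X (?Y C)) = (\<lambda>z. - 2 * ?X D z)" and YXYC: "?Y (?X (?Y C)) = (\<lambda>z. - 2 * ?Y D z)"
    unfolding XYC by (rule heis_X_cmult[OF D], rule heis_Y_cmult[OF D])
  have XYXC: "?X (?Y (?X C)) = (\<lambda>z. 2 * ?X D z)" and YYXC: "?Y (?Y (?X C)) = (\<lambda>z. 2 * ?Y D z)"
    unfolding YXC by (simp_all add: heis_cmult[OF D])
  have XXXC: "?X (?X (?X C)) = (\<lambda>z. - 6 * ?Y D z)"
    using comm[of "?Y C"] YXYC TY[OF C] C unfolding eq1 by (simp add: sm D_def fun_eq_iff)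
  have YXXC: "?Y (?X (?X C)) = (\<lambda>z. 6 * ?X D z)"
    using comm[of "?X C"] XYXC TX[OF C] C by (simp add: sm D_def fun_eq_iff)
  then have YYYC: "?Y (?Y (?Y C)) = (\<lambda>z. 6 * ?X D z)" unfolding eq1 .
  have TXX: "?T (?X (?X C)) = ?X (?X D)" and TYY: "?T (?Y (?Y C)) = ?Y (?Y D)"
    using C by (simp_all add: TX TY sm D_def)
  have XX_YY: "?X (?X D) = ?Y (?Y D)" using TXX TYY eq1 by simp
  \<comment> \<open>the overdetermined step: the commutator on \<open>X X C\<close>, computed from the third-order identities\<close>
  have "?X (?X D) z = 0" for z
  proof -
    have "?X (?Y (?X (?X C))) = (\<lambda>z. 6 * ?X (?X D) z)"
      unfolding YXXC using D by (simp add: heis_cmult sm)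
    moreover have "?Y (?X (?X (?X C))) = (\<lambda>z. - 6 * ?Y (?Y D) z)"
      unfolding XXXC by (rule heis_Y_cmult) (simp add: sm D)
    ultimately show ?thesis
      using comm[of "?X (?X C)"] C unfolding TXX by (simp add: sm fun_eq_iff XX_YY[symmetric])
  qed
  then have XXD: "?X (?X D) = (\<lambda>z. 0)" and YYD: "?Y (?Y D) = (\<lambda>z. 0)"
    using XX_YY by (auto simp: fun_eq_iff)
  have XYD: "?X (?Y D) = (\<lambda>z. - 2 * ?T D z)"
    using arg_cong[OF XYC, of ?T] C D partial3_cmult[OF D, of "-2"] by (simp add: TX TY sm D_def)
  have YXD: "?Y (?X D) = (\<lambda>z. 2 * ?T D z)"
    using arg_cong[OF YXC, of ?T] C D partial3_cmult[OF D, of 2] by (simp add: TX TY sm D_def)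
  have zero: "?X (\<lambda>z. 0) = (\<lambda>z. 0)" "?Y (\<lambda>z. 0) = (\<lambda>z. 0)" "?T (\<lambda>z. 0) = (\<lambda>z. 0)"
    by (simp_all add: fun_eq_iff heis_X_def heis_Y_def partial_eq_dird)
  have YTD: "?Y (?T D) = (\<lambda>z. 0)"
    using arg_cong[OF XXXC, of ?T] C D partial3_cmult[of "?Y D" "-6"] XXD
    by (simp add: TX TY sm D_def[symmetric] zero fun_eq_iff)
  have XTD: "?X (?T D) = (\<lambda>z. 0)"
    using arg_cong[OF YYYC, of ?T] C D partial3_cmult[of "?X D" "6"] YYD
    by (simp add: TX TY sm D_def[symmetric] zero fun_eq_iff)
  have TTD: "?T (?T D) = (\<lambda>z. 0)"
    using comm[of "?T D"] D by (simp add: XTD YTD zero sm fun_eq_iff)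
  show thesis
  proof -
    obtain d0 where d0: "\<And>z. ?T D z = d0"
      by (rule determined_by_partials[of "?T D" "\<lambda>z. 0" "\<lambda>z. 0" "\<lambda>z. 0" "\<lambda>z. 0"])
         (use D in \<open>auto simp: sm partial_of_heis XTD YTD TTD\<close>)
    obtain d1 where d1: "\<And>z. ?X D z = 2 * d0 * z$2 + d1"
      by (rule determined_by_partials[of "?X D" "\<lambda>z. 2 * d0 * z$2" "\<lambda>z. 0" "\<lambda>z. 2 * d0" "\<lambda>z. 0"])
         (use D in \<open>auto simp: sm partial_of_heis TX XTD XXD YXD d0 intro!: derivative_eq_intros has_derivative_nth\<close>)
    obtain d2 where d2: "\<And>z. ?Y D z = - 2 * d0 * z$1 + d2"
      by (rule determined_by_partials[of "?Y D" "\<lambda>z. - 2 * d0 * z$1" "\<lambda>z. - 2 * d0" "\<lambda>z. 0" "\<lambda>z. 0"])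
         (use D in \<open>auto simp: sm partial_of_heis TY YTD YYD XYD d0 intro!: derivative_eq_intros has_derivative_nth\<close>)
    obtain d3 where d3: "\<And>z. D z = d0 * z$3 + d1 * z$1 + d2 * z$2 + d3"
      by (rule determined_by_partials[of D "\<lambda>z. d0 * z$3 + d1 * z$1 + d2 * z$2" "\<lambda>z. d1" "\<lambda>z. d2" "\<lambda>z. d0"])
         (use D in \<open>auto simp: partial_of_heis d0 d1 d2 algebra_simps intro!: derivative_eq_intros has_derivative_nth\<close>)
    have TN: "?T (?X (?X C)) = (\<lambda>z. 0)" using TXX XXD by simp
    obtain n where n: "\<And>z. ?X (?X C) z = 6 * d0 * ((z$1)\<^sup>2 + (z$2)\<^sup>2) - 6 * d2 * z$1 + 6 * d1 * z$2 + n"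
      by (rule determined_by_partials[of "?X (?X C)"
            "\<lambda>z. 6 * d0 * ((z$1)\<^sup>2 + (z$2)\<^sup>2) - 6 * d2 * z$1 + 6 * d1 * z$2"
            "\<lambda>z. 12 * d0 * z$1 - 6 * d2" "\<lambda>z. 12 * d0 * z$2 + 6 * d1" "\<lambda>z. 0"])
         (use C in \<open>auto simp: sm partial_of_heis TN XXXC YXXC d1 d2 algebra_simps intro!: derivative_eq_intros has_derivative_nth\<close>)
    have TXC: "?T (?X C) = ?X D" and TYC: "?T (?Y C) = ?Y D"
      using C by (simp_all add: TX TY D_def)
    have YYC: "?Y (?Y C) z = ?X (?X C) z" for z by (simp add: eq1)
    obtain b where b: "\<And>z. ?X C z = d0 * (2 * z$1 ^ 3 + 2 * z$1 * (z$2)\<^sup>2 + 2 * z$2 * z$3) + d1 * (4 * z$1 * z$2 + z$3)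
       + d2 * ((z$2)\<^sup>2 - 3 * (z$1)\<^sup>2) + 2 * d3 * z$2 + n * z$1 + b"
      by (rule determined_by_partials[of "?X C"
            "\<lambda>z. d0 * (2 * z$1 ^ 3 + 2 * z$1 * (z$2)\<^sup>2 + 2 * z$2 * z$3) + d1 * (4 * z$1 * z$2 + z$3)
               + d2 * ((z$2)\<^sup>2 - 3 * (z$1)\<^sup>2) + 2 * d3 * z$2 + n * z$1"
            "\<lambda>z. d0 * (6 * (z$1)\<^sup>2 + 2 * (z$2)\<^sup>2) + 4 * d1 * z$2 - 6 * d2 * z$1 + n"
            "\<lambda>z. d0 * (4 * z$1 * z$2 + 2 * z$3) + 4 * d1 * z$1 + 2 * d2 * z$2 + 2 * d3"
            "\<lambda>z. 2 * d0 * z$2 + d1"])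
         (use C in \<open>auto simp: sm partial_of_heis TXC YXC d1 d3 n power2_eq_square power3_eq_cube algebra_simps
            intro!: derivative_eq_intros has_derivative_nth\<close>)
    obtain a where a: "\<And>z. ?Y C z = d0 * (2 * (z$1)\<^sup>2 * z$2 + 2 * z$2 ^ 3 - 2 * z$1 * z$3) + d1 * (3 * (z$2)\<^sup>2 - (z$1)\<^sup>2)
       + d2 * (z$3 - 4 * z$1 * z$2) - 2 * d3 * z$1 + n * z$2 + a"
      by (rule determined_by_partials[of "?Y C"
            "\<lambda>z. d0 * (2 * (z$1)\<^sup>2 * z$2 + 2 * z$2 ^ 3 - 2 * z$1 * z$3) + d1 * (3 * (z$2)\<^sup>2 - (z$1)\<^sup>2)
               + d2 * (z$3 - 4 * z$1 * z$2) - 2 * d3 * z$1 + n * z$2"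
            "\<lambda>z. d0 * (4 * z$1 * z$2 - 2 * z$3) - 2 * d1 * z$1 - 4 * d2 * z$2 - 2 * d3"
            "\<lambda>z. d0 * (2 * (z$1)\<^sup>2 + 6 * (z$2)\<^sup>2) + 6 * d1 * z$2 - 4 * d2 * z$1 + n"
            "\<lambda>z. - 2 * d0 * z$1 + d2"])
         (use C in \<open>auto simp: sm partial_of_heis TYC XYC YYC d2 d3 n power2_eq_square power3_eq_cube algebra_simps
            intro!: derivative_eq_intros has_derivative_nth\<close>)
    obtain c where c: "\<And>z. C z = d0 / 2 * ((z$3)\<^sup>2 + ((z$1)\<^sup>2 + (z$2)\<^sup>2)\<^sup>2) + d1 * (z$1 * z$3 + (z$1)\<^sup>2 * z$2 + z$2 ^ 3)
       + d2 * (z$2 * z$3 - z$1 ^ 3 - z$1 * (z$2)\<^sup>2) + d3 * z$3 + n / 2 * ((z$1)\<^sup>2 + (z$2)\<^sup>2)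
       + b * z$1 + a * z$2 + c"
      by (rule determined_by_partials[of C
            "\<lambda>z. d0 / 2 * ((z$3)\<^sup>2 + ((z$1)\<^sup>2 + (z$2)\<^sup>2)\<^sup>2) + d1 * (z$1 * z$3 + (z$1)\<^sup>2 * z$2 + z$2 ^ 3)
               + d2 * (z$2 * z$3 - z$1 ^ 3 - z$1 * (z$2)\<^sup>2) + d3 * z$3 + n / 2 * ((z$1)\<^sup>2 + (z$2)\<^sup>2)
               + b * z$1 + a * z$2"
            "\<lambda>z. ?X C z - 2 * z$2 * D z" "\<lambda>z. ?Y C z + 2 * z$1 * D z" "\<lambda>z. D z"])
         (use C in \<open>auto simp: a b d3 partial_of_heis D_def[symmetric] power2_eq_square power3_eq_cube algebra_simps
            intro!: derivative_eq_intros has_derivative_nth\<close>)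
    show thesis
      by (rule that[OF c b a d3[unfolded D_def] XXYC[unfolded D_def] YYYC[unfolded D_def] XXXC[unfolded D_def]
            YYXC[unfolded D_def]])
  qed
qed


section \<open>The prolongation in coordinates\<close>

abbreviation dz :: "3 \<Rightarrow> (jet0 \<Rightarrow> real) \<Rightarrow> jet0 \<Rightarrow> real" where
  "dz i \<equiv> dird (axis i 1, 0)"

abbreviation du :: "(jet0 \<Rightarrow> real) \<Rightarrow> jet0 \<Rightarrow> real" where
  "du \<equiv> dird (0, 1)"

abbreviation xi :: "vfield \<Rightarrow> 3 \<Rightarrow> jet0 \<Rightarrow> real" where
  "xi S k \<equiv> \<lambda>w. fst (S w) $ k"

abbreviation eta :: "vfield \<Rightarrow> jet0 \<Rightarrow> real" where
  "eta S \<equiv> \<lambda>w. snd (S w)"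

text \<open>The total derivative \<open>D\<^sub>i g\<close>, in terms of the partial derivatives of \<open>g\<close>.\<close>

definition tot1 :: "3 \<Rightarrow> (jet0 \<Rightarrow> real) \<Rightarrow> jet1 \<Rightarrow> real" where
  "tot1 i g = (\<lambda>(z, u, p). dz i g (z, u) + p$i * du g (z, u))"

text \<open>The iterated total derivative \<open>D\<^sub>j D\<^sub>i g\<close>; the last summand is the contribution of \<open>D\<^sub>j p\<^sub>i = q\<^sub>j\<^sub>i\<close>.\<close>

definition tot2 :: "3 \<Rightarrow> 3 \<Rightarrow> (jet0 \<Rightarrow> real) \<Rightarrow> jet2 \<Rightarrow> real" where
  "tot2 i j g = (\<lambda>(z, u, p, q). tot1 j (dz i g) (z, u, p) + p$i * tot1 j (du g) (z, u, p) + q$j$i * du g (z, u))"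

lemma dird_axis_pair:
  assumes "g differentiable (at w)"
  shows "dird (axis i 1, r) g w = dz i g w + r * du g w"
proof -
  have "(axis i 1, r) = (axis i 1, 0) + r *\<^sub>R (0, 1 :: real)" by simp
  then have "dird (axis i 1, r) g w = dird ((axis i 1, 0) + r *\<^sub>R (0, 1)) g w" by (rule arg_cong)
  also have "\<dots> = dz i g w + r * du g w"
    unfolding dird_add_left[OF assms] dird_scaleR_left[OF assms] by simp
  finally show ?thesis .
qed

lemma total_deriv0_eq:
  "g differentiable (at (z, u)) \<Longrightarrow> total_deriv0 i g (z, u, p) = tot1 i g (z, u, p)"
  by (simp add: total_deriv0_def tot1_def dird_axis_pair[where r = "p$i"] flip: dird_def)

context
  fixes I :: "real set" and S :: vfield
  assumes I: "open I" and S: "smooth_on (UNIV \<times> I) S"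
begin

lemma smooth_xi: "smooth_on (UNIV \<times> I) (xi S k)"
  by (rule smooth_on_bounded_linear_comp[where L = "\<lambda>v. fst v $ k", OF open_Times[OF open_UNIV I] _ S])
     (rule bounded_linear_compose[OF bounded_linear_vec_nth bounded_linear_fst])

lemma smooth_eta: "smooth_on (UNIV \<times> I) (eta S)"
  by (rule smooth_on_bounded_linear_comp[OF open_Times[OF open_UNIV I] bounded_linear_snd S])

lemma prolong_coeff1_eq:
  assumes "u \<in> I"
  shows "prolong_coeff1 S i (z, u, p)
    = tot1 i (eta S) (z, u, p) - (\<Sum>k\<in>UNIV. p$k * tot1 i (xi S k) (z, u, p))"
proof -
  have "xi S k differentiable (at (z, u))" "eta S differentiable (at (z, u))" for k
    using smooth_on_differentiable[OF smooth_xi] smooth_on_differentiable[OF smooth_eta] assms by auto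
  then show ?thesis by (simp add: prolong_coeff1_def total_deriv0_eq)
qed

lemma has_derivative_tot1:
  assumes "smooth_on (UNIV \<times> I) g" "u \<in> I"
  shows "(tot1 i g has_derivative (\<lambda>v. dird (fst v, fst (snd v)) (dz i g) (z, u)
     + (p$i * dird (fst v, fst (snd v)) (du g) (z, u) + snd (snd v) $ i * du g (z, u)))) (at (z, u, p))"
proof -
  have base: "((\<lambda>w::jet1. (fst w, fst (snd w))) has_derivative (\<lambda>v. (fst v, fst (snd v)))) (at (z, u, p))"
    by (auto intro!: derivative_eq_intros)
  have d: "dird v g differentiable (at (fst (z, u, p), fst (snd (z, u, p))))" for v
    using smooth_on_differentiable[OF smooth_on_dird[OF assms(1)]] assms(2) by auto
  have h: "((\<lambda>w::jet1. dird v g (fst w, fst (snd w))) has_derivative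
      (\<lambda>w. dird (fst w, fst (snd w)) (dird v g) (z, u))) (at (z, u, p))" for v
    using diff_chain_at[OF base has_derivative_dird[OF d]] by (simp add: o_def)
  have n: "((\<lambda>w::jet1. snd (snd w) $ i) has_derivative (\<lambda>v. snd (snd v) $ i)) (at (z, u, p))"
    by (rule bounded_linear_imp_has_derivative)
       (intro bounded_linear_compose[OF bounded_linear_vec_nth] bounded_linear_compose[OF bounded_linear_snd] bounded_linear_snd)
  have "tot1 i g = (\<lambda>w. dz i g (fst w, fst (snd w)) + snd (snd w) $ i * du g (fst w, fst (snd w)))"
    by (auto simp: tot1_def)
  then show ?thesis
    using has_derivative_add[OF h[of "(axis i 1, 0)"] has_derivative_mult[OF n h[of "(0, 1)"]]] by simp
qed

lemma prolong_coeff2_eq: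
  assumes "u \<in> I"
  shows "prolong_coeff2 S i j (z, u, p, q)
    = tot2 i j (eta S) (z, u, p, q)
      - (\<Sum>k\<in>UNIV. p$k * tot2 i j (xi S k) (z, u, p, q) + q$j$k * tot1 i (xi S k) (z, u, p))
      - (\<Sum>k\<in>UNIV. q$i$k * tot1 j (xi S k) (z, u, p))"
proof -
  let ?v = "(axis j 1, p$j, q$j)"
  have diff: "dird v g differentiable (at (z, u))" if "smooth_on (UNIV \<times> I) g" for v and g :: "jet0 \<Rightarrow> real"
    using smooth_on_differentiable[OF smooth_on_dird[OF that]] assms by auto
  have t1: "tot1 i g differentiable (at (z, u, p))" "dird ?v (tot1 i g) (z, u, p) = tot2 i j g (z, u, p, q)"
    if "smooth_on (UNIV \<times> I) g" for g
    using has_derivative_tot1[OF that assms, of i z p] dirdI[OF has_derivative_tot1[OF that assms], of ?v]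
    by (auto simp: differentiable_def tot2_def tot1_def dird_axis_pair[OF diff[OF that], where r = "p$j"])
  have n: "((\<lambda>w::jet1. snd (snd w) $ k) has_derivative (\<lambda>v. snd (snd v) $ k)) (at w)" for k w
    by (rule bounded_linear_imp_has_derivative)
       (intro bounded_linear_compose[OF bounded_linear_vec_nth] bounded_linear_compose[OF bounded_linear_snd] bounded_linear_snd)
  have "((\<lambda>w. tot1 i (eta S) w - (\<Sum>k\<in>UNIV. snd (snd w) $ k * tot1 i (xi S k) w)) has_derivative
     (\<lambda>v. dird v (tot1 i (eta S)) (z, u, p) - (\<Sum>k\<in>UNIV. snd (snd (z, u, p)) $ k * dird v (tot1 i (xi S k)) (z, u, p)
        + snd (snd v) $ k * tot1 i (xi S k) (z, u, p)))) (at (z, u, p))"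
    by (intro has_derivative_diff has_derivative_sum has_derivative_mult n has_derivative_dird t1
          smooth_eta smooth_xi)
  from dirdI[OF this, of ?v]
  have "dird ?v (\<lambda>w. tot1 i (eta S) w - (\<Sum>k\<in>UNIV. snd (snd w) $ k * tot1 i (xi S k) w)) (z, u, p)
    = tot2 i j (eta S) (z, u, p, q)
      - (\<Sum>k\<in>UNIV. p$k * tot2 i j (xi S k) (z, u, p, q) + q$j$k * tot1 i (xi S k) (z, u, p))"
    by (simp add: t1(2) smooth_eta smooth_xi)
  moreover have "dird ?v (prolong_coeff1 S i) (z, u, p)
    = dird ?v (\<lambda>w. tot1 i (eta S) w - (\<Sum>k\<in>UNIV. snd (snd w) $ k * tot1 i (xi S k) w)) (z, u, p)"
  proof (rule dird_cong)
    show "open (UNIV \<times> (I \<times> UNIV) :: jet1 set)" using I by (simp add: open_Times)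
  qed (use assms prolong_coeff1_eq in auto)
  moreover have "total_deriv0 j (xi S k) (z, u, p) = tot1 j (xi S k) (z, u, p)" for k
    using smooth_on_differentiable[OF smooth_xi] assms by (intro total_deriv0_eq) auto
  ultimately show ?thesis
    by (simp add: prolong_coeff2_def total_deriv1_def flip: dird_def)
qed

end

lemma has_derivative_heis_eq:
  assumes "(f has_real_derivative f') (at u)"
  shows "(heis_eq f has_derivative (\<lambda>(z', u', p', q').
     q'$1$1 + q'$2$2 + 4 * ((z$1)\<^sup>2 + (z$2)\<^sup>2) * q'$3$3 + 8 * (z$1 * z'$1 + z$2 * z'$2) * q$3$3
     + 4 * (z$2 * q'$1$3 + z'$2 * q$1$3) - 4 * (z$1 * q'$2$3 + z'$1 * q$2$3) + f' * u')) (at (z, u, p, q))"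
proof -
  have z: "((\<lambda>w::jet2. fst w $ k) has_derivative (\<lambda>v. fst v $ k)) (at w)" for k w
    by (rule bounded_linear_imp_has_derivative, rule bounded_linear_compose[OF bounded_linear_vec_nth bounded_linear_fst])
  have q: "((\<lambda>w::jet2. snd (snd (snd w)) $ k $ l) has_derivative (\<lambda>v. snd (snd (snd v)) $ k $ l)) (at w)" for k l w
    by (rule bounded_linear_imp_has_derivative)
       (intro bounded_linear_compose[OF bounded_linear_vec_nth] bounded_linear_compose[OF bounded_linear_snd] bounded_linear_snd)
  have f: "(f has_derivative (\<lambda>v. f' * v)) (at (fst (snd (z, u, p, q))))"
    using assms by (simp add: has_field_derivative_def)
  have u: "((\<lambda>w::jet2. fst (snd w)) has_derivative (\<lambda>v. fst (snd v))) (at (z, u, p, q))"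
    by (auto intro!: derivative_eq_intros)
  have fu: "((\<lambda>w::jet2. f (fst (snd w))) has_derivative (\<lambda>v. f' * fst (snd v))) (at (z, u, p, q))"
    using diff_chain_at[OF u f] by (simp add: o_def)
  have "heis_eq f = (\<lambda>w. snd (snd (snd w)) $ 1 $ 1 + snd (snd (snd w)) $ 2 $ 2
     + 4 * ((fst w $ 1)\<^sup>2 + (fst w $ 2)\<^sup>2) * snd (snd (snd w)) $ 3 $ 3
     + 4 * fst w $ 2 * snd (snd (snd w)) $ 1 $ 3 - 4 * fst w $ 1 * snd (snd (snd w)) $ 2 $ 3 + f (fst (snd w)))"
    by (auto simp: heis_eq_def)
  then show ?thesis
    by (auto intro!: derivative_eq_intros z q fu simp: algebra_simps)
qed


section \<open>The determining equations\<close>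

text \<open>The fields \<open>X\<close>, \<open>Y\<close> and the operator \<open>L\<close>, acting on functions of \<open>(z, u)\<close> with \<open>u\<close> as a parameter.\<close>

definition frame_X :: "(jet0 \<Rightarrow> real) \<Rightarrow> jet0 \<Rightarrow> real" where
  "frame_X g = (\<lambda>(z, u). dz 1 g (z, u) + 2 * z$2 * dz 3 g (z, u))"

definition frame_Y :: "(jet0 \<Rightarrow> real) \<Rightarrow> jet0 \<Rightarrow> real" where
  "frame_Y g = (\<lambda>(z, u). dz 2 g (z, u) - 2 * z$1 * dz 3 g (z, u))"

definition frame_L :: "(jet0 \<Rightarrow> real) \<Rightarrow> jet0 \<Rightarrow> real" where
  "frame_L g = (\<lambda>(z, u). dz 1 (dz 1 g) (z, u) + dz 2 (dz 2 g) (z, u)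
    + 4 * ((z$1)\<^sup>2 + (z$2)\<^sup>2) * dz 3 (dz 3 g) (z, u)
    + 4 * z$2 * dz 3 (dz 1 g) (z, u) - 4 * z$1 * dz 3 (dz 2 g) (z, u))"

text \<open>The operator \<open>L\<close> with total derivatives in place of partial ones, apart from the terms containing second
derivatives of \<open>u\<close>.  The combinations \<open>p\<^sub>1 + 2 y p\<^sub>3\<close> and \<open>p\<^sub>2 - 2 x p\<^sub>3\<close> are \<open>X u\<close> and \<open>Y u\<close>.\<close>

definition total_L :: "(jet0 \<Rightarrow> real) \<Rightarrow> jet1 \<Rightarrow> real" where
  "total_L g = (\<lambda>(z, u, p).
     frame_L g (z, u)
     + 2 * ((p$1 + 2 * z$2 * p$3) * frame_X (du g) (z, u) + (p$2 - 2 * z$1 * p$3) * frame_Y (du g) (z, u))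
     + ((p$1 + 2 * z$2 * p$3)\<^sup>2 + (p$2 - 2 * z$1 * p$3)\<^sup>2) * du (du g) (z, u))"

text \<open>Contracted with the symbol, the terms containing \<open>q\<close> become the left-hand side of the equation without \<open>f\<close>, so
on solutions they contribute \<open>- f\<close>.\<close>

lemma contract_tot2:
  assumes "open I" "smooth_on (UNIV \<times> I) g" "u \<in> I" "\<And>i j. q$i$j = q$j$i"
    and eq: "heis_eq f (z, u, p, q) = 0"
  shows "tot2 1 1 g (z, u, p, q) + tot2 2 2 g (z, u, p, q)
     + 4 * ((z$1)\<^sup>2 + (z$2)\<^sup>2) * tot2 3 3 g (z, u, p, q)
     + 4 * z$2 * tot2 1 3 g (z, u, p, q) - 4 * z$1 * tot2 2 3 g (z, u, p, q)
   = total_L g (z, u, p) - f u * du g (z, u)"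
proof -
  have O: "open (UNIV \<times> I :: jet0 set)" and m: "(z, u) \<in> UNIV \<times> I"
    using assms by (auto simp: open_Times)
  note c = dird_commute[OF O m assms(2)]
  have q22: "q$2$2 = - f u - q$1$1 - 4 * ((z$1)\<^sup>2 + (z$2)\<^sup>2) * q$3$3 - 4 * z$2 * q$1$3 + 4 * z$1 * q$2$3"
    using eq by (simp add: heis_eq_def)
  show ?thesis
    by (simp add: tot2_def tot1_def total_L_def frame_L_def frame_X_def frame_Y_def q22
        assms(4)[of 3 1] assms(4)[of 3 2] c[of "(0, 1)" "(axis _ 1, 0)"])
       (simp add: algebra_simps power2_eq_square)
qed

text \<open>The symmetry condition on the equation manifold.  Second derivatives of \<open>u\<close> contracted with the symbol have been
replaced by \<open>- f\<close>; those that remain are contracted with \<open>\<xi>\<close> or with its derivatives.\<close>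

lemma heis_eq_prolong2:
  assumes "open I" "smooth_on (UNIV \<times> I) S" "u \<in> I" "(f has_real_derivative f') (at u)"
    and sym: "\<And>i j. q$i$j = q$j$i" and eq: "heis_eq f (z, u, p, q) = 0"
  defines "w \<equiv> (z, u)"
  shows "frechet_derivative (heis_eq f) (at (z, u, p, q)) (prolong2 S (z, u, p, q)) =
     total_L (eta S) (z, u, p) - f u * du (eta S) w + f' * eta S w
     + 8 * (z$1 * xi S 1 w + z$2 * xi S 2 w) * q$3$3 + 4 * xi S 2 w * q$1$3 - 4 * xi S 1 w * q$2$3
     - (\<Sum>k\<in>UNIV. p$k * (total_L (xi S k) (z, u, p) - f u * du (xi S k) w)
         + 2 * (q$1$k + 2 * z$2 * q$3$k) * (frame_X (xi S k) w + (p$1 + 2 * z$2 * p$3) * du (xi S k) w)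
         + 2 * (q$2$k - 2 * z$1 * q$3$k) * (frame_Y (xi S k) w + (p$2 - 2 * z$1 * p$3) * du (xi S k) w))"
proof -
  note s = smooth_xi[OF assms(1,2)] smooth_eta[OF assms(1,2)]
  note ct = contract_tot2[OF assms(1) _ assms(3) sym eq, symmetric]
  have expand: "frechet_derivative (heis_eq f) (at (z, u, p, q)) (prolong2 S (z, u, p, q)) =
     prolong_coeff2 S 1 1 (z, u, p, q) + prolong_coeff2 S 2 2 (z, u, p, q)
     + 4 * ((z$1)\<^sup>2 + (z$2)\<^sup>2) * prolong_coeff2 S 3 3 (z, u, p, q)
     + 8 * (z$1 * xi S 1 w + z$2 * xi S 2 w) * q$3$3
     + 4 * (z$2 * prolong_coeff2 S 1 3 (z, u, p, q) + xi S 2 w * q$1$3)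
     - 4 * (z$1 * prolong_coeff2 S 2 3 (z, u, p, q) + xi S 1 w * q$2$3) + f' * eta S w"
    by (simp add: frechet_derivative_at[OF has_derivative_heis_eq[OF assms(4)], symmetric] prolong2_def w_def)
  show ?thesis
    unfolding expand w_def ct[OF s(1)] ct[OF s(2)]
    by (simp add: prolong_coeff2_eq[OF assms(1,2,3)] sum_3 w_def tot1_def frame_X_def frame_Y_def
        sym[of 2 1] sym[of 3 1] sym[of 3 2])
       (simp add: algebra_simps power2_eq_square)
qed


section \<open>Comparing coefficients\<close>

definition sym_matrix :: "real \<Rightarrow> real \<Rightarrow> real \<Rightarrow> real \<Rightarrow> real \<Rightarrow> real \<Rightarrow> real^3^3" where
  "sym_matrix a b c d e g = vector [vector [a, b, c], vector [b, d, e], vector [c, e, g]]"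

lemma sym_matrix_nth [simp]:
  "sym_matrix a b c d e g $ 1 $ 1 = a" "sym_matrix a b c d e g $ 1 $ 2 = b" "sym_matrix a b c d e g $ 1 $ 3 = c"
  "sym_matrix a b c d e g $ 2 $ 1 = b" "sym_matrix a b c d e g $ 2 $ 2 = d" "sym_matrix a b c d e g $ 2 $ 3 = e"
  "sym_matrix a b c d e g $ 3 $ 1 = c" "sym_matrix a b c d e g $ 3 $ 2 = e" "sym_matrix a b c d e g $ 3 $ 3 = g"
  by (simp_all add: sym_matrix_def)

lemma transpose_eq_iff: "transpose q = q \<longleftrightarrow> (\<forall>i j. q$i$j = q$j$i)" for q :: "'a^'n^'n"
  by (auto simp: transpose_def vec_eq_iff)

lemma transpose_sym_matrix: "transpose (sym_matrix a b c d e g) = sym_matrix a b c d e g"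
  by (simp add: transpose_eq_iff forall_3)

context
  fixes I :: "real set" and S :: vfield and f f' :: "real \<Rightarrow> real"
  assumes I: "open I" and f: "\<forall>u\<in>I. (f has_real_derivative f' u) (at u)"
    and sym: "inf_symmetry I f S"
begin

lemma symmetry_condition:
  assumes "u \<in> I" "a + d + 4 * ((z$1)\<^sup>2 + (z$2)\<^sup>2) * g + 4 * z$2 * c - 4 * z$1 * e + f u = 0"
  defines "w \<equiv> (z, u)"
  shows "total_L (eta S) (z, u, p) - f u * du (eta S) w + f' u * eta S w
     + 8 * (z$1 * xi S 1 w + z$2 * xi S 2 w) * g + 4 * xi S 2 w * c - 4 * xi S 1 w * e
     = p$1 * (total_L (xi S 1) (z, u, p) - f u * du (xi S 1) w)
       + 2 * (a + 2 * z$2 * c) * (frame_X (xi S 1) w + (p$1 + 2 * z$2 * p$3) * du (xi S 1) w)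
       + 2 * (b - 2 * z$1 * c) * (frame_Y (xi S 1) w + (p$2 - 2 * z$1 * p$3) * du (xi S 1) w)
     + (p$2 * (total_L (xi S 2) (z, u, p) - f u * du (xi S 2) w)
       + 2 * (b + 2 * z$2 * e) * (frame_X (xi S 2) w + (p$1 + 2 * z$2 * p$3) * du (xi S 2) w)
       + 2 * (d - 2 * z$1 * e) * (frame_Y (xi S 2) w + (p$2 - 2 * z$1 * p$3) * du (xi S 2) w))
     + (p$3 * (total_L (xi S 3) (z, u, p) - f u * du (xi S 3) w)
       + 2 * (c + 2 * z$2 * g) * (frame_X (xi S 3) w + (p$1 + 2 * z$2 * p$3) * du (xi S 3) w)
       + 2 * (e - 2 * z$1 * g) * (frame_Y (xi S 3) w + (p$2 - 2 * z$1 * p$3) * du (xi S 3) w))"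
proof -
  let ?q = "sym_matrix a b c d e g"
  have S: "smooth_on (UNIV \<times> I) S" using sym by (simp add: inf_symmetry_def)
  have eq: "heis_eq f (z, u, p, ?q) = 0" using assms by (simp add: heis_eq_def)
  have "frechet_derivative (heis_eq f) (at (z, u, p, ?q)) (prolong2 S (z, u, p, ?q)) = 0"
    using sym assms(1) eq by (simp add: inf_symmetry_def transpose_sym_matrix)
  then show ?thesis
    using transpose_sym_matrix[of a b c d e g]
    by (subst (asm) heis_eq_prolong2[OF I S assms(1) bspec[OF f assms(1)] _ eq])
       (simp_all add: sum_3 w_def transpose_eq_iff)
qed

text \<open>A mixed second difference of the condition, in \<open>p\<close> from \<open>0\<close> to a unit vector and in \<open>q\<close> along a direction that
keeps the equation satisfied, isolates the coefficients of the products \<open>p q\<close>.\<close>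

lemma du_xi_zero:
  assumes "u \<in> I"
  shows "du (xi S k) (z, u) = 0"
proof -
  let ?e1 = "vector [1, 0, 0] :: real^3" and ?e2 = "vector [0, 1, 0] :: real^3"
  \<comment> \<open>direction \<open>q\<^sub>1\<^sub>2\<close>\<close>
  have E: "du (xi S 2) (z, u) = 0"
    using symmetry_condition[OF assms, of 0 "- f u" z 0 0 0 ?e1 0] symmetry_condition[OF assms, of 0 "- f u" z 0 0 0 ?e1 1]
     symmetry_condition[OF assms, of 0 "- f u" z 0 0 0 0 0] symmetry_condition[OF assms, of 0 "- f u" z 0 0 0 0 1]
    by (simp add: algebra_simps)
  have E1: "du (xi S 1) (z, u) = 0"
    using symmetry_condition[OF assms, of 0 "- f u" z 0 0 0 ?e2 0] symmetry_condition[OF assms, of 0 "- f u" z 0 0 0 ?e2 1]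
     symmetry_condition[OF assms, of 0 "- f u" z 0 0 0 0 0] symmetry_condition[OF assms, of 0 "- f u" z 0 0 0 0 1]
    by (simp add: algebra_simps)
  \<comment> \<open>direction \<open>q\<^sub>1\<^sub>3\<close>, compensated by \<open>q\<^sub>1\<^sub>1 = - 4 y\<close>\<close>
  have E3: "du (xi S 3) (z, u) = 0"
    using symmetry_condition[OF assms, of 0 "- f u" z 0 0 0 ?e1 0] 
     symmetry_condition[OF assms, of "- 4 * z$2" "- f u" z 0 1 0 ?e1 0]
     symmetry_condition[OF assms, of 0 "- f u" z 0 0 0 0 0] 
     symmetry_condition[OF assms, of "- 4 * z$2" "- f u" z 0 1 0 0 0]
    by (simp add: E1 algebra_simps)
  show ?thesis using E E1 E3 exhaust_3[of k] by auto
qed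

text \<open>Once \<open>\<xi>\<close> is independent of \<open>u\<close>, the coefficient of \<open>p\<^sub>1\<^sup>2\<close> is the second \<open>u\<close>-derivative of \<open>\<eta>\<close>; it is the second
difference of the condition along \<open>p\<^sub>1\<close>.\<close>

lemma du_du_eta_zero:
  assumes "u \<in> I"
  shows "du (du (eta S)) (z, u) = 0"
proof -
  let ?e1 = "vector [1, 0, 0] :: real^3"
  have O: "open (UNIV \<times> I :: jet0 set)" and m: "(z, u) \<in> UNIV \<times> I"
    using assms I by (auto simp: open_Times)
  have z: "dird v (du (xi S k)) (z, u) = 0" for v k
    using dird_cong[OF O m, of "du (xi S k)" "\<lambda>w. 0" v] du_xi_zero by auto
  have L: "total_L (xi S k) (z, u, p) = frame_L (xi S k) (z, u)" for k p
    by (simp add: total_L_def frame_X_def frame_Y_def z)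
  note s = symmetry_condition[OF assms, of 0 "- f u" z 0 0 0 _ 0]
  show ?thesis using s[of ?e1] s[of "- ?e1"] s[of 0]
    unfolding L by (simp add: du_xi_zero[OF assms] total_L_def algebra_simps)
qed

end


lemma constant_in_u:
  fixes g :: "jet0 \<Rightarrow> real"
  assumes "is_interval I" "\<And>u. u \<in> I \<Longrightarrow> g differentiable (at (z, u))"
    and "\<And>u. u \<in> I \<Longrightarrow> du g (z, u) = 0" "u \<in> I" "v \<in> I"
  shows "g (z, u) = g (z, v)"
proof -
  have "((\<lambda>r. g (z, r)) has_real_derivative 0) (at r within I)" if "r \<in> I" for r
    using has_real_derivative_line[of g "(z, 0)" r "(0, 1)"] assms(2,3)[OF that]
    by (simp add: has_field_derivative_at_within)
  then obtain c where "\<forall>r\<in>I. g (z, r) = c"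
    using has_field_derivative_zero_constant[of I "\<lambda>r. g (z, r)"] assms(1)
    by (auto simp: is_interval_convex)
  then show ?thesis using assms(4,5) by simp
qed

lemma smooth_on_slice:
  assumes "smooth_on (UNIV \<times> I) g" "u \<in> I"
  shows "smooth_on UNIV (\<lambda>z. g (z, u))"
proof -
  have "smooth_on UNIV (\<lambda>z. g ((z, 0) + (0, u)))"
    by (rule smooth_on_affine_comp[OF open_UNIV _ _ assms(1), where L = "\<lambda>z. (z, 0)"])
       (auto simp: assms(2) intro: bounded_linear_Pair bounded_linear_ident bounded_linear_zero)
  then show ?thesis by simp
qed

text \<open>This is where connectedness of \<open>I\<close> enters: the vanishing \<open>u\<close>-derivatives are integrated along the interval.\<close>

lemma symmetry_affine_form:
  assumes I: "open I" "is_interval I" "u0 \<in> I"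
    and f: "\<forall>u\<in>I. (f has_real_derivative f' u) (at u)"
    and sym: "inf_symmetry I f S"
  obtains a1 a2 a3 \<alpha> \<beta> where
    "smooth_on UNIV a1" "smooth_on UNIV a2" "smooth_on UNIV a3" "smooth_on UNIV \<alpha>" "smooth_on UNIV \<beta>"
    "\<And>z u. u \<in> I \<Longrightarrow> S (z, u) = (vector [a1 z, a2 z, a3 z], \<alpha> z * u + \<beta> z)"
proof -
  have S: "smooth_on (UNIV \<times> I) S" using sym by (simp add: inf_symmetry_def)
  note xi = smooth_xi[OF I(1) S] and eta = smooth_eta[OF I(1) S]
  define a where "a k z = xi S k (z, u0)" for k z
  define \<alpha> where "\<alpha> z = du (eta S) (z, u0)" for z
  define \<beta> where "\<beta> z = eta S (z, u0) - u0 * \<alpha> z" for z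
  have a: "smooth_on UNIV (a k)" for k
    unfolding a_def using smooth_on_slice[OF xi I(3)] .
  have \<alpha>: "smooth_on UNIV \<alpha>"
    unfolding \<alpha>_def using smooth_on_slice[OF smooth_on_dird[OF eta] I(3)] .
  have \<beta>: "smooth_on UNIV \<beta>"
    unfolding \<beta>_def using smooth_on_diff[OF open_UNIV smooth_on_slice[OF eta I(3)] smooth_on_cmult[OF open_UNIV \<alpha>]] .
  have diff: "g differentiable (at (z, u))" if "smooth_on (UNIV \<times> I) g" "u \<in> I" for g :: "jet0 \<Rightarrow> real" and z u
    using smooth_on_differentiable[OF that(1), of "(z, u)"] that(2) by simp
  have xi_eq: "xi S k (z, u) = a k z" if "u \<in> I" for k z u
    unfolding a_def
    by (rule constant_in_u[OF I(2) diff[OF xi] du_xi_zero[OF I(1) f sym] that I(3)])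
  have du_eta: "du (eta S) (z, u) = \<alpha> z" if "u \<in> I" for z u
    unfolding \<alpha>_def
    by (rule constant_in_u[OF I(2) diff[OF smooth_on_dird[OF eta]] du_du_eta_zero[OF I(1) f sym] that I(3)])
  have eta_eq: "eta S (z, u) = \<alpha> z * u + \<beta> z" if "u \<in> I" for z u
  proof -
    have l: "bounded_linear (\<lambda>w::jet0. snd w * \<alpha> z)"
      by (intro bounded_linear_intros)
    note d = bounded_linear_imp_differentiable[OF l]
    have "eta S (z, u) - snd (z, u) * \<alpha> z = eta S (z, u0) - snd (z, u0) * \<alpha> z"
    proof (rule constant_in_u[OF I(2) _ _ that I(3)])
      show "(\<lambda>w. eta S w - snd w * \<alpha> z) differentiable at (z, u)" if "u \<in> I" for u
        by (rule differentiable_diff[OF diff[OF eta that] d])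
      show "du (\<lambda>w. eta S w - snd w * \<alpha> z) (z, u) = 0" if "u \<in> I" for u
        by (subst dird_diff[OF diff[OF eta that] d])
           (simp add: dird_bounded_linear[OF l] du_eta[OF that])
    qed
    then show ?thesis by (simp add: \<beta>_def algebra_simps)
  qed
  show thesis
  proof (rule that[OF a[of 1] a[of 2] a[of 3] \<alpha> \<beta>])
    fix z u assume u: "u \<in> I"
    have "fst (S (z, u)) = vector [a 1 z, a 2 z, a 3 z]"
      by (simp add: vec_eq_iff forall_3 xi_eq[OF u])
    then show "S (z, u) = (vector [a 1 z, a 2 z, a 3 z], \<alpha> z * u + \<beta> z)"
      using eta_eq[OF u] by (simp add: prod_eq_iff)
  qed
qed

lemma smooth_on_fst: "open I \<Longrightarrow> smooth_on UNIV h \<Longrightarrow> smooth_on (UNIV \<times> I) (\<lambda>w. h (fst w))"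
  using smooth_on_affine_comp[OF open_Times[OF open_UNIV] bounded_linear_fst, of I 0 UNIV h] by simp

lemma dird_affine_in_u:
  fixes g :: "jet0 \<Rightarrow> real"
  assumes "open I" "smooth_on UNIV \<alpha>" "smooth_on UNIV \<beta>" "u \<in> I"
    and g: "\<And>z u. u \<in> I \<Longrightarrow> g (z, u) = \<alpha> z * u + \<beta> z"
  shows "dird (v, r) g (z, u) = dird v \<alpha> z * u + (dird v \<beta> z + r * \<alpha> z)"
proof -
  have O: "open (UNIV \<times> I :: jet0 set)" and m: "(z, u) \<in> UNIV \<times> I"
    using assms by (auto simp: open_Times)
  have d: "\<alpha> differentiable (at (fst (z, u)))" "\<beta> differentiable (at (fst (z, u)))"
    using assms(2,3) smooth_on_differentiable[OF _ UNIV_I] by auto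
  have comp: "((\<lambda>w. h (fst w)) has_derivative (\<lambda>v. dird (fst v) h z)) (at (z, u))"
    if "h differentiable (at (fst (z, u)))" for h :: "real^3 \<Rightarrow> real"
    using diff_chain_at[OF has_derivative_fst[OF has_derivative_ident] has_derivative_dird[OF that]]
    by (simp add: o_def)
  have "((\<lambda>w. \<alpha> (fst w) * snd w + \<beta> (fst w)) has_derivative
      (\<lambda>v. \<alpha> z * snd v + dird (fst v) \<alpha> z * u + dird (fst v) \<beta> z)) (at (z, u))"
    using has_derivative_add[OF has_derivative_mult[OF comp[OF d(1)] has_derivative_snd[OF has_derivative_ident]] comp[OF d(2)]]
    by simp
  from dirdI[OF this, of "(v, r)"] show ?thesis
    using dird_cong[OF O m, of g "\<lambda>w. \<alpha> (fst w) * snd w + \<beta> (fst w)" "(v, r)"] g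
    by (auto simp: algebra_simps)
qed

lemma frame_affine_in_u:
  fixes g :: "jet0 \<Rightarrow> real"
  assumes I: "open I" "u \<in> I" and s: "smooth_on UNIV \<alpha>" "smooth_on UNIV \<beta>"
    and g: "\<And>z u. u \<in> I \<Longrightarrow> g (z, u) = \<alpha> z * u + \<beta> z"
  shows "du g (z, u) = \<alpha> z"
    and "frame_X g (z, u) = heis_X \<alpha> z * u + heis_X \<beta> z"
    and "frame_Y g (z, u) = heis_Y \<alpha> z * u + heis_Y \<beta> z"
    and "total_L g (z, u, p) = kohn_laplace \<alpha> z * u + kohn_laplace \<beta> z
       + 2 * ((p$1 + 2 * z$2 * p$3) * heis_X \<alpha> z + (p$2 - 2 * z$1 * p$3) * heis_Y \<alpha> z)"
proof -
  have zero: "dird 0 h z = 0" if "smooth_on UNIV h" for h :: "real^3 \<Rightarrow> real" and z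
    using dird_scaleR_left[OF smooth_on_differentiable[OF that UNIV_I], of 0 0] by simp
  have du_g: "du g (z, u) = 0 * u + \<alpha> z" if "u \<in> I" for z u
    using dird_affine_in_u[OF I(1) s that g, of 0 1] s zero by simp
  have dz_g: "dz i g (z, u) = partial i \<alpha> z * u + partial i \<beta> z" if "u \<in> I" for z u i
    using dird_affine_in_u[OF I(1) s that g, of "axis i 1" 0] by (simp add: partial_eq_dird)
  have dz2: "dz j (dz i g) (z, u) = partial j (partial i \<alpha>) z * u + partial j (partial i \<beta>) z" if "u \<in> I" for z u i j
    using dird_affine_in_u[OF I(1) smooth_on_partial[OF s(1)] smooth_on_partial[OF s(2)] that dz_g, of "axis j 1" 0]
    by (simp add: partial_eq_dird)
  have dzdu: "dz i (du g) (z, u) = partial i \<alpha> z" if "u \<in> I" for z u i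
    using dird_affine_in_u[OF I(1) smooth_on_const[of UNIV 0] s(1) that du_g, of "axis i 1" 0]
    by (simp add: partial_eq_dird)
  have dudu: "du (du g) (z, u) = 0" if "u \<in> I" for z u
    using dird_affine_in_u[OF I(1) smooth_on_const[of UNIV 0] s(1) that du_g, of 0 1] zero[OF s(1)]
    by simp
  show "du g (z, u) = \<alpha> z"
    and "frame_X g (z, u) = heis_X \<alpha> z * u + heis_X \<beta> z"
    and "frame_Y g (z, u) = heis_Y \<alpha> z * u + heis_Y \<beta> z"
    and "total_L g (z, u, p) = kohn_laplace \<alpha> z * u + kohn_laplace \<beta> z
       + 2 * ((p$1 + 2 * z$2 * p$3) * heis_X \<alpha> z + (p$2 - 2 * z$1 * p$3) * heis_Y \<alpha> z)"
    by (simp_all add: du_g[OF I(2)] frame_X_def frame_Y_def heis_X_def heis_Y_def dz_g[OF I(2)] total_L_def frame_L_def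
        dz2[OF I(2)] dzdu[OF I(2)] dudu[OF I(2)] kohn_laplace_coords[OF open_UNIV s(1) UNIV_I]
        kohn_laplace_coords[OF open_UNIV s(2) UNIV_I] algebra_simps)
qed

lemma smooth_on_vector_field:
  assumes "open O'" "\<And>k. smooth_on O' (\<lambda>w. fst (S w) $ k)" "smooth_on O' (\<lambda>w. snd (S w))"
  shows "smooth_on O' (S :: vfield)"
proof -
  have l: "bounded_linear (\<lambda>r::real. r *\<^sub>R v)" for v :: jet0
    by (rule bounded_linear_scaleR_left)
  have decomp: "fst (S w) $ 1 *\<^sub>R (axis 1 1, 0) + fst (S w) $ 2 *\<^sub>R (axis 2 1, 0)
      + fst (S w) $ 3 *\<^sub>R (axis 3 1, 0) + snd (S w) *\<^sub>R (0, 1) = S w" for w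
    by (simp add: prod_eq_iff vec_eq_iff forall_3 axis_def)
  have "smooth_on O' (\<lambda>w. fst (S w) $ 1 *\<^sub>R (axis 1 1, 0) + fst (S w) $ 2 *\<^sub>R (axis 2 1, 0)
      + fst (S w) $ 3 *\<^sub>R (axis 3 1, 0) + snd (S w) *\<^sub>R (0, 1 :: real) :: jet0)"
    by (intro smooth_on_add assms(1) smooth_on_bounded_linear_comp[OF assms(1) l assms(2)]
          smooth_on_bounded_linear_comp[OF assms(1) l assms(3)])
  then show ?thesis
    by (rule smooth_on_cong[OF assms(1)]) (rule decomp)
qed


text \<open>For \<open>\<xi> = (a1, a2, a3)\<close> the first four equations say that \<open>\<xi>\<close> preserves the symbol of the operator up to a
scalar factor; the last three, that the first-order terms produced by \<open>\<xi>\<close> and by \<open>\<eta> = \<alpha> u + \<beta>\<close> cancel.\<close>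

definition determining_equations :: "(real^3 \<Rightarrow> real) \<Rightarrow> (real^3 \<Rightarrow> real) \<Rightarrow> (real^3 \<Rightarrow> real) \<Rightarrow> (real^3 \<Rightarrow> real) \<Rightarrow> bool" where
  "determining_equations a1 a2 a3 \<alpha> \<longleftrightarrow> (\<forall>z.
     heis_X a1 z = heis_Y a2 z \<and> heis_X a2 z = - heis_Y a1 z \<and>
     heis_X a3 z = 2 * a2 z + 2 * z$2 * heis_X a1 z + 2 * z$1 * heis_Y a1 z \<and>
     heis_Y a3 z = - 2 * a1 z - 2 * z$1 * heis_X a1 z - 2 * z$2 * heis_X a2 z \<and>
     2 * heis_X \<alpha> z = kohn_laplace a1 z \<and> 2 * heis_Y \<alpha> z = kohn_laplace a2 z \<and>
     4 * (z$2 * heis_X \<alpha> z - z$1 * heis_Y \<alpha> z) = kohn_laplace a3 z)"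

lemma heis_const:
  "heis_X (\<lambda>z. c) = (\<lambda>z. 0)" "heis_Y (\<lambda>z. c) = (\<lambda>z. 0)" "kohn_laplace (\<lambda>z. c) z = 0"
proof -
  show X: "heis_X (\<lambda>z. c) = (\<lambda>z. 0)" and Y: "heis_Y (\<lambda>z. c) = (\<lambda>z. 0)" for c
    by (simp_all add: fun_eq_iff heis_X_def heis_Y_def partial_eq_dird)
  show "kohn_laplace (\<lambda>z. c) z = 0" by (simp add: kohn_laplace_def X Y)
qed

text \<open>For fields with \<open>\<xi>\<close> independent of \<open>u\<close> and \<open>\<eta>\<close> affine in \<open>u\<close> the condition is affine in \<open>p\<close> and \<open>q\<close>.  The determining
equations are its coefficients, and the remaining equation is its value where \<open>q\<^sub>2\<^sub>2 = - f\<close> and all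
other derivatives of \<open>u\<close> vanish.\<close>

lemma symmetry_iff_determining:
  fixes S :: vfield
  assumes I: "open I" "I \<noteq> {}" and f: "\<forall>u\<in>I. (f has_real_derivative f' u) (at u)"
    and a: "smooth_on UNIV a1" "smooth_on UNIV a2" "smooth_on UNIV a3"
    and s: "smooth_on UNIV \<alpha>" "smooth_on UNIV \<beta>"
    and form: "\<And>z u. u \<in> I \<Longrightarrow> S (z, u) = (vector [a1 z, a2 z, a3 z], \<alpha> z * u + \<beta> z)"
  shows "inf_symmetry I f S \<longleftrightarrow> determining_equations a1 a2 a3 \<alpha> \<and>
    (\<forall>z. \<forall>u\<in>I. f' u * (\<alpha> z * u + \<beta> z) + kohn_laplace \<alpha> z * u + kohn_laplace \<beta> z
        - (\<alpha> z - 2 * heis_X a1 z) * f u = 0)" (is "_ \<longleftrightarrow> ?D \<and> ?E")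
proof -
  have "eta S (z, u) = \<alpha> z * u + \<beta> z" if "u \<in> I" for z u
    using form[OF that] by simp
  note eta = this frame_affine_in_u[OF I(1) _ s this]
  have x1: "xi S 1 (z, u) = 0 * u + a1 z" and x2: "xi S 2 (z, u) = 0 * u + a2 z"
    and x3: "xi S 3 (z, u) = 0 * u + a3 z" if "u \<in> I" for z u
    using form[OF that] by simp_all
  note x1 = x1 frame_affine_in_u[OF I(1) _ smooth_on_const[of UNIV 0] a(1) x1, unfolded heis_const]
  note x2 = x2 frame_affine_in_u[OF I(1) _ smooth_on_const[of UNIV 0] a(2) x2, unfolded heis_const]
  note x3 = x3 frame_affine_in_u[OF I(1) _ smooth_on_const[of UNIV 0] a(3) x3, unfolded heis_const]
  have S: "smooth_on (UNIV \<times> I) S"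
  proof (rule smooth_on_vector_field)
    show O: "open (UNIV \<times> I :: jet0 set)" using I by (simp add: open_Times)
    have m: "smooth_on (UNIV \<times> I :: jet0 set) snd"
      by (rule smooth_on_bounded_linear[OF bounded_linear_snd])
    have "smooth_on (UNIV \<times> I) (\<lambda>w. \<alpha> (fst w) * snd w + \<beta> (fst w))"
      by (intro smooth_on_add smooth_on_mult O m smooth_on_fst I s)
    then show "smooth_on (UNIV \<times> I) (eta S)"
      by (rule smooth_on_cong[OF O]) (auto simp: form)
    have "smooth_on (UNIV \<times> I) (xi S 1)"
      by (rule smooth_on_cong[OF O smooth_on_fst[OF I(1) a(1)]]) (auto simp: form)
    moreover have "smooth_on (UNIV \<times> I) (xi S 2)"
      by (rule smooth_on_cong[OF O smooth_on_fst[OF I(1) a(2)]]) (auto simp: form)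
    moreover have "smooth_on (UNIV \<times> I) (xi S 3)"
      by (rule smooth_on_cong[OF O smooth_on_fst[OF I(1) a(3)]]) (auto simp: form)
    ultimately show "smooth_on (UNIV \<times> I) (xi S k)" for k
      using exhaust_3[of k] by auto
  qed
  show ?thesis
  proof
    assume sym: "inf_symmetry I f S"
    obtain u0 where u0: "u0 \<in> I" using I by blast
    let ?e1 = "vector [1, 0, 0] :: real^3" and ?e2 = "vector [0, 1, 0] :: real^3" and ?e3 = "vector [0, 0, 1] :: real^3"
    note cond = symmetry_condition[OF I(1) f sym, unfolded mult_zero_left add_0]
    have base: "f' u * (\<alpha> z * u + \<beta> z) + kohn_laplace \<alpha> z * u + kohn_laplace \<beta> z
        - \<alpha> z * f u + 2 * heis_Y a2 z * f u = 0" if "u \<in> I" for z u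
      using cond[OF that, of 0 "- f u" z 0 0 0 0 0] that by (simp add: eta x1 x2 x3 algebra_simps)
    note base0 = base[OF u0]
    note rules = eta[OF u0] x1[OF u0] x2[OF u0] x3[OF u0] algebra_simps power2_eq_square
    \<comment> \<open>each instance differs from the basic one in a single direction of \<open>q\<close> or \<open>p\<close> along the equation\<close>
    have eq11: "heis_X a1 z = heis_Y a2 z" for z
      using cond[OF u0, of 1 "- f u0 - 1" z 0 0 0 0 0] base0[of z] by (simp add: rules)
    have eq12: "heis_X a2 z = - heis_Y a1 z" for z
      using cond[OF u0, of 0 "- f u0" z 0 0 0 0 1] base0[of z] by (simp add: rules)
    have eq13: "heis_X a3 z = 2 * a2 z + 2 * z$2 * heis_X a1 z + 2 * z$1 * heis_Y a1 z" for z
      using cond[OF u0, of "- 4 * z$2" "- f u0" z 0 1 0 0 0] base0[of z] by (simp add: rules)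
    have eq23: "heis_Y a3 z = - 2 * a1 z - 2 * z$1 * heis_X a1 z - 2 * z$2 * heis_X a2 z" for z
      using cond[OF u0, of "4 * z$1" "- f u0" z 0 0 1 0 0] base0[of z] by (simp add: rules eq11)
    have p1: "2 * heis_X \<alpha> z = kohn_laplace a1 z" for z
      using cond[OF u0, of 0 "- f u0" z 0 0 0 ?e1 0] base0[of z] by (simp add: rules)
    have p2: "2 * heis_Y \<alpha> z = kohn_laplace a2 z" for z
      using cond[OF u0, of 0 "- f u0" z 0 0 0 ?e2 0] base0[of z] by (simp add: rules)
    have p3: "4 * (z$2 * heis_X \<alpha> z - z$1 * heis_Y \<alpha> z) = kohn_laplace a3 z" for z
      using cond[OF u0, of 0 "- f u0" z 0 0 0 ?e3 0] base0[of z] by (simp add: rules)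
    have "?D" unfolding determining_equations_def using eq11 eq12 eq13 eq23 p1 p2 p3 by blast
    moreover have "?E" using base by (simp add: eq11 algebra_simps)
    ultimately show "?D \<and> ?E" ..
  next
    assume "?D \<and> ?E"
    then have D: "?D" and E: "?E" by auto
    show "inf_symmetry I f S"
      unfolding inf_symmetry_def
    proof (intro conjI S allI impI)
      fix z u p q
      assume A: "u \<in> I \<and> transpose q = q \<and> heis_eq f (z, u, p, q) = 0"
      then have u: "u \<in> I" and q: "\<And>i j. q$i$j = q$j$i" and eq: "heis_eq f (z, u, p, q) = 0"
        by (auto simp: transpose_eq_iff)
      have q22: "q$2$2 = - f u - q$1$1 - 4 * ((z$1)\<^sup>2 + (z$2)\<^sup>2) * q$3$3 - 4 * z$2 * q$1$3 + 4 * z$1 * q$2$3"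
        using eq by (simp add: heis_eq_def)
      have L: "kohn_laplace \<beta> z = - (f' u * (\<alpha> z * u + \<beta> z)) - kohn_laplace \<alpha> z * u
        + (\<alpha> z - 2 * heis_X a1 z) * f u" using E u by (simp add: algebra_simps)
      have dets: "heis_Y a2 z = heis_X a1 z" "heis_X a2 z = - heis_Y a1 z"
        "heis_X a3 z = 2 * a2 z + 2 * z$2 * heis_X a1 z + 2 * z$1 * heis_Y a1 z"
        "heis_Y a3 z = - 2 * a1 z - 2 * z$1 * heis_X a1 z + 2 * z$2 * heis_Y a1 z"
        "kohn_laplace a1 z = 2 * heis_X \<alpha> z" "kohn_laplace a2 z = 2 * heis_Y \<alpha> z"
        "kohn_laplace a3 z = 4 * (z$2 * heis_X \<alpha> z - z$1 * heis_Y \<alpha> z)"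
        using D unfolding determining_equations_def by auto
      show "frechet_derivative (heis_eq f) (at (z, u, p, q)) (prolong2 S (z, u, p, q)) = 0"
        unfolding heis_eq_prolong2[OF I(1) S u bspec[OF f u] q eq] sum_3
        by (simp add: eta[OF u] x1[OF u] x2[OF u] x3[OF u] dets L q22 q[of 2 1] q[of 3 1] q[of 3 2])
           (simp add: algebra_simps power2_eq_square)
    qed
  qed
qed


section \<open>Solving the determining equations\<close>

lemma heis_of_has_derivative:
  assumes "\<And>z. (h has_derivative (\<lambda>v. v$1 * G1 z + v$2 * G2 z + v$3 * G3 z)) (at z)"
  shows "heis_X h = (\<lambda>z. G1 z + 2 * z$2 * G3 z)"
    and "heis_Y h = (\<lambda>z. G2 z - 2 * z$1 * G3 z)"
  using dirdI[OF assms] by (simp_all add: fun_eq_iff heis_X_def heis_Y_def partial_eq_dird axis_def)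

lemma heis_add:
  assumes "smooth_on UNIV g" "smooth_on UNIV h"
  shows heis_X_add: "heis_X (\<lambda>z. g z + h z) = (\<lambda>z. heis_X g z + heis_X h z)"
    and heis_Y_add: "heis_Y (\<lambda>z. g z + h z) = (\<lambda>z. heis_Y g z + heis_Y h z)"
  using dird_add[OF smooth_on_differentiable[OF assms(1) UNIV_I] smooth_on_differentiable[OF assms(2) UNIV_I]]
  by (simp_all add: fun_eq_iff heis_X_def heis_Y_def partial_eq_dird algebra_simps)

lemma heis_nth_mult:
  assumes "smooth_on UNIV g"
  shows heis_X_nth_mult: "heis_X (\<lambda>z. z$j * g z) = (\<lambda>z. heis_X (\<lambda>z. z$j) z * g z + z$j * heis_X g z)"
    and heis_Y_nth_mult: "heis_Y (\<lambda>z. z$j * g z) = (\<lambda>z. heis_Y (\<lambda>z. z$j) z * g z + z$j * heis_Y g z)"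
  using dird_mult[OF smooth_on_differentiable[OF smooth_on_nth UNIV_I] smooth_on_differentiable[OF assms UNIV_I]]
  by (simp_all add: fun_eq_iff heis_X_def heis_Y_def partial_eq_dird algebra_simps)

lemma heis_nth:
  "heis_X (\<lambda>z. z$1) = (\<lambda>z. 1)" "heis_X (\<lambda>z. z$2) = (\<lambda>z. 0)"
  "heis_Y (\<lambda>z. z$1) = (\<lambda>z. 0)" "heis_Y (\<lambda>z. z$2) = (\<lambda>z. 1)"
  by (simp_all add: fun_eq_iff heis_X_def heis_Y_def partial_nth)

lemma kohn_laplace_cmult:
  "smooth_on UNIV g \<Longrightarrow> kohn_laplace (\<lambda>z. c * g z) z = c * kohn_laplace g z"
  by (simp add: kohn_laplace_def heis_cmult smooth_on_heis_X smooth_on_heis_Y algebra_simps)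

lemma kohn_laplace_add:
  "smooth_on UNIV g \<Longrightarrow> smooth_on UNIV h \<Longrightarrow> kohn_laplace (\<lambda>z. g z + h z) z = kohn_laplace g z + kohn_laplace h z"
  by (simp add: kohn_laplace_def heis_add smooth_on_heis_X smooth_on_heis_Y)

text \<open>The potential is \<open>C = a3 - 2 y a1 + 2 x a2\<close>, the \<open>T\<close>-component of the field in the frame \<open>X\<close>, \<open>Y\<close>, \<open>T\<close>.  The
third-order identities for \<open>C\<close> give \<open>L a1 = - X T C\<close> and \<open>L a2 = - Y T C\<close>, so \<open>\<alpha> + T C / 2\<close> is annihilated by
\<open>X\<close> and \<open>Y\<close>, hence by their commutator, and is constant.\<close>

lemma determining_solutions:
  assumes a: "smooth_on UNIV a1" "smooth_on UNIV a2" "smooth_on UNIV a3" and \<alpha>: "smooth_on UNIV \<alpha>"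
    and D: "determining_equations a1 a2 a3 \<alpha>"
  obtains cT cR cX cY v1 v2 v3 s e where
    "\<And>z. a1 z = cX + cR * z$2 + v1 * (z$1 * z$3 - (z$1)\<^sup>2 * z$2 - z$2 ^ 3) + v2 * (z$3 - 4 * z$1 * z$2)
       + v3 * ((z$1)\<^sup>2 - 3 * (z$2)\<^sup>2) + s * z$1"
    "\<And>z. a2 z = cY - cR * z$1 + v1 * (z$2 * z$3 + z$1 ^ 3 + z$1 * (z$2)\<^sup>2) + v2 * (3 * (z$1)\<^sup>2 - (z$2)\<^sup>2)
       + v3 * (z$3 + 4 * z$1 * z$2) + s * z$2"
    "\<And>z. a3 z = cT - 2 * cX * z$2 + 2 * cY * z$1 + v1 * ((z$3)\<^sup>2 - ((z$1)\<^sup>2 + (z$2)\<^sup>2)\<^sup>2)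
       - v2 * (2 * z$2 * z$3 + 2 * z$1 ^ 3 + 2 * z$1 * (z$2)\<^sup>2)
       + v3 * (2 * z$1 * z$3 - 2 * (z$1)\<^sup>2 * z$2 - 2 * z$2 ^ 3) + 2 * s * z$3"
    "\<And>z. \<alpha> z = e - (v1 * z$3 - 2 * v2 * z$2 + 2 * v3 * z$1)"
proof -
  define C where "C z = a3 z + (- 2 * (z$2 * a1 z) + 2 * (z$1 * a2 z))" for z
  note sm = smooth_on_heis_X[OF open_UNIV] smooth_on_heis_Y[OF open_UNIV] smooth_on_partial
    smooth_on_add[OF open_UNIV] smooth_on_cmult[OF open_UNIV] smooth_on_mult[OF open_UNIV smooth_on_nth]
  have C: "smooth_on UNIV C" unfolding C_def[abs_def] by (intro sm a)
  note d = D[unfolded determining_equations_def, rule_format]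
  have "heis_X C = (\<lambda>z. heis_X a3 z + (- 2 * (0 * a1 z + z$2 * heis_X a1 z) + 2 * (1 * a2 z + z$1 * heis_X a2 z)))"
    unfolding C_def[abs_def] by (simp only: heis_X_add heis_X_cmult heis_X_nth_mult heis_nth sm a)
  then have XC: "heis_X C = (\<lambda>z. 4 * a2 z)"
    using d by (simp add: fun_eq_iff algebra_simps)
  have "heis_Y C = (\<lambda>z. heis_Y a3 z + (- 2 * (1 * a1 z + z$2 * heis_Y a1 z) + 2 * (0 * a2 z + z$1 * heis_Y a2 z)))"
    unfolding C_def[abs_def] by (simp only: heis_Y_add heis_Y_cmult heis_Y_nth_mult heis_nth sm a)
  then have YC: "heis_Y C = (\<lambda>z. - 4 * a1 z)"
    using d by (simp add: fun_eq_iff algebra_simps)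
  have eq1: "heis_X (heis_X C) = heis_Y (heis_Y C)"
    unfolding XC YC heis_cmult[OF a(1)] heis_cmult[OF a(2)] using d by (simp add: fun_eq_iff)
  have eq2: "heis_X (heis_Y C) = (\<lambda>z. - 1 * heis_Y (heis_X C) z)"
    unfolding XC YC heis_cmult[OF a(1)] heis_cmult[OF a(2)] using d by (simp add: fun_eq_iff)
  obtain d0 d1 d2 d3 n a b c where
    sol: "\<And>z. C z = d0 / 2 * ((z$3)\<^sup>2 + ((z$1)\<^sup>2 + (z$2)\<^sup>2)\<^sup>2) + d1 * (z$1 * z$3 + (z$1)\<^sup>2 * z$2 + z$2 ^ 3)
       + d2 * (z$2 * z$3 - z$1 ^ 3 - z$1 * (z$2)\<^sup>2) + d3 * z$3 + n / 2 * ((z$1)\<^sup>2 + (z$2)\<^sup>2)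
       + b * z$1 + a * z$2 + c"
    "\<And>z. heis_X C z = d0 * (2 * z$1 ^ 3 + 2 * z$1 * (z$2)\<^sup>2 + 2 * z$2 * z$3) + d1 * (4 * z$1 * z$2 + z$3)
       + d2 * ((z$2)\<^sup>2 - 3 * (z$1)\<^sup>2) + 2 * d3 * z$2 + n * z$1 + b"
    "\<And>z. heis_Y C z = d0 * (2 * (z$1)\<^sup>2 * z$2 + 2 * z$2 ^ 3 - 2 * z$1 * z$3) + d1 * (3 * (z$2)\<^sup>2 - (z$1)\<^sup>2)
       + d2 * (z$3 - 4 * z$1 * z$2) - 2 * d3 * z$1 + n * z$2 + a"
    "\<And>z. partial 3 C z = d0 * z$3 + d1 * z$1 + d2 * z$2 + d3"
    and third: "heis_X (heis_X (heis_Y C)) = (\<lambda>z. - 2 * heis_X (partial 3 C) z)"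
    "heis_Y (heis_Y (heis_Y C)) = (\<lambda>z. 6 * heis_X (partial 3 C) z)"
    "heis_X (heis_X (heis_X C)) = (\<lambda>z. - 6 * heis_Y (partial 3 C) z)"
    "heis_Y (heis_Y (heis_X C)) = (\<lambda>z. 2 * heis_Y (partial 3 C) z)"
    by (rule contact_potential_polynomial[OF C eq1 eq2]) (rule that)
  have k1: "kohn_laplace (heis_X C) z = 4 * kohn_laplace a2 z" for z
    unfolding XC by (rule kohn_laplace_cmult[OF assms(2)])
  have k2: "kohn_laplace (heis_Y C) z = - 4 * kohn_laplace a1 z" for z
    unfolding YC by (rule kohn_laplace_cmult[OF assms(1)])
  have k3: "kohn_laplace (heis_X C) z = - 4 * heis_Y (partial 3 C) z"
    "kohn_laplace (heis_Y C) z = 4 * heis_X (partial 3 C) z" for z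
    by (simp_all add: kohn_laplace_def third)
  have La: "kohn_laplace a2 z = - heis_Y (partial 3 C) z" "kohn_laplace a1 z = - heis_X (partial 3 C) z" for z
    using k1[of z] k2[of z] k3[of z] by simp_all
  have X\<alpha>: "heis_X \<alpha> z = - heis_X (partial 3 C) z / 2" and Y\<alpha>: "heis_Y \<alpha> z = - heis_Y (partial 3 C) z / 2" for z
    using d[of z] La[of z] by simp_all
  define g where "g z = \<alpha> z + 1 / 2 * partial 3 C z" for z
  have g: "smooth_on UNIV g" unfolding g_def[abs_def] by (intro sm \<alpha> C)
  have Xg: "heis_X g = (\<lambda>z. 0)" and Yg: "heis_Y g = (\<lambda>z. 0)"
    unfolding g_def[abs_def] heis_add[OF \<alpha> smooth_on_cmult[OF open_UNIV smooth_on_partial[OF C]]]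
      heis_cmult[OF smooth_on_partial[OF C]]
    by (simp_all add: X\<alpha> Y\<alpha>)
  have Tg: "partial 3 g = (\<lambda>z. 0)"
    using heis_commutator[OF g] by (simp add: Xg Yg heis_const fun_eq_iff)
  obtain e where e: "\<And>z. g z = e"
    by (rule determined_by_partials[OF g, of "\<lambda>z. 0" "\<lambda>z. 0" "\<lambda>z. 0" "\<lambda>z. 0"])
       (auto simp: partial_of_heis Xg Yg Tg)
  have a2: "a2 z = heis_X C z / 4" and a1: "a1 z = - heis_Y C z / 4" for z by (simp_all add: XC YC)
  have a3: "a3 z = C z + 2 * z$2 * a1 z - 2 * z$1 * a2 z" for z by (simp add: C_def)
  show thesis
  \<comment> \<open>the values come from comparing \<open>C\<close> with the potentials of the individual generators\<close>
  proof (rule that[of "- a / 4" "- n / 4" "d0 / 2" "- d2 / 4" "d1 / 4" "d3 / 2" "b / 4" c "e - d3 / 2"])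
    show "\<alpha> z = e - d3 / 2 - (d0 / 2 * z$3 - 2 * (- d2 / 4) * z$2 + 2 * (d1 / 4) * z$1)" for z
      using e[of z] by (simp add: g_def sol field_simps)
  qed (simp_all add: a3, simp_all add: a1 a2 sol field_simps power2_eq_square power3_eq_cube)
qed

lemma determining_converse:
  assumes
    a1: "a1 = (\<lambda>z. cX + cR * z$2 + v1 * (z$1 * z$3 - (z$1)\<^sup>2 * z$2 - z$2 ^ 3) + v2 * (z$3 - 4 * z$1 * z$2)
       + v3 * ((z$1)\<^sup>2 - 3 * (z$2)\<^sup>2) + s * z$1)" and
    a2: "a2 = (\<lambda>z. cY - cR * z$1 + v1 * (z$2 * z$3 + z$1 ^ 3 + z$1 * (z$2)\<^sup>2) + v2 * (3 * (z$1)\<^sup>2 - (z$2)\<^sup>2)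
       + v3 * (z$3 + 4 * z$1 * z$2) + s * z$2)" and
    a3: "a3 = (\<lambda>z. cT - 2 * cX * z$2 + 2 * cY * z$1 + v1 * ((z$3)\<^sup>2 - ((z$1)\<^sup>2 + (z$2)\<^sup>2)\<^sup>2)
       - v2 * (2 * z$2 * z$3 + 2 * z$1 ^ 3 + 2 * z$1 * (z$2)\<^sup>2)
       + v3 * (2 * z$1 * z$3 - 2 * (z$1)\<^sup>2 * z$2 - 2 * z$2 ^ 3) + 2 * s * z$3)" and
    \<alpha>: "\<alpha> = (\<lambda>z. e - (v1 * z$3 - 2 * v2 * z$2 + 2 * v3 * z$1))"
  shows "determining_equations a1 a2 a3 \<alpha>" and "heis_X a1 = (\<lambda>z. v1 * z$3 - 2 * v2 * z$2 + 2 * v3 * z$1 + s)"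
    and "kohn_laplace \<alpha> z = 0"
proof -
  note der = derivative_eq_intros has_derivative_nth
  let ?m = "\<lambda>z::real^3. v1 * z$3 - 2 * v2 * z$2 + 2 * v3 * z$1 + s"
  let ?n = "\<lambda>z::real^3. 3 * v1 * ((z$1)\<^sup>2 + (z$2)\<^sup>2) + 6 * v2 * z$1 + 6 * v3 * z$2 - cR"
  have "(a1 has_derivative (\<lambda>v. v$1 * (v1 * (z$3 - 2 * z$1 * z$2) - 4 * v2 * z$2 + 2 * v3 * z$1 + s)
      + v$2 * (cR - v1 * ((z$1)\<^sup>2 + 3 * (z$2)\<^sup>2) - 4 * v2 * z$1 - 6 * v3 * z$2)
      + v$3 * (v1 * z$1 + v2))) (at z)" for z
    unfolding a1 by (auto intro!: der simp: algebra_simps power2_eq_square power3_eq_cube)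
  from heis_of_has_derivative[OF this] have h1: "heis_X a1 = ?m" "heis_Y a1 = (\<lambda>z. - ?n z)"
    by (auto simp: fun_eq_iff algebra_simps power2_eq_square)
  have "(a2 has_derivative (\<lambda>v. v$1 * (- cR + v1 * (3 * (z$1)\<^sup>2 + (z$2)\<^sup>2) + 6 * v2 * z$1 + 4 * v3 * z$2)
      + v$2 * (v1 * (z$3 + 2 * z$1 * z$2) - 2 * v2 * z$2 + 4 * v3 * z$1 + s)
      + v$3 * (v1 * z$2 + v3))) (at z)" for z
    unfolding a2 by (auto intro!: der simp: algebra_simps power2_eq_square power3_eq_cube)
  from heis_of_has_derivative[OF this] have h2: "heis_X a2 = ?n" "heis_Y a2 = ?m"
    by (auto simp: fun_eq_iff algebra_simps power2_eq_square)
  have "(a3 has_derivative (\<lambda>v. v$1 * (2 * cY - 4 * v1 * z$1 * ((z$1)\<^sup>2 + (z$2)\<^sup>2)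
        - v2 * (6 * (z$1)\<^sup>2 + 2 * (z$2)\<^sup>2) + v3 * (2 * z$3 - 4 * z$1 * z$2))
      + v$2 * (- 2 * cX - 4 * v1 * z$2 * ((z$1)\<^sup>2 + (z$2)\<^sup>2) - v2 * (2 * z$3 + 4 * z$1 * z$2)
        - v3 * (2 * (z$1)\<^sup>2 + 6 * (z$2)\<^sup>2))
      + v$3 * (2 * v1 * z$3 - 2 * v2 * z$2 + 2 * v3 * z$1 + 2 * s))) (at z)" for z
    unfolding a3 by (auto intro!: der simp: algebra_simps power2_eq_square power3_eq_cube)
  from heis_of_has_derivative[OF this]
  have h3: "heis_X a3 = (\<lambda>z. 2 * a2 z + 2 * z$2 * ?m z - 2 * z$1 * ?n z)"
    "heis_Y a3 = (\<lambda>z. - 2 * a1 z - 2 * z$1 * ?m z - 2 * z$2 * ?n z)"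
    by (auto simp: a1 a2 fun_eq_iff algebra_simps power2_eq_square power3_eq_cube)
  have "(?m has_derivative (\<lambda>v. v$1 * (2 * v3) + v$2 * (- 2 * v2) + v$3 * v1)) (at z)" for z
    by (auto intro!: der simp: algebra_simps)
  from heis_of_has_derivative[OF this]
  have hm: "heis_X ?m = (\<lambda>z. 2 * v3 + 2 * v1 * z$2)" "heis_Y ?m = (\<lambda>z. - 2 * v2 - 2 * v1 * z$1)"
    by (auto simp: fun_eq_iff)
  have "(?n has_derivative (\<lambda>v. v$1 * (6 * v1 * z$1 + 6 * v2) + v$2 * (6 * v1 * z$2 + 6 * v3) + v$3 * 0)) (at z)" for z
    by (auto intro!: der simp: algebra_simps)
  note hn = heis_of_has_derivative[OF this]
  have "((\<lambda>z. - ?n z) has_derivative (\<lambda>v. v$1 * (- 6 * v1 * z$1 - 6 * v2) + v$2 * (- 6 * v1 * z$2 - 6 * v3) + v$3 * 0)) (at z)" for z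
    by (auto intro!: der simp: algebra_simps)
  note hn' = heis_of_has_derivative[OF this]
  have "(\<alpha> has_derivative (\<lambda>v. v$1 * (- 2 * v3) + v$2 * (2 * v2) + v$3 * (- v1))) (at z)" for z
    unfolding \<alpha> by (auto intro!: der simp: algebra_simps)
  from heis_of_has_derivative[OF this]
  have h\<alpha>: "heis_X \<alpha> = (\<lambda>z. - 2 * v3 - 2 * v1 * z$2)" "heis_Y \<alpha> = (\<lambda>z. 2 * v2 + 2 * v1 * z$1)"
    by (auto simp: fun_eq_iff)
  have "(heis_X a3 has_derivative (\<lambda>v. v$1 * (- v1 * (12 * (z$1)\<^sup>2 + 4 * (z$2)\<^sup>2) - 12 * v2 * z$1)
      + v$2 * (v1 * (4 * z$3 - 8 * z$1 * z$2) - 12 * v2 * z$2 + 4 * s) + v$3 * (4 * v1 * z$2 + 2 * v3))) (at z)" for z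
    unfolding h3 a2 by (auto intro!: der simp: algebra_simps power2_eq_square power3_eq_cube)
  from heis_of_has_derivative(1)[OF this]
  have XXa3: "heis_X (heis_X a3) = (\<lambda>z. - v1 * (12 * (z$1)\<^sup>2 - 4 * (z$2)\<^sup>2) - 12 * v2 * z$1 + 4 * v3 * z$2)"
    by (auto simp: fun_eq_iff algebra_simps power2_eq_square)
  have "(heis_Y a3 has_derivative (\<lambda>v. v$1 * (- v1 * (4 * z$3 + 8 * z$1 * z$2) - 12 * v3 * z$1 - 4 * s)
      + v$2 * (- v1 * (4 * (z$1)\<^sup>2 + 12 * (z$2)\<^sup>2) - 12 * v3 * z$2) + v$3 * (- 4 * v1 * z$1 - 2 * v2))) (at z)" for z
    unfolding h3 a1 by (auto intro!: der simp: algebra_simps power2_eq_square power3_eq_cube)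
  from heis_of_has_derivative(2)[OF this]
  have YYa3: "heis_Y (heis_Y a3) = (\<lambda>z. - v1 * (12 * (z$2)\<^sup>2 - 4 * (z$1)\<^sup>2) - 12 * v3 * z$2 + 4 * v2 * z$1)"
    by (auto simp: fun_eq_iff algebra_simps power2_eq_square)
  show "heis_X a1 = ?m" by (rule h1)
  have "(heis_X \<alpha> has_derivative (\<lambda>v. v$1 * 0 + v$2 * (- 2 * v1) + v$3 * 0)) (at z)" for z
    unfolding h\<alpha> by (auto intro!: der simp: algebra_simps)
  note L\<alpha>1 = heis_of_has_derivative(1)[OF this]
  have "(heis_Y \<alpha> has_derivative (\<lambda>v. v$1 * (2 * v1) + v$2 * 0 + v$3 * 0)) (at z)" for z
    unfolding h\<alpha> by (auto intro!: der simp: algebra_simps)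
  note L\<alpha>2 = heis_of_has_derivative(2)[OF this]
  show "kohn_laplace \<alpha> z = 0" by (simp add: kohn_laplace_def L\<alpha>1 L\<alpha>2)
  have L1: "kohn_laplace a1 z = - 4 * v3 - 4 * v1 * z$2" and L2: "kohn_laplace a2 z = 4 * v2 + 4 * v1 * z$1" for z
    unfolding kohn_laplace_def h1 h2 hm hn hn' by (simp_all add: algebra_simps)
  have L3: "kohn_laplace a3 z = - 8 * v1 * ((z$1)\<^sup>2 + (z$2)\<^sup>2) - 8 * v2 * z$1 - 8 * v3 * z$2" for z
    unfolding kohn_laplace_def XXa3 YYa3 by (simp add: algebra_simps)
  show "determining_equations a1 a2 a3 \<alpha>"
    unfolding determining_equations_def L1 L2 L3 h\<alpha> h1 h2 h3 by (auto simp: algebra_simps power2_eq_square)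
qed


section \<open>The general form of a symmetry\<close>

text \<open>The dilations for powers and exponentials are members of this family, \<open>Z = Z\<^sub>1 + 2 / (1 - p) Z\<^sub>2\<close> and \<open>Z\<^sub>3 = Z\<^sub>1 + W\<close> with
\<open>\<beta> = - 2\<close>, so that it covers all nonlinearities at once.\<close>

definition general_field ::
  "real \<Rightarrow> real \<Rightarrow> real \<Rightarrow> real \<Rightarrow> real \<Rightarrow> real \<Rightarrow> real \<Rightarrow> real \<Rightarrow> real \<Rightarrow> (real^3 \<Rightarrow> real) \<Rightarrow> vfield" where
  "general_field cT cR cX cY v1 v2 v3 s e \<beta> w =
     cT *\<^sub>R gen_T w + cR *\<^sub>R gen_R w + cX *\<^sub>R gen_Xt w + cY *\<^sub>R gen_Yt w
     + v1 *\<^sub>R gen_V1 w + v2 *\<^sub>R gen_V2 w + v3 *\<^sub>R gen_V3 w + s *\<^sub>R gen_Z1 w + e *\<^sub>R gen_Z2 w + gen_W \<beta> w"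

text \<open>The factor by which the part of the field built from \<open>V\<^sub>1\<close>, \<open>V\<^sub>2\<close>, \<open>V\<^sub>3\<close> scales the horizontal plane: the function
\<open>X \<xi>\<^sup>1 = Y \<xi>\<^sup>2\<close> of that part.\<close>

definition conformal_weight :: "real \<Rightarrow> real \<Rightarrow> real \<Rightarrow> real^3 \<Rightarrow> real" where
  "conformal_weight v1 v2 v3 z = v1 * z$3 - 2 * v2 * z$2 + 2 * v3 * z$1"

text \<open>The part of the symmetry condition that depends on \<open>f\<close>.\<close>

definition classifying_equation ::
  "real set \<Rightarrow> (real \<Rightarrow> real) \<Rightarrow> (real \<Rightarrow> real) \<Rightarrow> real \<Rightarrow> real \<Rightarrow> real \<Rightarrow> real \<Rightarrow> real \<Rightarrow> (real^3 \<Rightarrow> real) \<Rightarrow> bool" where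
  "classifying_equation I f f' v1 v2 v3 s e \<beta> \<longleftrightarrow> (\<forall>z. \<forall>u\<in>I.
     f' u * ((e - conformal_weight v1 v2 v3 z) * u + \<beta> z) + kohn_laplace \<beta> z - (e - 3 * conformal_weight v1 v2 v3 z - 2 * s) * f u = 0)"

lemmas gen_defs = gen_T_def gen_R_def gen_Xt_def gen_Yt_def gen_V1_def gen_V2_def gen_V3_def gen_Z1_def
  gen_Z2_def gen_Z3_def gen_Z_def gen_W_def vf_def

lemma general_field_components:
  "general_field cT cR cX cY v1 v2 v3 s e \<beta> (z, u) = (vector
     [cX + cR * z$2 + v1 * (z$1 * z$3 - (z$1)\<^sup>2 * z$2 - z$2 ^ 3) + v2 * (z$3 - 4 * z$1 * z$2)
        + v3 * ((z$1)\<^sup>2 - 3 * (z$2)\<^sup>2) + s * z$1,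
      cY - cR * z$1 + v1 * (z$2 * z$3 + z$1 ^ 3 + z$1 * (z$2)\<^sup>2) + v2 * (3 * (z$1)\<^sup>2 - (z$2)\<^sup>2)
        + v3 * (z$3 + 4 * z$1 * z$2) + s * z$2,
      cT - 2 * cX * z$2 + 2 * cY * z$1 + v1 * ((z$3)\<^sup>2 - ((z$1)\<^sup>2 + (z$2)\<^sup>2)\<^sup>2)
        - v2 * (2 * z$2 * z$3 + 2 * z$1 ^ 3 + 2 * z$1 * (z$2)\<^sup>2)
        + v3 * (2 * z$1 * z$3 - 2 * (z$1)\<^sup>2 * z$2 - 2 * z$2 ^ 3) + 2 * s * z$3],
     (e - (v1 * z$3 - 2 * v2 * z$2 + 2 * v3 * z$1)) * u + \<beta> z)"
  by (simp add: general_field_def gen_defs prod_eq_iff vec_eq_iff forall_3) (simp add: algebra_simps)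

text \<open>All members of this family have \<open>\<alpha> = e - w\<close>, \<open>X \<xi>\<^sup>1 = w + s\<close> and \<open>L \<alpha> = 0\<close>, where \<open>w\<close> is the conformal weight;
this turns the scalar determining equation into the classifying equation.\<close>

lemma symmetry_characterization:
  assumes I: "open I" "is_interval I" "I \<noteq> {}" and f: "\<forall>u\<in>I. (f has_real_derivative f' u) (at u)"
  shows "S \<in> symmetries I f \<longleftrightarrow> (\<exists>cT cR cX cY v1 v2 v3 s e \<beta>.
    smooth_on UNIV \<beta> \<and> (\<forall>w\<in>UNIV \<times> I. S w = general_field cT cR cX cY v1 v2 v3 s e \<beta> w) \<and>
    classifying_equation I f f' v1 v2 v3 s e \<beta>)" (is "_ \<longleftrightarrow> ?R")
proof
  assume "S \<in> symmetries I f"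
  then have sym: "inf_symmetry I f S" by (simp add: symmetries_def)
  obtain u0 where u0: "u0 \<in> I" using I by blast
  obtain a1 a2 a3 \<alpha> \<beta> where sm: "smooth_on UNIV a1" "smooth_on UNIV a2" "smooth_on UNIV a3"
      "smooth_on UNIV \<alpha>" "smooth_on UNIV \<beta>"
    and form: "\<And>z u. u \<in> I \<Longrightarrow> S (z, u) = (vector [a1 z, a2 z, a3 z], \<alpha> z * u + \<beta> z)"
    using symmetry_affine_form[OF I(1,2) u0 f sym] by blast
  have D: "determining_equations a1 a2 a3 \<alpha>" and E: "\<And>z u. u \<in> I \<Longrightarrow>
      f' u * (\<alpha> z * u + \<beta> z) + kohn_laplace \<alpha> z * u + kohn_laplace \<beta> z - (\<alpha> z - 2 * heis_X a1 z) * f u = 0"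
    using symmetry_iff_determining[OF I(1,3) f sm form] sym by auto
  obtain cT cR cX cY v1 v2 v3 s e where sol:
    "\<And>z. a1 z = cX + cR * z$2 + v1 * (z$1 * z$3 - (z$1)\<^sup>2 * z$2 - z$2 ^ 3) + v2 * (z$3 - 4 * z$1 * z$2)
       + v3 * ((z$1)\<^sup>2 - 3 * (z$2)\<^sup>2) + s * z$1"
    "\<And>z. a2 z = cY - cR * z$1 + v1 * (z$2 * z$3 + z$1 ^ 3 + z$1 * (z$2)\<^sup>2) + v2 * (3 * (z$1)\<^sup>2 - (z$2)\<^sup>2)
       + v3 * (z$3 + 4 * z$1 * z$2) + s * z$2"
    "\<And>z. a3 z = cT - 2 * cX * z$2 + 2 * cY * z$1 + v1 * ((z$3)\<^sup>2 - ((z$1)\<^sup>2 + (z$2)\<^sup>2)\<^sup>2)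
       - v2 * (2 * z$2 * z$3 + 2 * z$1 ^ 3 + 2 * z$1 * (z$2)\<^sup>2)
       + v3 * (2 * z$1 * z$3 - 2 * (z$1)\<^sup>2 * z$2 - 2 * z$2 ^ 3) + 2 * s * z$3"
    "\<And>z. \<alpha> z = e - (v1 * z$3 - 2 * v2 * z$2 + 2 * v3 * z$1)"
    by (rule determining_solutions[OF sm(1-4) D]) (rule that)
  note conv = determining_converse[OF ext[OF sol(1)] ext[OF sol(2)] ext[OF sol(3)] ext[OF sol(4)]]
  have "S (z, u) = general_field cT cR cX cY v1 v2 v3 s e \<beta> (z, u)" if "u \<in> I" for z u
    unfolding general_field_components form[OF that] sol ..
  moreover have "classifying_equation I f f' v1 v2 v3 s e \<beta>"
    unfolding classifying_equation_def
  proof (intro allI ballI)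
    fix z u assume "u \<in> I"
    from E[OF this, of z] show "f' u * ((e - conformal_weight v1 v2 v3 z) * u + \<beta> z) + kohn_laplace \<beta> z
       - (e - 3 * conformal_weight v1 v2 v3 z - 2 * s) * f u = 0"
      unfolding conv(2) conv(3) by (simp add: sol(4) conformal_weight_def algebra_simps)
  qed
  ultimately show ?R using sm(5) by fast
next
  assume ?R
  then obtain cT cR cX cY v1 v2 v3 s e \<beta> where \<beta>: "smooth_on UNIV \<beta>"
    and S: "\<And>w. w \<in> UNIV \<times> I \<Longrightarrow> S w = general_field cT cR cX cY v1 v2 v3 s e \<beta> w"
    and E: "classifying_equation I f f' v1 v2 v3 s e \<beta>" by blast
  define a1 a2 a3 \<alpha> where def:
    "a1 = (\<lambda>z::real^3. cX + cR * z$2 + v1 * (z$1 * z$3 - (z$1)\<^sup>2 * z$2 - z$2 ^ 3) + v2 * (z$3 - 4 * z$1 * z$2)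
       + v3 * ((z$1)\<^sup>2 - 3 * (z$2)\<^sup>2) + s * z$1)"
    "a2 = (\<lambda>z::real^3. cY - cR * z$1 + v1 * (z$2 * z$3 + z$1 ^ 3 + z$1 * (z$2)\<^sup>2) + v2 * (3 * (z$1)\<^sup>2 - (z$2)\<^sup>2)
       + v3 * (z$3 + 4 * z$1 * z$2) + s * z$2)"
    "a3 = (\<lambda>z::real^3. cT - 2 * cX * z$2 + 2 * cY * z$1 + v1 * ((z$3)\<^sup>2 - ((z$1)\<^sup>2 + (z$2)\<^sup>2)\<^sup>2)
       - v2 * (2 * z$2 * z$3 + 2 * z$1 ^ 3 + 2 * z$1 * (z$2)\<^sup>2)
       + v3 * (2 * z$1 * z$3 - 2 * (z$1)\<^sup>2 * z$2 - 2 * z$2 ^ 3) + 2 * s * z$3)"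
    "\<alpha> = (\<lambda>z::real^3. e - (v1 * z$3 - 2 * v2 * z$2 + 2 * v3 * z$1))"
  note conv = determining_converse[OF def]
  have sm: "smooth_on UNIV a1" "smooth_on UNIV a2" "smooth_on UNIV a3" "smooth_on UNIV \<alpha>"
    unfolding def
    by (intro smooth_on_add smooth_on_diff smooth_on_mult smooth_on_power smooth_on_nth smooth_on_const open_UNIV)+
  have form: "S (z, u) = (vector [a1 z, a2 z, a3 z], \<alpha> z * u + \<beta> z)" if "u \<in> I" for z u
    using S[of "(z, u)"] that by (simp add: def general_field_components)
  have "f' u * (\<alpha> z * u + \<beta> z) + kohn_laplace \<alpha> z * u + kohn_laplace \<beta> z - (\<alpha> z - 2 * heis_X a1 z) * f u = 0"
    if "u \<in> I" for z u
    using E[unfolded classifying_equation_def, rule_format, OF that, of z]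
    unfolding conv(2,3) by (simp add: def(4) conformal_weight_def algebra_simps)
  then show "S \<in> symmetries I f"
    using symmetry_iff_determining[OF I(1,3) f sm \<beta> form] conv(1) by (simp add: symmetries_def)
qed

section \<open>Spans of vector fields\<close>

text \<open>A linear space of vector fields in which the values for \<open>u\<close> outside \<open>I\<close> are irrelevant, as they are in \<open>vf_span\<close>.\<close>

definition vf_subspace :: "real set \<Rightarrow> vfield set \<Rightarrow> bool" where
  "vf_subspace I V \<longleftrightarrow> (\<lambda>w. 0) \<in> V \<and> (\<forall>S\<in>V. \<forall>S'\<in>V. (\<lambda>w. S w + S' w) \<in> V) \<and> (\<forall>c. \<forall>S\<in>V. (\<lambda>w. c *\<^sub>R S w) \<in> V)
     \<and> (\<forall>S S'. S \<in> V \<and> (\<forall>w\<in>UNIV \<times> I. S w = S' w) \<longrightarrow> S' \<in> V)"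

lemma vf_subspace_zero: "vf_subspace I V \<Longrightarrow> (\<lambda>w. 0) \<in> V"
  and vf_subspace_add: "vf_subspace I V \<Longrightarrow> S \<in> V \<Longrightarrow> S' \<in> V \<Longrightarrow> (\<lambda>w. S w + S' w) \<in> V"
  and vf_subspace_scale: "vf_subspace I V \<Longrightarrow> S \<in> V \<Longrightarrow> (\<lambda>w. c *\<^sub>R S w) \<in> V"
  and vf_subspace_cong: "vf_subspace I V \<Longrightarrow> S \<in> V \<Longrightarrow> (\<And>w. w \<in> UNIV \<times> I \<Longrightarrow> S w = S' w) \<Longrightarrow> S' \<in> V"
  unfolding vf_subspace_def by blast+

lemma vf_spanI:
  assumes "finite F" "F \<subseteq> B" "\<And>w. w \<in> UNIV \<times> I \<Longrightarrow> S w = (\<Sum>G\<in>F. c G *\<^sub>R G w)"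
  shows "S \<in> vf_span I B"
  unfolding vf_span_def mem_Collect_eq
  by (rule exI[where x = F, OF exI[where x = c]]) (use assms in blast)

lemma vf_spanE:
  assumes "S \<in> vf_span I B"
  obtains F c where "finite F" "F \<subseteq> B" "\<And>w. w \<in> UNIV \<times> I \<Longrightarrow> S w = (\<Sum>G\<in>F. c G *\<^sub>R G w)"
  using assms unfolding vf_span_def mem_Collect_eq by (elim exE conjE) (metis (no_types))

lemma vf_span_superset: "B \<subseteq> vf_span I B"
proof
  fix G assume "G \<in> B"
  then show "G \<in> vf_span I B" by (intro vf_spanI[of "{G}" _ _ _ "\<lambda>_. 1"]) simp_all
qed

lemma vf_span_minimal:
  assumes V: "vf_subspace I V" and "B \<subseteq> V"
  shows "vf_span I B \<subseteq> V"
proof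
  fix S assume "S \<in> vf_span I B"
  then obtain F c where F: "finite F" "F \<subseteq> B" "\<And>w. w \<in> UNIV \<times> I \<Longrightarrow> S w = (\<Sum>G\<in>F. c G *\<^sub>R G w)"
    by (rule vf_spanE) (rule that)
  have "(\<lambda>w. \<Sum>G\<in>F. c G *\<^sub>R G w) \<in> V"
    using F(1,2)
  proof (induction F)
    case (insert G F)
    then show ?case
      using vf_subspace_add[OF V vf_subspace_scale[OF V, of G "c G"], of "\<lambda>w. \<Sum>G\<in>F. c G *\<^sub>R G w"] assms(2)
      by auto
  qed (simp add: vf_subspace_zero[OF V])
  then show "S \<in> V" by (rule vf_subspace_cong[OF V]) (simp only: F(3))
qed

lemma vf_subspace_span: "vf_subspace I (vf_span I B)"
  unfolding vf_subspace_def
proof (intro conjI ballI allI impI)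
  show "(\<lambda>w. 0) \<in> vf_span I B" by (rule vf_spanI[of "{}"]) simp_all
next
  fix S S' assume S: "S \<in> vf_span I B" and S': "S' \<in> vf_span I B"
  obtain F c where F: "finite F" "F \<subseteq> B" "\<And>w. w \<in> UNIV \<times> I \<Longrightarrow> S w = (\<Sum>G\<in>F. c G *\<^sub>R G w)"
    using S by (rule vf_spanE) (rule that)
  obtain F' c' where F': "finite F'" "F' \<subseteq> B" "\<And>w. w \<in> UNIV \<times> I \<Longrightarrow> S' w = (\<Sum>G\<in>F'. c' G *\<^sub>R G w)"
    using S' by (rule vf_spanE) (rule that)
  let ?c = "\<lambda>G. (if G \<in> F then c G else 0) + (if G \<in> F' then c' G else 0)"
  show "(\<lambda>w. S w + S' w) \<in> vf_span I B"
  proof (rule vf_spanI)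
    show "finite (F \<union> F')" "F \<union> F' \<subseteq> B" using F(1,2) F'(1,2) by auto
    fix w assume w: "w \<in> (UNIV :: (real^3) set) \<times> I"
    have "(\<Sum>G\<in>F. c G *\<^sub>R G w) = (\<Sum>G\<in>F \<union> F'. (if G \<in> F then c G else 0) *\<^sub>R G w)"
      by (rule sum.mono_neutral_cong_left) (use F(1) F'(1) in auto)
    moreover have "(\<Sum>G\<in>F'. c' G *\<^sub>R G w) = (\<Sum>G\<in>F \<union> F'. (if G \<in> F' then c' G else 0) *\<^sub>R G w)"
      by (rule sum.mono_neutral_cong_left) (use F(1) F'(1) in auto)
    ultimately show "S w + S' w = (\<Sum>G\<in>F \<union> F'. ?c G *\<^sub>R G w)"
      by (simp only: F(3)[OF w] F'(3)[OF w] scaleR_add_left sum.distrib)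
  qed
next
  fix k S assume "S \<in> vf_span I B"
  then obtain F c where F: "finite F" "F \<subseteq> B" "\<And>w. w \<in> UNIV \<times> I \<Longrightarrow> S w = (\<Sum>G\<in>F. c G *\<^sub>R G w)"
    by (rule vf_spanE) (rule that)
  show "(\<lambda>w. k *\<^sub>R S w) \<in> vf_span I B"
    by (rule vf_spanI[OF F(1,2), of _ _ "\<lambda>G. k * c G"]) (simp only: F(3) scaleR_sum_right scaleR_scaleR)
next
  fix S S' :: vfield assume eq: "S \<in> vf_span I B \<and> (\<forall>w\<in>UNIV \<times> I. S w = S' w)"
  then have "S \<in> vf_span I B" ..
  then obtain F c where F: "finite F" "F \<subseteq> B" "\<And>w. w \<in> UNIV \<times> I \<Longrightarrow> S w = (\<Sum>G\<in>F. c G *\<^sub>R G w)"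
    by (rule vf_spanE) (rule that)
  show "S' \<in> vf_span I B"
    by (rule vf_spanI[OF F(1,2), of _ _ c]) (simp only: F(3)[symmetric] eq)
qed

lemma vf_subspace_symmetries:
  assumes I: "open I" "is_interval I" "I \<noteq> {}" and f: "\<forall>u\<in>I. (f has_real_derivative f' u) (at u)"
  shows "vf_subspace I (symmetries I f)"
proof -
  note ch = symmetry_characterization[OF I f]
  have zero: "(\<lambda>w. 0) \<in> symmetries I f"
    unfolding ch
    by (intro exI[of _ 0] exI[of _ "\<lambda>z. 0"])
       (simp add: general_field_def gen_W_def classifying_equation_def conformal_weight_def heis_const zero_prod_def split: prod.split)
  moreover have "(\<lambda>w. S w + S' w) \<in> symmetries I f" if S: "S \<in> symmetries I f" and S': "S' \<in> symmetries I f" for S S'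
  proof -
    obtain cT cR cX cY v1 v2 v3 s e \<beta> where 1: "smooth_on UNIV \<beta>"
      "\<And>w. w \<in> UNIV \<times> I \<Longrightarrow> S w = general_field cT cR cX cY v1 v2 v3 s e \<beta> w" "classifying_equation I f f' v1 v2 v3 s e \<beta>"
      using S unfolding ch by blast
    obtain cT' cR' cX' cY' v1' v2' v3' s' e' \<beta>' where 2: "smooth_on UNIV \<beta>'"
      "\<And>w. w \<in> UNIV \<times> I \<Longrightarrow> S' w = general_field cT' cR' cX' cY' v1' v2' v3' s' e' \<beta>' w" "classifying_equation I f f' v1' v2' v3' s' e' \<beta>'"
      using S' unfolding ch by blast
    have L: "kohn_laplace (\<lambda>z. \<beta> z + \<beta>' z) z = kohn_laplace \<beta> z + kohn_laplace \<beta>' z" for z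
      by (rule kohn_laplace_add[OF 1(1) 2(1)])
    have "S w + S' w = general_field (cT + cT') (cR + cR') (cX + cX') (cY + cY') (v1 + v1') (v2 + v2') (v3 + v3')
        (s + s') (e + e') (\<lambda>z. \<beta> z + \<beta>' z) w" if "w \<in> UNIV \<times> I" for w
      unfolding 1(2)[OF that] 2(2)[OF that]
      by (simp add: general_field_def gen_W_def scaleR_add_left split: prod.split)
    moreover have "classifying_equation I f f' (v1 + v1') (v2 + v2') (v3 + v3') (s + s') (e + e') (\<lambda>z. \<beta> z + \<beta>' z)"
      unfolding classifying_equation_def
    proof (intro allI ballI)
      fix z u assume u: "u \<in> I"
      have c: "conformal_weight (v1 + v1') (v2 + v2') (v3 + v3') z = conformal_weight v1 v2 v3 z + conformal_weight v1' v2' v3' z"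
        by (simp add: conformal_weight_def algebra_simps)
      show "f' u * ((e + e' - conformal_weight (v1 + v1') (v2 + v2') (v3 + v3') z) * u + (\<beta> z + \<beta>' z))
          + kohn_laplace (\<lambda>z. \<beta> z + \<beta>' z) z - (e + e' - 3 * conformal_weight (v1 + v1') (v2 + v2') (v3 + v3') z - 2 * (s + s')) * f u = 0"
        using 1(3)[unfolded classifying_equation_def, rule_format, OF u, of z] 2(3)[unfolded classifying_equation_def, rule_format, OF u, of z]
        unfolding L c by (simp add: algebra_simps)
    qed
    ultimately show ?thesis
      unfolding ch using smooth_on_add[OF open_UNIV 1(1) 2(1)] by fast
  qed
  moreover have "(\<lambda>w. c *\<^sub>R S w) \<in> symmetries I f" if S: "S \<in> symmetries I f" for S c
  proof -
    obtain cT cR cX cY v1 v2 v3 s e \<beta> where 1: "smooth_on UNIV \<beta>"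
      "\<And>w. w \<in> UNIV \<times> I \<Longrightarrow> S w = general_field cT cR cX cY v1 v2 v3 s e \<beta> w" "classifying_equation I f f' v1 v2 v3 s e \<beta>"
      using S unfolding ch by blast
    have L: "kohn_laplace (\<lambda>z. c * \<beta> z) z = c * kohn_laplace \<beta> z" for z
      by (rule kohn_laplace_cmult[OF 1(1)])
    have "c *\<^sub>R S w = general_field (c * cT) (c * cR) (c * cX) (c * cY) (c * v1) (c * v2) (c * v3)
        (c * s) (c * e) (\<lambda>z. c * \<beta> z) w" if "w \<in> UNIV \<times> I" for w
      unfolding 1(2)[OF that]
      by (simp add: general_field_def gen_W_def scaleR_add_right split: prod.split)
    moreover have "classifying_equation I f f' (c * v1) (c * v2) (c * v3) (c * s) (c * e) (\<lambda>z. c * \<beta> z)"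
      unfolding classifying_equation_def
    proof (intro allI ballI)
      fix z u assume u: "u \<in> I"
      have cf: "conformal_weight (c * v1) (c * v2) (c * v3) z = c * conformal_weight v1 v2 v3 z"
        by (simp add: conformal_weight_def algebra_simps)
      have "f' u * ((c * e - conformal_weight (c * v1) (c * v2) (c * v3) z) * u + c * \<beta> z)
          + kohn_laplace (\<lambda>z. c * \<beta> z) z - (c * e - 3 * conformal_weight (c * v1) (c * v2) (c * v3) z - 2 * (c * s)) * f u
        = c * (f' u * ((e - conformal_weight v1 v2 v3 z) * u + \<beta> z) + kohn_laplace \<beta> z - (e - 3 * conformal_weight v1 v2 v3 z - 2 * s) * f u)"
        unfolding L cf by (simp add: algebra_simps)
      then show "f' u * ((c * e - conformal_weight (c * v1) (c * v2) (c * v3) z) * u + c * \<beta> z)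
          + kohn_laplace (\<lambda>z. c * \<beta> z) z - (c * e - 3 * conformal_weight (c * v1) (c * v2) (c * v3) z - 2 * (c * s)) * f u = 0"
        using 1(3)[unfolded classifying_equation_def, rule_format, OF u, of z] by simp
    qed
    ultimately show ?thesis
      unfolding ch using smooth_on_cmult[OF open_UNIV 1(1)] by fast
  qed
  moreover have "S' \<in> symmetries I f" if S: "S \<in> symmetries I f" and eq: "\<And>w. w \<in> UNIV \<times> I \<Longrightarrow> S w = S' w" for S S'
  proof -
    obtain cT cR cX cY v1 v2 v3 s e \<beta> where 1: "smooth_on UNIV \<beta>"
      "\<And>w. w \<in> UNIV \<times> I \<Longrightarrow> S w = general_field cT cR cX cY v1 v2 v3 s e \<beta> w" "classifying_equation I f f' v1 v2 v3 s e \<beta>"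
      using S unfolding ch by blast
    then show ?thesis unfolding ch using eq by fastforce
  qed
  ultimately show ?thesis unfolding vf_subspace_def by blast
qed

lemma general_field_mem:
  assumes V: "vf_subspace I V"
    and "cT = 0 \<or> gen_T \<in> V" "cR = 0 \<or> gen_R \<in> V" "cX = 0 \<or> gen_Xt \<in> V" "cY = 0 \<or> gen_Yt \<in> V"
      "v1 = 0 \<or> gen_V1 \<in> V" "v2 = 0 \<or> gen_V2 \<in> V" "v3 = 0 \<or> gen_V3 \<in> V"
      "s = 0 \<or> gen_Z1 \<in> V" "e = 0 \<or> gen_Z2 \<in> V" "gen_W \<beta> \<in> V"
  shows "general_field cT cR cX cY v1 v2 v3 s e \<beta> \<in> V"
proof -
  have sc: "(\<lambda>w. c *\<^sub>R G w) \<in> V" if "c = 0 \<or> G \<in> V" for c and G :: vfield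
    using that vf_subspace_scale[OF V] vf_subspace_zero[OF V] by auto
  show ?thesis unfolding general_field_def[abs_def]
    by (intro vf_subspace_add[OF V] sc assms)
qed


section \<open>The generators as symmetries\<close>

lemma generator_parameters:
  "gen_T = general_field 1 0 0 0 0 0 0 0 0 (\<lambda>_. 0)" "gen_R = general_field 0 1 0 0 0 0 0 0 0 (\<lambda>_. 0)"
  "gen_Xt = general_field 0 0 1 0 0 0 0 0 0 (\<lambda>_. 0)" "gen_Yt = general_field 0 0 0 1 0 0 0 0 0 (\<lambda>_. 0)"
  "gen_V1 = general_field 0 0 0 0 1 0 0 0 0 (\<lambda>_. 0)" "gen_V2 = general_field 0 0 0 0 0 1 0 0 0 (\<lambda>_. 0)"
  "gen_V3 = general_field 0 0 0 0 0 0 1 0 0 (\<lambda>_. 0)" "gen_Z1 = general_field 0 0 0 0 0 0 0 1 0 (\<lambda>_. 0)"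
  "gen_Z2 = general_field 0 0 0 0 0 0 0 0 1 (\<lambda>_. 0)" "gen_W \<beta> = general_field 0 0 0 0 0 0 0 0 0 \<beta>"
  "gen_Z p = general_field 0 0 0 0 0 0 0 1 (2 / (1 - p)) (\<lambda>_. 0)"
  "gen_Z3 = general_field 0 0 0 0 0 0 0 1 0 (\<lambda>_. - 2)"
  by (auto simp: fun_eq_iff general_field_def gen_defs prod_eq_iff vec_eq_iff forall_3 zero_prod_def)

lemma gen_W_zero: "gen_W (\<lambda>_. 0) = (\<lambda>w. 0)"
  by (auto simp: gen_W_def zero_prod_def)

context
  fixes I :: "real set" and f f' :: "real \<Rightarrow> real"
  assumes I: "open I" "is_interval I" "I \<noteq> {}" and f: "\<forall>u\<in>I. (f has_real_derivative f' u) (at u)"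
begin

lemma general_field_symmetry:
  "smooth_on UNIV \<beta> \<Longrightarrow> classifying_equation I f f' v1 v2 v3 s e \<beta> \<Longrightarrow>
   general_field cT cR cX cY v1 v2 v3 s e \<beta> \<in> symmetries I f"
  unfolding symmetry_characterization[OF I f] 
  by (rule exI[of _ cT], rule exI[of _ cR], rule exI[of _ cX], rule exI[of _ cY], rule exI[of _ v1],
      rule exI[of _ v2], rule exI[of _ v3], rule exI[of _ s], rule exI[of _ e], rule exI[of _ \<beta>]) simp

lemma basic_gens_symmetries: "basic_gens \<subseteq> symmetries I f"
  unfolding basic_gens_def generator_parameters(1-4)
  by (auto intro!: general_field_symmetry simp: classifying_equation_def conformal_weight_def heis_const)

lemma basic_span_subset: "vf_span I basic_gens \<subseteq> symmetries I f"
  by (rule vf_span_minimal[OF vf_subspace_symmetries[OF I f] basic_gens_symmetries])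

text \<open>The coefficients of the basic generators are unconstrained by the classifying equation, so that only the
remaining part of a symmetry has to be placed in the span.\<close>

lemma symmetries_eq_span:
  assumes gens: "\<And>G. G \<in> B \<Longrightarrow> G \<in> symmetries I f" "basic_gens \<subseteq> B"
    and sol: "\<And>v1 v2 v3 s e \<beta>. smooth_on UNIV \<beta> \<Longrightarrow> classifying_equation I f f' v1 v2 v3 s e \<beta> \<Longrightarrow>
      general_field 0 0 0 0 v1 v2 v3 s e \<beta> \<in> vf_span I B"
  shows "symmetries I f = vf_span I B"
proof
  show "vf_span I B \<subseteq> symmetries I f"
    using gens(1) by (intro vf_span_minimal[OF vf_subspace_symmetries[OF I f]]) auto
  show "symmetries I f \<subseteq> vf_span I B"
  proof
    fix S assume "S \<in> symmetries I f"
    then obtain cT cR cX cY v1 v2 v3 s e \<beta> where \<beta>: "smooth_on UNIV \<beta>"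
      and S: "\<forall>w\<in>UNIV \<times> I. S w = general_field cT cR cX cY v1 v2 v3 s e \<beta> w"
      and E: "classifying_equation I f f' v1 v2 v3 s e \<beta>"
      unfolding symmetry_characterization[OF I f] by (elim exE conjE) (rule that)
    note V = vf_subspace_span[of I B]
    have b: "gen_T \<in> vf_span I B" "gen_R \<in> vf_span I B" "gen_Xt \<in> vf_span I B" "gen_Yt \<in> vf_span I B"
      using gens(2) vf_span_superset[of B I] unfolding basic_gens_def by auto
    have "general_field cT cR cX cY 0 0 0 0 0 (\<lambda>_. 0) \<in> vf_span I B"
      using b vf_subspace_zero[OF V] by (intro general_field_mem[OF V]) (auto simp: gen_W_zero)
    from vf_subspace_add[OF V this sol[OF \<beta> E]] show "S \<in> vf_span I B"
      by (rule vf_subspace_cong[OF V]) (simp add: S general_field_def gen_W_zero)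
  qed
qed

end

text \<open>The basic generators do not move \<open>u\<close>.  This distinguishes them from the additional generators.\<close>

lemma basic_span_eta_zero:
  assumes "S \<in> vf_span I basic_gens" "u \<in> I"
  shows "snd (S (z, u)) = 0"
proof -
  let ?V = "{S :: vfield. \<forall>z. \<forall>u\<in>I. snd (S (z, u)) = 0}"
  have "vf_subspace I ?V" unfolding vf_subspace_def by auto
  moreover have "basic_gens \<subseteq> ?V"
    by (auto simp: basic_gens_def gen_defs)
  ultimately have "vf_span I basic_gens \<subseteq> ?V" by (rule vf_span_minimal)
  with assms show ?thesis by auto
qed

lemma basic_span_psubset:
  assumes "vf_span I basic_gens \<subseteq> V" "G \<in> V" "u \<in> I" "snd (G (z, u)) \<noteq> 0"
  shows "vf_span I basic_gens \<subset> V"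
  using assms basic_span_eta_zero by blast

lemma two_nonzero_points:
  assumes "open I" "I \<noteq> {}"
  obtains u v :: real where "u \<in> I" "v \<in> I" "u \<noteq> v" "u \<noteq> 0" "v \<noteq> 0"
proof -
  obtain u where u: "u \<in> I" "u \<noteq> 0"
    using open_minus_countable[of "{0}" I] assms by auto
  obtain v where "v \<in> I" "v \<notin> {0, u}"
    using open_minus_countable[of "{0, u}" I] assms by auto
  with u show thesis by (intro that[of u v]) auto
qed

lemma conformal_weight_constant:
  assumes "\<And>z. conformal_weight v1 v2 v3 z = c"
  shows "v1 = 0" "v2 = 0" "v3 = 0" "c = 0"
  using assms[of 0] assms[of "vector [1, 0, 0]"] assms[of "vector [0, 1, 0]"] assms[of "vector [0, 0, 1]"]
  by (simp_all add: conformal_weight_def)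

lemma conformal_weight_zero [simp]: "conformal_weight 0 0 0 z = 0"
  by (simp add: conformal_weight_def)

lemma affine_zero:
  assumes "u \<noteq> v" "a * u + b = 0" "a * v + b = (0::real)"
  shows "a = 0" "b = 0"
proof -
  have "a * (u - v) = 0" unfolding right_diff_distrib using assms(2,3) by linarith
  then show "a = 0" using assms(1) by simp
  then show "b = 0" using assms(2) by simp
qed

lemma derivative_zero_on_open:
  assumes "open I" "u \<in> I" "\<And>v. v \<in> I \<Longrightarrow> g v = (0::real)" "(g has_real_derivative d) (at u)"
  shows "d = 0"
proof -
  have "(g has_real_derivative 0) (at u)"
    by (rule has_field_derivative_transform_within_open[OF DERIV_const[of 0] assms(1,2)]) (simp add: assms(3))
  with assms(4) show ?thesis by (rule DERIV_unique)
qed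

section \<open>Particular nonlinearities\<close>

text \<open>The Euler relation \<open>u f' = p f\<close> reduces the classifying equation to a linear relation between \<open>f\<close>, \<open>f'\<close> and \<open>1\<close>.
Multiplying it by \<open>u\<close> and differentiating eliminates the constant, and what remains is \<open>f\<close> times an affine
function of \<open>u\<close>.  The exponent \<open>1\<close> must be excluded because then \<open>f'\<close> is constant, and \<open>0\<close> because then \<open>f' = 0\<close>.\<close>

lemma power_type_solution:
  assumes I: "open I" "I \<noteq> {}" and f: "\<forall>u\<in>I. (f has_real_derivative f' u) (at u)"
    and hom: "\<And>u. u \<in> I \<Longrightarrow> u * f' u = p * f u" and ne: "\<And>u. u \<in> I \<Longrightarrow> u \<noteq> 0 \<Longrightarrow> f u \<noteq> 0"
    and p: "p \<noteq> 0" "p \<noteq> (1::real)"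
    and E: "classifying_equation I f f' v1 v2 v3 s e \<beta>"
  shows "\<beta> z = 0" and "p * (e - conformal_weight v1 v2 v3 z) = e - 3 * conformal_weight v1 v2 v3 z - 2 * s"
proof -
  define w where "w = conformal_weight v1 v2 v3 z"
  define A where "A = p * (e - w) - (e - 3 * w - 2 * s)"
  define b where "b = \<beta> z"
  define c where "c = kohn_laplace \<beta> z"
  have eq: "f' u * ((e - w) * u + b) + c - (e - 3 * w - 2 * s) * f u = 0" if "u \<in> I" for u
    using E that unfolding classifying_equation_def w_def b_def c_def by blast
  have eq1: "A * f u + b * f' u + c = 0" if "u \<in> I" for u
  proof -
    have "f' u * ((e - w) * u + b) = (e - w) * (u * f' u) + b * f' u" by (simp add: algebra_simps)
    then show ?thesis using eq[OF that] unfolding hom[OF that] A_def by (simp add: algebra_simps)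
  qed
  have eq2: "A * (u * f u) + b * p * f u + c * u = 0" if "u \<in> I" for u
  proof -
    have "A * (u * f u) + b * p * f u + c * u = u * (A * f u + b * f' u + c)"
      using hom[OF that] by (simp add: algebra_simps)
    then show ?thesis using eq1[OF that] by simp
  qed
  have lin: "A * u + b * (p - 1) = 0" if u: "u \<in> I" "u \<noteq> 0" for u
  proof -
    have "((\<lambda>u. A * (u * f u) + b * p * f u + c * u) has_real_derivative
        A * (1 * f u + f' u * u) + b * p * f' u + c * 1) (at u)"
      using bspec[OF f u(1)] by (auto intro!: derivative_eq_intros)
    from derivative_zero_on_open[OF I(1) u(1) eq2 this]
    have "A * (f u + u * f' u) + b * p * f' u + c = 0" by (simp add: algebra_simps)
    with eq1[OF u(1)] have "A * (u * f' u) + b * (p - 1) * f' u = 0" by (simp add: algebra_simps)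
    then have "u * (A * (u * f' u) + b * (p - 1) * f' u) = 0" by simp
    then have "(A * u + b * (p - 1)) * (u * f' u) = 0" by (simp add: algebra_simps)
    then show ?thesis unfolding hom[OF u(1)] using p ne[OF u] by simp
  qed
  obtain u v where "u \<in> I" "v \<in> I" "u \<noteq> v" "u \<noteq> 0" "v \<noteq> 0" by (rule two_nonzero_points[OF I])
  then have "A = 0" "b * (p - 1) = 0" using affine_zero lin by metis+
  then show "\<beta> z = 0" "p * (e - conformal_weight v1 v2 v3 z) = e - 3 * conformal_weight v1 v2 v3 z - 2 * s"
    using p by (simp_all add: A_def b_def w_def)
qed

text \<open>The functions \<open>u exp u\<close>, \<open>exp u\<close> and \<open>1\<close> are linearly independent.  The relation \<open>w = e\<close> between a linear form and a
constant then kills both.\<close>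

lemma exp_solution:
  assumes I: "open I" "I \<noteq> {}" and k: "k \<noteq> 0"
    and E: "classifying_equation I (\<lambda>u. k * exp u) (\<lambda>u. k * exp u) v1 v2 v3 s e \<beta>"
  shows "v1 = 0" "v2 = 0" "v3 = 0" "e = 0" "\<beta> z = - 2 * s"
proof -
  have sol: "conformal_weight v1 v2 v3 z = e \<and> \<beta> z = e - 3 * conformal_weight v1 v2 v3 z - 2 * s" for z
  proof -
    define A where "A = e - conformal_weight v1 v2 v3 z"
    define B where "B = \<beta> z - (e - 3 * conformal_weight v1 v2 v3 z - 2 * s)"
    define c where "c = kohn_laplace \<beta> z"
    have eq: "k * exp u * (A * u + B) + c = 0" if "u \<in> I" for u
      using E[unfolded classifying_equation_def, rule_format, OF that, of z]
      unfolding A_def B_def c_def by (simp add: algebra_simps)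
    have c: "k * exp u * A = c" if u: "u \<in> I" for u
    proof -
      have "((\<lambda>u. k * exp u * (A * u + B) + c) has_real_derivative
          k * exp u * (A * u + B) + k * exp u * A) (at u)"
        by (auto intro!: derivative_eq_intros simp: algebra_simps)
      from derivative_zero_on_open[OF I(1) u eq this] eq[OF u] show ?thesis by simp
    qed
    obtain u v where uv: "u \<in> I" "v \<in> I" "u \<noteq> v" by (rule two_nonzero_points[OF I])
    have "k * exp u * A = k * exp v * A" using c uv by simp
    then have "A = 0" using k uv(3) by simp
    moreover have "B = 0" using eq[OF uv(1)] c[OF uv(1)] k \<open>A = 0\<close> by simp
    ultimately show ?thesis by (simp add: A_def B_def)
  qed
  from conformal_weight_constant[of v1 v2 v3 e] sol show v: "v1 = 0" "v2 = 0" "v3 = 0" "e = 0" by blast+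
  show "\<beta> z = - 2 * s" using sol[of z] by (simp add: v)
qed

lemma linear_solution:
  assumes I: "open I" "I \<noteq> {}" and k: "k \<noteq> 0"
    and E: "classifying_equation I (\<lambda>u. k * u) (\<lambda>u. k) v1 v2 v3 s e \<beta>"
  shows "v1 = 0" "v2 = 0" "v3 = 0" "s = 0" "kohn_laplace \<beta> z + k * \<beta> z = 0"
proof -
  have sol: "conformal_weight v1 v2 v3 z = - s \<and> kohn_laplace \<beta> z + k * \<beta> z = 0" for z
  proof -
    have eq: "(2 * k * (conformal_weight v1 v2 v3 z + s)) * u + (kohn_laplace \<beta> z + k * \<beta> z) = 0" if "u \<in> I" for u
      using E[unfolded classifying_equation_def, rule_format, OF that, of z] by (simp add: algebra_simps)
    obtain u v where uv: "u \<in> I" "v \<in> I" "u \<noteq> v" by (rule two_nonzero_points[OF I])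
    from affine_zero[OF uv(3) eq[OF uv(1)] eq[OF uv(2)]] k show ?thesis by auto
  qed
  from conformal_weight_constant[of v1 v2 v3 "- s"] sol show "v1 = 0" "v2 = 0" "v3 = 0" "s = 0" by auto
  from sol show "kohn_laplace \<beta> z + k * \<beta> z = 0" by blast
qed

definition real_power_deriv :: "real \<Rightarrow> real \<Rightarrow> real" where
  "real_power_deriv p u = (if p \<in> \<int> then p * u powi (\<lfloor>p\<rfloor> - 1) else p * u powr (p - 1))"

lemma real_power_facts:
  assumes dom: "power_domain p I" and u: "u \<in> I" and p: "p \<noteq> 0" "p \<noteq> 1"
  shows "(real_power p has_real_derivative real_power_deriv p u) (at u)"
    and "u * real_power_deriv p u = p * real_power p u"
    and "u \<noteq> 0 \<Longrightarrow> real_power p u \<noteq> 0"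
proof -
  have "(real_power p has_real_derivative real_power_deriv p u) (at u) \<and>
    u * real_power_deriv p u = p * real_power p u \<and> (u \<noteq> 0 \<longrightarrow> real_power p u \<noteq> 0)"
  proof (cases "p \<in> \<int>")
    case True
    then obtain n where n: "p = of_int n" by (auto elim: Ints_cases)
    have n01: "n \<noteq> 0" "n \<noteq> 1" using p by (auto simp: n)
    have nn: "n \<ge> 0 \<or> u \<noteq> 0" using dom u by (auto simp: power_domain_def n)
    have rp: "real_power p = (\<lambda>u. u powi n)" "real_power_deriv p u = of_int n * u powi (n - 1)"
      using True by (auto simp: real_power_def real_power_deriv_def n fun_eq_iff)
    have "((\<lambda>u. u powi n) has_real_derivative of_int n * u powi (n - 1) * 1) (at u)"
      using nn by (intro DERIV_power_int) auto
    moreover have "u * u powi (n - 1) = u powi n"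
    proof (cases "u = 0")
      case True
      then have "n \<ge> 0" using nn by simp
      then show ?thesis using True n01 by simp
    next
      case False
      then show ?thesis by (simp add: power_int_diff)
    qed
    ultimately show ?thesis unfolding rp by (simp add: n mult.left_commute)
  next
    case False
    then have "u > 0" using dom u by (auto simp: power_domain_def)
    have rp: "real_power p = (\<lambda>u. u powr p)" "real_power_deriv p u = p * u powr (p - 1)"
      using False by (auto simp: real_power_def real_power_deriv_def fun_eq_iff)
    have "u * u powr (p - 1) = u powr p"
      using \<open>u > 0\<close> by (simp add: powr_mult_base)
    then show ?thesis using \<open>u > 0\<close> unfolding rp
      by (auto intro: has_real_derivative_powr)
  qed
  then show "(real_power p has_real_derivative real_power_deriv p u) (at u)"
    "u * real_power_deriv p u = p * real_power p u" "u \<noteq> 0 \<Longrightarrow> real_power p u \<noteq> 0" by auto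
qed


section \<open>The symmetry algebras\<close>

lemma kohn_laplace_minus_square:
  assumes U: "open U" and sm: "smooth_on U u" "smooth_on U v"
    and rel: "\<forall>z\<in>U. u z = v z - c * (z$1)\<^sup>2 / 2" and z: "z \<in> U"
  shows "kohn_laplace u z = kohn_laplace v z - c"
proof -
  have p: "partial i u z = partial i v z - (if i = 1 then c * z$1 else 0)" if "z \<in> U" for i z
  proof -
    have "partial i u z = dird (axis i 1) (\<lambda>z. v z - c * (z$1)\<^sup>2 / 2) z"
      unfolding partial_eq_dird by (rule dird_cong[OF U that]) (simp add: rel)
    also have "\<dots> = partial i v z - (if i = 1 then c * z$1 else 0)"
    proof -
      have "((\<lambda>z::real^3. v z - c * (z$1)\<^sup>2 / 2) has_derivative (\<lambda>h. dird h v z - c * z$1 * h$1)) (at z)"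
        by (auto intro!: derivative_eq_intros has_derivative_nth
              has_derivative_dird[OF smooth_on_differentiable[OF sm(2) that]])
      from dirdI[OF this] show ?thesis by (simp add: partial_eq_dird axis_def)
    qed
    finally show ?thesis .
  qed
  have p2: "partial j (partial i u) z = partial j (partial i v) z - (if i = 1 \<and> j = 1 then c else 0)" for i j
  proof -
    have "partial j (partial i u) z = dird (axis j 1) (\<lambda>z. partial i v z - (if i = 1 then c else 0) * z$1) z"
      unfolding partial_eq_dird[of j] by (rule dird_cong[OF U z]) (simp add: p)
    also have "\<dots> = partial j (partial i v) z - (if i = 1 \<and> j = 1 then c else 0)"
    proof -
      have "((\<lambda>z::real^3. partial i v z - (if i = 1 then c else 0) * z$1) has_derivative
          (\<lambda>h. dird h (partial i v) z - (if i = 1 then c else 0) * h$1)) (at z)"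
        by (auto intro!: derivative_eq_intros has_derivative_nth
              has_derivative_dird[OF smooth_on_differentiable[OF smooth_on_partial[OF sm(2)] z]])
      from dirdI[OF this] show ?thesis by (simp add: partial_eq_dird axis_def)
    qed
    finally show ?thesis .
  qed
  show ?thesis
    by (simp add: kohn_laplace_coords[OF U sm(1) z] kohn_laplace_coords[OF U sm(2) z] p2)
qed

context
  fixes I :: "real set"
  assumes I: "open I" "is_interval I" "I \<noteq> {}"
begin

lemma nonzero_point: obtains u where "u \<in> I" "u \<noteq> 0"
  by (rule two_nonzero_points[OF I(1,3)]) (rule that)

text \<open>Two nonlinearities suffice: the exponential leaves only \<open>Z\<^sub>3\<close> besides the basic generators, and the identity
function excludes the dilation contained in it.\<close>

lemma symmetries_arbitrary:
  "(\<Inter>f\<in>{f. smooth_on I f}. symmetries I f) = vf_span I basic_gens"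
proof
  show "vf_span I basic_gens \<subseteq> (\<Inter>f\<in>{f. smooth_on I f}. symmetries I f)"
  proof (intro INT_greatest)
    fix f :: "real \<Rightarrow> real" assume "f \<in> {f. smooth_on I f}"
    then have "\<forall>u\<in>I. (f has_real_derivative deriv f u) (at u)"
      using smooth_on_differentiable by (auto simp: DERIV_deriv_iff_real_differentiable)
    then show "vf_span I basic_gens \<subseteq> symmetries I f" by (rule basic_span_subset[OF I])
  qed
  show "(\<Inter>f\<in>{f. smooth_on I f}. symmetries I f) \<subseteq> vf_span I basic_gens"
  proof
    fix S assume S: "S \<in> (\<Inter>f\<in>{f. smooth_on I f}. symmetries I f)"
    have "smooth_on I (\<lambda>u. 1 * u)"
      by (rule smooth_on_bounded_linear) (simp add: bounded_linear_ident)
    then have S1: "S \<in> symmetries I (\<lambda>u. 1 * u)" using S by blast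
    have "smooth_on I (\<lambda>u. 1 * exp u)" using smooth_on_exp[OF I(1)] by simp
    then have S2: "S \<in> symmetries I (\<lambda>u. 1 * exp u)" using S by blast
    have d1: "\<forall>u\<in>I. ((\<lambda>u::real. 1 * u) has_real_derivative 1) (at u)"
      and d2: "\<forall>u\<in>I. ((\<lambda>u::real. 1 * exp u) has_real_derivative 1 * exp u) (at u)"
      by (auto intro!: derivative_eq_intros)
    obtain cT cR cX cY v1 v2 v3 s e \<beta> where
      1: "\<forall>w\<in>UNIV \<times> I. S w = general_field cT cR cX cY v1 v2 v3 s e \<beta> w"
        "classifying_equation I (\<lambda>u. 1 * exp u) (\<lambda>u. 1 * exp u) v1 v2 v3 s e \<beta>"
      using S2 unfolding symmetry_characterization[OF I d2] by (elim exE conjE) (rule that)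
    note sol1 = exp_solution[OF I(1,3) _ 1(2), simplified]
    obtain cT' cR' cX' cY' v1' v2' v3' s' e' \<beta>' where
      2: "\<forall>w\<in>UNIV \<times> I. S w = general_field cT' cR' cX' cY' v1' v2' v3' s' e' \<beta>' w"
        "classifying_equation I (\<lambda>u. 1 * u) (\<lambda>u. 1) v1' v2' v3' s' e' \<beta>'"
      using S1 unfolding symmetry_characterization[OF I d1] by (elim exE conjE) (rule that)
    note sol2 = linear_solution(1-4)[OF I(1,3) _ 2(2), simplified]
    obtain u where u: "u \<in> I" by (rule nonzero_point)
    have "general_field cT cR cX cY v1 v2 v3 s e \<beta> (z, u) = general_field cT' cR' cX' cY' v1' v2' v3' s' e' \<beta>' (z, u)" for z
      using 1(1) 2(1) u by simp
    \<comment> \<open>the two representations need not have equal parameters a priori, but the first component determines \<open>s\<close>\<close>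
    from this[of "vector [1, 0, 0]"] this[of 0] have "s = 0"
      by (simp add: general_field_components sol1 sol2 vec_eq_iff forall_3)
    note V = vf_subspace_span[of I basic_gens]
    have "general_field cT cR cX cY v1 v2 v3 s e (\<lambda>_. 0) \<in> vf_span I basic_gens"
      using vf_span_superset[of basic_gens I] vf_subspace_zero[OF V]
      by (intro general_field_mem[OF V]) (auto simp: sol1 \<open>s = 0\<close> gen_W_zero basic_gens_def)
    then show "S \<in> vf_span I basic_gens"
      by (rule vf_subspace_cong[OF V]) (simp add: 1(1) sol1 \<open>s = 0\<close> general_field_def gen_W_def split: prod.split)
  qed
qed

lemma symmetries_zero:
  "symmetries I (\<lambda>_. 0) =
       vf_span I (basic_gens \<union> {gen_V1, gen_V2, gen_V3, gen_Z1, gen_Z2}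
         \<union> {gen_W \<beta> | \<beta>. smooth_on UNIV \<beta> \<and> (\<forall>z. kohn_laplace \<beta> z = 0)})"
  (is "_ = vf_span I ?B")
proof (rule symmetries_eq_span[OF I])
  show d: "\<forall>u\<in>I. ((\<lambda>_. 0) has_real_derivative 0) (at u)" by simp
  show "G \<in> symmetries I (\<lambda>_. 0)" if "G \<in> ?B" for G
    using that basic_gens_symmetries[OF I d]
    by (auto simp: generator_parameters classifying_equation_def heis_const intro!: general_field_symmetry[OF I d])
  fix v1 v2 v3 s e \<beta>
  assume "smooth_on UNIV \<beta>" "classifying_equation I (\<lambda>_. 0) (\<lambda>_. 0) v1 v2 v3 s e \<beta>"
  then have "gen_W \<beta> \<in> ?B" using I(3) by (auto simp: classifying_equation_def)
  then show "general_field 0 0 0 0 v1 v2 v3 s e \<beta> \<in> vf_span I ?B"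
    using vf_span_superset[of ?B I] by (intro general_field_mem[OF vf_subspace_span]) auto
qed auto

lemma symmetries_linear:
  assumes k: "k \<noteq> 0"
  shows "symmetries I (\<lambda>u. k * u) =
            vf_span I (basic_gens \<union> {gen_Z2}
              \<union> {gen_W \<beta> | \<beta>. smooth_on UNIV \<beta> \<and> (\<forall>z. kohn_laplace \<beta> z + k * \<beta> z = 0)})"
  (is "_ = vf_span I ?B")
proof (rule symmetries_eq_span[OF I])
  show d: "\<forall>u\<in>I. ((\<lambda>u. k * u) has_real_derivative k) (at u)" by (auto intro!: derivative_eq_intros)
  show "G \<in> symmetries I (\<lambda>u. k * u)" if "G \<in> ?B" for G
    using that basic_gens_symmetries[OF I d]
    by (auto simp: generator_parameters classifying_equation_def heis_const add.commute intro!: general_field_symmetry[OF I d])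
  fix v1 v2 v3 s e \<beta>
  assume \<beta>: "smooth_on UNIV \<beta>" and E: "classifying_equation I (\<lambda>u. k * u) (\<lambda>u. k) v1 v2 v3 s e \<beta>"
  note sol = linear_solution[OF I(1,3) k E]
  have "gen_W \<beta> \<in> ?B" using sol(5) \<beta> by auto
  then show "general_field 0 0 0 0 v1 v2 v3 s e \<beta> \<in> vf_span I ?B"
    using vf_span_superset[of ?B I] sol by (intro general_field_mem[OF vf_subspace_span]) auto
qed auto

lemma symmetries_exp:
  assumes k: "k \<noteq> 0"
  shows "symmetries I (\<lambda>u. k * exp u) = vf_span I (basic_gens \<union> {gen_Z3})"
  (is "_ = vf_span I ?B")
proof (rule symmetries_eq_span[OF I])
  show d: "\<forall>u\<in>I. ((\<lambda>u. k * exp u) has_real_derivative k * exp u) (at u)" by (auto intro!: derivative_eq_intros)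
  show "G \<in> symmetries I (\<lambda>u. k * exp u)" if "G \<in> ?B" for G
    using that basic_gens_symmetries[OF I d]
    by (auto simp: generator_parameters classifying_equation_def heis_const intro!: general_field_symmetry[OF I d])
  fix v1 v2 v3 s e \<beta>
  assume \<beta>: "smooth_on UNIV \<beta>" and E: "classifying_equation I (\<lambda>u. k * exp u) (\<lambda>u. k * exp u) v1 v2 v3 s e \<beta>"
  note sol = exp_solution[OF I(1,3) k E]
  have "(\<lambda>w. s *\<^sub>R gen_Z3 w) \<in> vf_span I ?B"
    using vf_span_superset[of ?B I] by (intro vf_subspace_scale[OF vf_subspace_span]) auto
  moreover have "general_field 0 0 0 0 v1 v2 v3 s e \<beta> = (\<lambda>w. s *\<^sub>R gen_Z3 w)"
    by (auto simp: fun_eq_iff sol generator_parameters(12) general_field_components vec_eq_iff forall_3)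
  ultimately show "general_field 0 0 0 0 v1 v2 v3 s e \<beta> \<in> vf_span I ?B" by simp
qed auto

lemma symmetries_power:
  assumes k: "k \<noteq> 0" and p: "p \<noteq> 0" "p \<noteq> 1" and dom: "power_domain p I"
  shows "vf_span I basic_gens \<subset> symmetries I (\<lambda>u. k * real_power p u)"
    and "p \<noteq> 3 \<Longrightarrow> symmetries I (\<lambda>u. k * real_power p u) = vf_span I (basic_gens \<union> {gen_Z p})"
    and "p = 3 \<Longrightarrow> symmetries I (\<lambda>u. k * real_power p u) =
       vf_span I (basic_gens \<union> {gen_Z p, gen_V1, gen_V2, gen_V3})"
proof -
  let ?f = "\<lambda>u. k * real_power p u" and ?f' = "\<lambda>u. k * real_power_deriv p u"
  have d: "\<forall>u\<in>I. (?f has_real_derivative ?f' u) (at u)"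
    using real_power_facts(1)[OF dom _ p] by (auto intro!: derivative_eq_intros)
  have hom: "u * ?f' u = p * ?f u" if "u \<in> I" for u
    using real_power_facts(2)[OF dom that p] by (simp add: mult.left_commute)
  have ne: "?f u \<noteq> 0" if "u \<in> I" "u \<noteq> 0" for u
    using real_power_facts(3)[OF dom that(1) p that(2)] k by simp
  have Z: "gen_Z p \<in> symmetries I ?f"
    unfolding generator_parameters
  proof (rule general_field_symmetry[OF I d smooth_on_const], unfold classifying_equation_def, intro allI ballI)
    fix z u assume u: "u \<in> I"
    have "?f' u * ((2 / (1 - p) - conformal_weight 0 0 0 z) * u + 0) + kohn_laplace (\<lambda>_. 0) z
        - (2 / (1 - p) - 3 * conformal_weight 0 0 0 z - 2 * 1) * ?f u = 2 / (1 - p) * (u * ?f' u) - (2 / (1 - p) - 2) * ?f u"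
      by (simp add: heis_const)
    also have "\<dots> = (2 / (1 - p) * p - (2 / (1 - p) - 2)) * ?f u"
      unfolding hom[OF u] by (simp only: left_diff_distrib mult.assoc)
    also have "2 / (1 - p) * p - (2 / (1 - p) - 2) = 0" using p by (simp add: field_simps)
    finally show "?f' u * ((2 / (1 - p) - conformal_weight 0 0 0 z) * u + 0) + kohn_laplace (\<lambda>_. 0) z
        - (2 / (1 - p) - 3 * conformal_weight 0 0 0 z - 2 * 1) * ?f u = 0" by simp
  qed
  have V: "G \<in> symmetries I ?f" if "p = 3" "G \<in> {gen_V1, gen_V2, gen_V3}" for G
  proof -
    have "general_field 0 0 0 0 v1 v2 v3 0 0 (\<lambda>_. 0) \<in> symmetries I ?f" for v1 v2 v3
    proof (rule general_field_symmetry[OF I d smooth_on_const], unfold classifying_equation_def, intro allI ballI)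
      fix z u assume u: "u \<in> I"
      have "?f' u * ((0 - conformal_weight v1 v2 v3 z) * u + 0) + kohn_laplace (\<lambda>_. 0) z - (0 - 3 * conformal_weight v1 v2 v3 z - 2 * 0) * ?f u
        = conformal_weight v1 v2 v3 z * (3 * ?f u - u * ?f' u)" by (simp add: heis_const algebra_simps)
      also have "\<dots> = 0" unfolding hom[OF u] by (simp add: that(1))
      finally show "?f' u * ((0 - conformal_weight v1 v2 v3 z) * u + 0) + kohn_laplace (\<lambda>_. 0) z - (0 - 3 * conformal_weight v1 v2 v3 z - 2 * 0) * ?f u = 0" .
    qed
    then show ?thesis using that(2) by (auto simp: generator_parameters)
  qed
  obtain u where u: "u \<in> I" "u \<noteq> 0" by (rule nonzero_point)
  show "vf_span I basic_gens \<subset> symmetries I ?f"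
    by (rule basic_span_psubset[OF basic_span_subset[OF I d] Z u(1), of 0])
       (use u p in \<open>simp add: gen_Z_def vf_def\<close>)
  show "symmetries I ?f = vf_span I (basic_gens \<union> {gen_Z p})" (is "_ = vf_span I ?B") if "p \<noteq> 3"
  proof (rule symmetries_eq_span[OF I d])
    show "G \<in> symmetries I ?f" if "G \<in> ?B" for G
      using that basic_gens_symmetries[OF I d] Z by auto
    fix v1 v2 v3 s e \<beta>
    assume \<beta>: "smooth_on UNIV \<beta>" and E: "classifying_equation I ?f ?f' v1 v2 v3 s e \<beta>"
    note sol = power_type_solution[OF I(1,3) d hom ne p E]
    have "conformal_weight v1 v2 v3 z = ((p - 1) * e + 2 * s) / (p - 3)" for z
      using sol(2)[of z] \<open>p \<noteq> 3\<close> by (simp add: field_simps)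
    note c = conformal_weight_constant[OF this]
    have e: "e = s * (2 / (1 - p))" using c(4) \<open>p \<noteq> 3\<close> p by (simp add: field_simps)
    have "(\<lambda>w. s *\<^sub>R gen_Z p w) \<in> vf_span I ?B"
      using vf_span_superset[of ?B I] by (intro vf_subspace_scale[OF vf_subspace_span]) auto
    moreover have "general_field 0 0 0 0 v1 v2 v3 s e \<beta> = (\<lambda>w. s *\<^sub>R gen_Z p w)"
      by (auto simp: fun_eq_iff sol(1) c e generator_parameters(11) general_field_components vec_eq_iff forall_3)
    ultimately show "general_field 0 0 0 0 v1 v2 v3 s e \<beta> \<in> vf_span I ?B" by simp
  qed auto
  show "symmetries I ?f = vf_span I (basic_gens \<union> {gen_Z p, gen_V1, gen_V2, gen_V3})" (is "_ = vf_span I ?B") if "p = 3"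
  proof (rule symmetries_eq_span[OF I d])
    show "G \<in> symmetries I ?f" if "G \<in> ?B" for G
      using that basic_gens_symmetries[OF I d] Z V[OF \<open>p = 3\<close>] by auto
    fix v1 v2 v3 s e \<beta>
    assume \<beta>: "smooth_on UNIV \<beta>" and E: "classifying_equation I ?f ?f' v1 v2 v3 s e \<beta>"
    note sol = power_type_solution[OF I(1,3) d hom ne p E]
    have e: "e = - s" using sol(2)[of 0] \<open>p = 3\<close> by simp
    note W = vf_subspace_span[of I ?B]
    have "general_field 0 0 0 0 v1 v2 v3 0 0 (\<lambda>_. 0) \<in> vf_span I ?B"
      using vf_span_superset[of ?B I] vf_subspace_zero[OF W] by (intro general_field_mem[OF W]) (auto simp: gen_W_zero)
    moreover have "gen_Z p \<in> vf_span I ?B" using vf_span_superset[of ?B I] by auto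
    ultimately have "(\<lambda>w. general_field 0 0 0 0 v1 v2 v3 0 0 (\<lambda>_. 0) w + s *\<^sub>R gen_Z p w) \<in> vf_span I ?B"
      by (intro vf_subspace_add[OF W] vf_subspace_scale[OF W])
    then show "general_field 0 0 0 0 v1 v2 v3 s e \<beta> \<in> vf_span I ?B"
      by (rule vf_subspace_cong[OF W])
         (auto simp: sol(1) e \<open>p = 3\<close> generator_parameters(11) general_field_components vec_eq_iff forall_3 algebra_simps)
  qed auto
qed

end

theorem mainTheorem1:
  fixes I :: "real set"
  assumes "open I" "is_interval I" "I \<noteq> {}"
  shows
    \<comment> \<open>the equation in coordinates\<close>
    "(\<forall>(f :: real \<Rightarrow> real) U u z. open U \<and> smooth_on U u \<and> z \<in> U \<longrightarrow>
        kohn_laplace u z + f (u z) = heis_eq f (jet2_of u z))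
   \<and> \<comment> \<open>arbitrary nonlinearity\<close>
     (\<Inter>f\<in>{f. smooth_on I f}. symmetries I f) = vf_span I basic_gens
   \<and> \<comment> \<open>zero\<close>
     vf_span I basic_gens \<subset> symmetries I (\<lambda>_. 0)
   \<and> symmetries I (\<lambda>_. 0) =
       vf_span I (basic_gens \<union> {gen_V1, gen_V2, gen_V3, gen_Z1, gen_Z2}
         \<union> {gen_W \<beta> | \<beta>. smooth_on UNIV \<beta> \<and> (\<forall>z. kohn_laplace \<beta> z = 0)})
   \<and> \<comment> \<open>constant\<close>
     (\<forall>c. vf_span I basic_gens \<subset> symmetries I (\<lambda>_. c)
        \<and> (\<forall>U u v. open U \<and> smooth_on U u \<and> smooth_on U v
             \<and> (\<forall>z\<in>U. u z = v z - c * (z$1)^2 / 2) \<longrightarrow>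
             ((\<forall>z\<in>U. kohn_laplace u z + c = 0) \<longleftrightarrow> (\<forall>z\<in>U. kohn_laplace v z = 0))))
   \<and> \<comment> \<open>linear\<close>
     (\<forall>k. k \<noteq> 0 \<longrightarrow>
        vf_span I basic_gens \<subset> symmetries I (\<lambda>u. k * u)
        \<and> symmetries I (\<lambda>u. k * u) =
            vf_span I (basic_gens \<union> {gen_Z2}
              \<union> {gen_W \<beta> | \<beta>. smooth_on UNIV \<beta> \<and> (\<forall>z. kohn_laplace \<beta> z + k * \<beta> z = 0)}))
   \<and> \<comment> \<open>power\<close>
     (\<forall>k p. k \<noteq> 0 \<and> p \<noteq> 0 \<and> p \<noteq> 1 \<and> power_domain p I \<longrightarrow>
        vf_span I basic_gens \<subset> symmetries I (\<lambda>u. k * real_power p u)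
        \<and> (p \<noteq> 3 \<longrightarrow>
             symmetries I (\<lambda>u. k * real_power p u) = vf_span I (basic_gens \<union> {gen_Z p}))
        \<and> (p = 3 \<longrightarrow>
             symmetries I (\<lambda>u. k * real_power p u) =
               vf_span I (basic_gens \<union> {gen_Z p, gen_V1, gen_V2, gen_V3})))
   \<and> \<comment> \<open>exponential\<close>
     (\<forall>k. k \<noteq> 0 \<longrightarrow>
        vf_span I basic_gens \<subset> symmetries I (\<lambda>u. k * exp u)
        \<and> symmetries I (\<lambda>u. k * exp u) = vf_span I (basic_gens \<union> {gen_Z3}))"
proof -
  note I = assms
  obtain u0 where u0: "u0 \<in> I" "u0 \<noteq> 0" by (rule nonzero_point[OF I])
  have dc: "\<forall>u\<in>I. ((\<lambda>_. c) has_real_derivative 0) (at u)" for c :: real by simp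
  have const: "vf_span I basic_gens \<subset> symmetries I (\<lambda>_. c)" for c
  proof (rule basic_span_psubset[OF basic_span_subset[OF I dc] _ u0(1)])
    \<comment> \<open>adding a constant to \<open>u\<close> is a symmetry when \<open>f\<close> is constant\<close>
    show "gen_W (\<lambda>_. 1) \<in> symmetries I (\<lambda>_. c)"
      unfolding generator_parameters by (rule general_field_symmetry[OF I dc]) (auto simp: classifying_equation_def heis_const)
    show "snd (gen_W (\<lambda>_. 1) (0, u0)) \<noteq> 0" by (simp add: gen_W_def)
  qed
  have lin: "vf_span I basic_gens \<subset> symmetries I (\<lambda>u. k * u)" if "k \<noteq> 0" for k
  proof (rule basic_span_psubset[of I _ gen_Z2 u0 0])
    have d: "\<forall>u\<in>I. ((\<lambda>u. k * u) has_real_derivative (\<lambda>u. k) u) (at u)" by (auto intro!: derivative_eq_intros)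
    from basic_span_subset[OF I this] show "vf_span I basic_gens \<subseteq> symmetries I (\<lambda>u. k * u)" .
    have "gen_Z2 \<in> vf_span I (basic_gens \<union> {gen_Z2}
              \<union> {gen_W \<beta> | \<beta>. smooth_on UNIV \<beta> \<and> (\<forall>z. kohn_laplace \<beta> z + k * \<beta> z = 0)})"
      by (rule subsetD[OF vf_span_superset]) (rule UnI1, rule UnI2, rule singletonI)
    then show "gen_Z2 \<in> symmetries I (\<lambda>u. k * u)"
      unfolding symmetries_linear[OF I that] .
    show "snd (gen_Z2 (0, u0)) \<noteq> 0" using u0 by (simp add: gen_Z2_def vf_def)
  qed (rule u0)
  have exp: "vf_span I basic_gens \<subset> symmetries I (\<lambda>u. k * exp u)" if "k \<noteq> 0" for k
  proof (rule basic_span_psubset[of I _ gen_Z3 u0 0])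
    have d: "\<forall>u\<in>I. ((\<lambda>u. k * exp u) has_real_derivative (\<lambda>u. k * exp u) u) (at u)" by (auto intro!: derivative_eq_intros)
    from basic_span_subset[OF I this] show "vf_span I basic_gens \<subseteq> symmetries I (\<lambda>u. k * exp u)" .
    show "gen_Z3 \<in> symmetries I (\<lambda>u. k * exp u)"
      unfolding symmetries_exp[OF I that] by (rule subsetD[OF vf_span_superset]) simp
    show "snd (gen_Z3 (0, u0)) \<noteq> 0" by (simp add: gen_Z3_def vf_def)
  qed (rule u0)
  have shift: "(\<forall>z\<in>U. kohn_laplace u z + c = 0) \<longleftrightarrow> (\<forall>z\<in>U. kohn_laplace v z = 0)"
    if "open U \<and> smooth_on U u \<and> smooth_on U v \<and> (\<forall>z\<in>U. u z = v z - c * (z$1)^2 / 2)" for U u v c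
    using kohn_laplace_minus_square[of U u v c] that by simp
  show ?thesis
    apply (rule conjI)
     subgoal using kohn_laplace_jet by blast
    apply (rule conjI, rule symmetries_arbitrary[OF I])
    apply (rule conjI, rule const)
    apply (rule conjI, rule symmetries_zero[OF I])
    apply (rule conjI)
     subgoal by (intro allI impI conjI const) (rule shift)
    apply (rule conjI)
     subgoal by (intro allI impI conjI lin symmetries_linear[OF I])
    apply (rule conjI)
     subgoal by (intro allI impI conjI symmetries_power[OF I]) simp_all
    subgoal by (intro allI impI conjI exp symmetries_exp[OF I])
    done
qed

end
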